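(* Let $\Omega\subset\mathbb{R}^2$ be a bounded open set with Lipschitz boundary $\partial\Omega$, whose boundary is covered by compact portions $\partial\Omega_1,\dots,\partial\Omega_{N_{dev}}\subset\partial\Omega$ whose pairwise intersections are reduced to (finitely many) points, and let $x_1,\dots,x_{N_{dev}}\in\mathbb{R}^2$. Let $\mathcal{O}$ be an open set containing $\overline{\Omega}$, and for wavenumber $k$ let $u_i=u_i(\cdot;k)\in H^1_{loc}(\mathcal{O})$ be a solution of the homogeneous Helmholtz equation $\Delta u_i+k^2u_i=0$ in $\mathcal{O}$. Let $R=R_1\cup\dots\cup R_{N_{dev}}$, where $$R_j=\{x\in\mathbb{R}^2\mid |x-x_j|\le \max_{y\in\partial\Omega_j}|y-x_j|\}.$$ Let $K$ be a compact subset of $\mathbb{C}\setminus(-\infty,0]$ and $X$ a compact subset of $\mathbb{R}^2\setminus R$. For $j=1,\dots,N_{dev}$ and $m\in\mathbb{Z}$ define $$b_{j,m}=\frac{\mathrm{i}}{4}\int_{\partial\Omega_j}dS(y)\Big[-\frac{\partial u_i}{\partial\nu(y)}(y;k)\,U_m(y-x_j;k)+u_i(y;k)\,\frac{\partial U_m(y-x_j;k)}{\partial\nu(y)}\Big],\qquad U_m(x;k)=J_m(k|x|)\,e^{-\mathrm{i}m\arg(x)},$$ and let $$u_e^{(M)}(x;k)=\sum_{j=1}^{N_{dev}}\sum_{m=-M}^{M}b_{j,m}V_m(x-x_j;k),\qquad u_e(x;k)=\sum_{j=1}^{N_{dev}}\sum_{m=-\infty}^{\infty}b_{j,m}V_m(x-x_j;k).$$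 Then there exists a constant $C>0$ (which may depend on $K$, $X$, and on $u_i(\cdot;k)$ and $\partial u_i/\partial\nu(y)$ on $\partial\Omega$, and on $\Omega$, the $\partial\Omega_j$ and the $x_j$, but not on $M$ or $x$, and on $k\in K$ only through $u_i(\cdot;k)$ and its normal derivative on $\partial\Omega$) such that for any $(x,k)\in X\times K$ and any integer $M\ge 0$, $$\left|u_c(x;k)-u_e^{(M)}(x;k)\right|\le C\,\frac{a^{M+1}}{1-a},\qquad\text{where}\quad a=\max_{x\in X}\ \max_{j=1,\dots,N_{dev}}\ \max_{y\in\partial\Omega_j}\frac{|y-x_j|}{|x-x_j|}<1.$$ In particular, for any $x\notin R$ and $k\notin(-\infty,0]$, one has $u_c(x;k)=u_e(x;k)$.
   Context: $|\cdot|$ is the Euclidean norm on $\mathbb{R}^2$ (and the modulus on $\mathbb{C}$). $J_m$ is the Bessel function of the first kind of order $m$ and $H^{(1)}_m$ the Hankel function of the first kind of order $m$ (principal branch, cut along $(-\infty,0]$). For $x\in\mathbb{R}^2\setminus\{0\}$, $\arg(x)$ is the counter-clockwise angle of $x$ relative to $(1,0)$. The functions $U_m(\cdot;k)$ are understood to be extended smoothly to $x=0$. The multipolar sources are $$V_m(x;k)=e^{\mathrm{i}m\arg(x)}H^{(1)}_m(k|x|).$$ The Green function is $G(x;k)=\frac{\mathrm{i}}{4}H^{(1)}_0(k|x|)$. $H^1_{loc}(\mathcal{O})$ is the set of functions that are $H^1$ on every bounded open subset whose closure lies in $\mathcal{O}$; the Helmholtz equation is understood in the sense of distributions. By interior elliptic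 regularity such $u_i$ is $C^\infty$ on $\overline{\Omega}$, so the traces of $u_i$ and $\partial u_i/\partial\nu$ on $\partial\Omega$ are well defined and in $L^\infty(\partial\Omega)$. $\nu(y)$ is the outward unit normal vector to $\partial\Omega$ at $y$ (defined for almost every $y\in\partial\Omega$), $\partial/\partial\nu(y)$ is the derivative with respect to $y$ in the direction $\nu(y)$, and $dS$ is arc-length measure. The (ideal) cloak field $u_c$ is defined for $x\notin\partial\Omega$ by $$u_c(x;k)=\int_{\partial\Omega}dS(y)\Big[-\frac{\partial u_i}{\partial\nu(y)}(y;k)\,G(x-y;k)+u_i(y;k)\,\frac{\partial G}{\partial\nu(y)}(x-y;k)\Big];$$ by the Green identities it equals $-u_i$ in $\Omega$ and $0$ outside $\overline{\Omega}$. *)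

theory Defs
  imports "HOL-Analysis.Analysis"
begin

definition bessel_J_nat :: "nat \<Rightarrow> complex \<Rightarrow> complex" where
  "bessel_J_nat n z =
     (\<Sum>p. (-1) ^ p / (fact p * fact (n + p)) * (z / 2) ^ (n + 2 * p))"

(* Bessel function of the second kind: the classical series for integer order, with the
   logarithm on its principal branch, which puts the cut on the nonpositive real axis. *)
definition bessel_Y_nat :: "nat \<Rightarrow> complex \<Rightarrow> complex" where
  "bessel_Y_nat n z =
     2 / of_real pi * (Ln (z / 2) + euler_mascheroni) * bessel_J_nat n z
     - 1 / of_real pi * (\<Sum>p<n. fact (n - 1 - p) / fact p * (2 / z) ^ n * (z / 2) ^ (2 * p))
     - 1 / of_real pi * (\<Sum>p. (-1) ^ p / (fact p * fact (n + p)) * (z / 2) ^ (n + 2 * p)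
                               * (harm p + harm (n + p)))"

definition bessel_J :: "int \<Rightarrow> complex \<Rightarrow> complex" where
  "bessel_J m z = (if m \<ge> 0 then bessel_J_nat (nat m) z
                   else (-1) ^ nat (-m) * bessel_J_nat (nat (-m)) z)"

definition bessel_Y :: "int \<Rightarrow> complex \<Rightarrow> complex" where
  "bessel_Y m z = (if m \<ge> 0 then bessel_Y_nat (nat m) z
                   else (-1) ^ nat (-m) * bessel_Y_nat (nat (-m)) z)"

definition hankel1 :: "int \<Rightarrow> complex \<Rightarrow> complex" where
  "hankel1 m z = bessel_J m z + \<i> * bessel_Y m z"

definition polar_angle :: "real ^ 2 \<Rightarrow> real" where
  "polar_angle x = Arg (Complex (x $ 1) (x $ 2))"

(* As Arg 0 = 0, this formula takes at x = 0 the value 1 for m = 0 and the value 0 for all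
   other m, so that it already is the smooth extension to the origin. *)
definition U_wave :: "int \<Rightarrow> complex \<Rightarrow> real ^ 2 \<Rightarrow> complex" where
  "U_wave m k x = bessel_J m (k * of_real (norm x)) * exp (- \<i> * of_int m * of_real (polar_angle x))"

definition V_wave :: "int \<Rightarrow> complex \<Rightarrow> real ^ 2 \<Rightarrow> complex" where
  "V_wave m k x = exp (\<i> * of_int m * of_real (polar_angle x)) * hankel1 m (k * of_real (norm x))"

definition green :: "complex \<Rightarrow> real ^ 2 \<Rightarrow> complex" where
  "green k x = \<i> / 4 * hankel1 0 (k * of_real (norm x))"

(* In some orthonormal frame (e1, e2) at each boundary point, S is locally the subgraph
   of a Lipschitz function. *)
definition lipschitz_boundary :: "(real ^ 2) set \<Rightarrow> bool" where
  "lipschitz_boundary S \<longleftrightarrow>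
     (\<forall>p\<in>frontier S. \<exists>e1 e2 :: real ^ 2. \<exists>h :: real \<Rightarrow> real. \<exists>L r.
        norm e1 = 1 \<and> norm e2 = 1 \<and> e1 \<bullet> e2 = 0 \<and> L-lipschitz_on UNIV h \<and> r > 0 \<and>
        (\<forall>z\<in>ball p r. z \<in> S \<longleftrightarrow> z \<bullet> e2 < h (z \<bullet> e1)))"

(* n is the outward unit normal at the boundary point y: at first order around y, the set S
   is the half-plane {z. (z - y) \<bullet> n < 0}. If S is locally the subgraph of a function h, this
   holds for some n exactly where h is differentiable. *)
definition is_outward_normal :: "(real ^ 2) set \<Rightarrow> real ^ 2 \<Rightarrow> real ^ 2 \<Rightarrow> bool" where
  "is_outward_normal S y n \<longleftrightarrow>
     y \<in> frontier S \<and> norm n = 1 \<and>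
     (\<forall>e>0. \<exists>d>0. \<forall>z\<in>ball y d.
        ((z - y) \<bullet> n < - e * norm (z - y) \<longrightarrow> z \<in> S) \<and>
        ((z - y) \<bullet> n > e * norm (z - y) \<longrightarrow> z \<notin> S))"

(* The value 0 is used on the set of boundary points without a normal, which is null for a
   Lipschitz boundary. *)
definition outward_normal :: "(real ^ 2) set \<Rightarrow> real ^ 2 \<Rightarrow> real ^ 2" where
  "outward_normal S y =
     (if \<exists>n. is_outward_normal S y n then THE n. is_outward_normal S y n else 0)"

definition normal_deriv :: "(real ^ 2) set \<Rightarrow> (real ^ 2 \<Rightarrow> complex) \<Rightarrow> real ^ 2 \<Rightarrow> complex" where
  "normal_deriv S f y = vector_derivative (\<lambda>t. f (y + t *\<^sub>R outward_normal S y)) (at 0)"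

definition hausdorff1_outer :: "'a :: metric_space set \<Rightarrow> ennreal" where
  "hausdorff1_outer A =
     (SUP \<delta>\<in>{0::real<..}. INF C\<in>{C :: nat \<Rightarrow> 'a set. A \<subseteq> (\<Union>i. C i) \<and>
                                     (\<forall>i. bounded (C i) \<and> diameter (C i) \<le> \<delta>)}.
        \<Sum>i. ennreal (diameter (C i)))"

(* One-dimensional Hausdorff measure on the Borel sets, where it is countably additive by
   Caratheodory's criterion. On a Lipschitz curve it is the arc-length measure. *)
definition arc_length :: "(real ^ 2) measure" where
  "arc_length = measure_of UNIV (sets borel) hausdorff1_outer"

definition partial_deriv :: "2 \<Rightarrow> (real ^ 2 \<Rightarrow> complex) \<Rightarrow> real ^ 2 \<Rightarrow> complex" where
  "partial_deriv i f x = frechet_derivative f (at x) (axis i 1)"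

definition smooth :: "(real ^ 2 \<Rightarrow> complex) \<Rightarrow> bool" where
  "smooth f \<longleftrightarrow> (\<forall>is x. foldr partial_deriv is f differentiable (at x))"

definition test_functions :: "(real ^ 2) set \<Rightarrow> (real ^ 2 \<Rightarrow> complex) set" where
  "test_functions W =
     {\<phi>. smooth \<phi> \<and> compact (closure {x. \<phi> x \<noteq> 0}) \<and> closure {x. \<phi> x \<noteq> 0} \<subseteq> W}"

definition L2_on :: "(real ^ 2) set \<Rightarrow> (real ^ 2 \<Rightarrow> complex) set" where
  "L2_on W = {f. f \<in> borel_measurable (lebesgue_on W) \<and>
                 integrable (lebesgue_on W) (\<lambda>x. (cmod (f x))\<^sup>2)}"

definition H1_on :: "(real ^ 2) set \<Rightarrow> (real ^ 2 \<Rightarrow> complex) set" where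
  "H1_on W = {u. u \<in> L2_on W \<and>
     (\<forall>i. \<exists>g\<in>L2_on W. \<forall>\<phi>\<in>test_functions W.
        (LINT x|lebesgue_on W. u x * partial_deriv i \<phi> x) = - (LINT x|lebesgue_on W. g x * \<phi> x))}"

definition H1_loc :: "(real ^ 2) set \<Rightarrow> (real ^ 2 \<Rightarrow> complex) set" where
  "H1_loc D = {u. \<forall>W. open W \<and> bounded W \<and> closure W \<subseteq> D \<longrightarrow> u \<in> H1_on W}"

definition laplacian :: "(real ^ 2 \<Rightarrow> complex) \<Rightarrow> real ^ 2 \<Rightarrow> complex" where
  "laplacian \<phi> x = (\<Sum>i\<in>UNIV. partial_deriv i (partial_deriv i \<phi>) x)"

definition weak_helmholtz :: "(real ^ 2) set \<Rightarrow> complex \<Rightarrow> (real ^ 2 \<Rightarrow> complex) \<Rightarrow> bool" where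
  "weak_helmholtz D k u \<longleftrightarrow>
     (\<forall>\<phi>\<in>test_functions D. (LINT x|lebesgue_on D. u x * (laplacian \<phi> x + k\<^sup>2 * \<phi> x)) = 0)"

(* Elements of H1_loc are only determined up to null sets. Pointwise values and normal
   derivatives on curves inside the open set D are those of the representative that is
   continuous on D (unique on D; for Helmholtz solutions it exists and is smooth on D by
   interior elliptic regularity). *)
definition continuous_rep :: "(real ^ 2) set \<Rightarrow> (real ^ 2 \<Rightarrow> complex) \<Rightarrow> real ^ 2 \<Rightarrow> complex" where
  "continuous_rep D u = (SOME v. continuous_on D v \<and> (AE x in lebesgue_on D. v x = u x))"

(* In the remaining definitions v is the pointwise defined (smooth) incident field,
   S the cloaked region, \<Gamma> j the portions of its boundary, and c j the device locations. *)

definition cloak_field ::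
    "(real ^ 2) set \<Rightarrow> (real ^ 2 \<Rightarrow> complex) \<Rightarrow> complex \<Rightarrow> real ^ 2 \<Rightarrow> complex" where
  "cloak_field S v k x =
     (LINT y:frontier S|arc_length.
        - normal_deriv S v y * green k (x - y)
        + v y * normal_deriv S (\<lambda>y. green k (x - y)) y)"

definition multipole_coeff ::
    "(real ^ 2) set \<Rightarrow> (nat \<Rightarrow> (real ^ 2) set) \<Rightarrow> (nat \<Rightarrow> real ^ 2) \<Rightarrow> (real ^ 2 \<Rightarrow> complex) \<Rightarrow> complex
      \<Rightarrow> nat \<Rightarrow> int \<Rightarrow> complex" where
  "multipole_coeff S \<Gamma> c v k j m =
     \<i> / 4 * (LINT y:\<Gamma> j|arc_length.
        - normal_deriv S v y * U_wave m k (y - c j)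
        + v y * normal_deriv S (\<lambda>y. U_wave m k (y - c j)) y)"

definition device_field_trunc ::
    "(real ^ 2) set \<Rightarrow> nat \<Rightarrow> (nat \<Rightarrow> (real ^ 2) set) \<Rightarrow> (nat \<Rightarrow> real ^ 2) \<Rightarrow> (real ^ 2 \<Rightarrow> complex)
      \<Rightarrow> complex \<Rightarrow> nat \<Rightarrow> real ^ 2 \<Rightarrow> complex" where
  "device_field_trunc S N \<Gamma> c v k M x =
     (\<Sum>j=1..N. \<Sum>m=-int M..int M. multipole_coeff S \<Gamma> c v k j m * V_wave m k (x - c j))"

definition device_field ::
    "(real ^ 2) set \<Rightarrow> nat \<Rightarrow> (nat \<Rightarrow> (real ^ 2) set) \<Rightarrow> (nat \<Rightarrow> real ^ 2) \<Rightarrow> (real ^ 2 \<Rightarrow> complex)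
      \<Rightarrow> complex \<Rightarrow> real ^ 2 \<Rightarrow> complex" where
  "device_field S N \<Gamma> c v k x =
     (\<Sum>j=1..N. \<Sum>\<^sub>\<infinity>m\<in>UNIV. multipole_coeff S \<Gamma> c v k j m * V_wave m k (x - c j))"

definition device_region :: "nat \<Rightarrow> (nat \<Rightarrow> (real ^ 2) set) \<Rightarrow> (nat \<Rightarrow> real ^ 2) \<Rightarrow> (real ^ 2) set" where
  "device_region N \<Gamma> c =
     (\<Union>j\<in>{1..N}. {x. norm (x - c j) \<le> (SUP y\<in>\<Gamma> j. norm (y - c j))})"

(* For nonempty compact portions \<Gamma> j, and X nonempty, compact and disjoint from the device
   region, the suprema here and in device_region are attained. *)
definition expansion_ratio ::
    "nat \<Rightarrow> (nat \<Rightarrow> (real ^ 2) set) \<Rightarrow> (nat \<Rightarrow> real ^ 2) \<Rightarrow> (real ^ 2) set \<Rightarrow> real" where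
  "expansion_ratio N \<Gamma> c X =
     (SUP x\<in>X. MAX j\<in>{1..N}. SUP y\<in>\<Gamma> j. norm (y - c j) / norm (x - c j))"

end

theory Submission
  imports Defs
begin

text \<open>
The difference between the cloak field and the truncated device field is, for each portion of the
boundary, the boundary integral of the traces of the incident field against the tail of a series.
Indeed Graf's addition theorem, for \<open>\<bar>y\<bar> < \<bar>x\<bar>\<close>,
  \<open>green k (x - y) = \<i> / 4 * (\<Sum>m. V_wave m k x * U_wave m k y)\<close>,
taken with \<open>x - c j\<close> and \<open>y - c j\<close>, turns the coefficients \<open>multipole_coeff\<close> into the
coefficients of the expansion of the layer potentials over \<open>\<Gamma> j\<close>; for \<open>x\<close> outside the device
region the condition \<open>\<bar>y - c j\<bar> < \<bar>x - c j\<bar>\<close> holds on the whole portion. A portion enters through the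
numbers \<open>\<bar>y - c j\<bar> \<le> a * \<bar>x - c j\<bar>\<close> only, so the tail of the series after \<open>M\<close> terms is a geometric
tail in \<open>a\<close>, uniformly for \<open>(x, k)\<close> in a compact set.

The addition theorem is obtained by a homotopy (\<open>graf_homotopy_deriv\<close>, \<open>graf_addition\<close>). Move the
point \<open>z\<close> along the segment \<open>z - s w\<close> and at the same time \<open>w\<close> along \<open>(1 - s) w\<close>: the
difference of the two points stays \<open>z - w\<close>, so the full sum ought to be constant. For the sum over
\<open>\<bar>m\<bar> \<le> M\<close>, the derivative in \<open>s\<close> telescopes, because differentiation shifts the order of both kinds
of waves by one, and what remains are four products of waves of order about \<open>\<plusminus>M\<close>. These are
\<open>O(M^2 * (\<bar>w\<bar> / \<bar>z\<bar>)^M)\<close>. At \<open>s = 1\<close> only the term \<open>m = 0\<close> is left, since the regular waves of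
nonzero order vanish at the origin. The derivative of the expansion in \<open>y\<close> is again of this kind, with
orders shifted by one. All that is used about Bessel and Hankel functions are the first derivative,
the three-term recurrence, and the growth bounds \<open>norm_bessel_wave_le\<close> and \<open>norm_hankel_wave_le\<close>,
whose factorials cancel in the products; all of them are read off from the defining series.

The terms of the differentiated series carry one power of \<open>a\<close> less, so their tail is only
\<open>a ^ M / (1 - a)\<close>. For \<open>a > 0\<close> a factor \<open>1 / a\<close> in the constant repairs this, the number \<open>a\<close> being
determined by \<open>X\<close> and the geometry. For \<open>a = 0\<close> every portion consists of its device location
alone, and there is nothing to integrate.

The estimate is integrated over the boundary (\<open>multipole_expansion_error\<close>). A Lipschitz boundary is
locally a Lipschitz image of an interval, hence of finite length; points are null sets, so the portions
can be treated as disjoint; the outward normal is a Borel function. The traces are bounded because the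
continuous representative of a weak solution is continuously differentiable
(\<open>helmholtz_continuous_rep_C1\<close>). This is Weyl's lemma for the Helmholtz equation: as test functions
one takes explicit regularisations of a truncated parametrix, whose image under the Helmholtz operator
is an approximate identity plus a remainder with a continuously differentiable limit. The weak
equation then says that the solution is locally a multiple of its convolution with that limit.

Consequently the error is at most \<open>C * (\<integral> \<bar>f\<bar> + \<bar>g\<bar>) * a ^ (M + 1) / (1 - a)\<close> with \<open>f\<close> and \<open>g\<close> the traces of
the field and of its normal derivative; adding \<open>1\<close> to the product in front makes it a positive function of
the two traces. The equality of the fields follows with \<open>X = {x}\<close>, \<open>K = {k}\<close> and \<open>M \<longlonglongrightarrow> \<infinity>\<close>.
\<close>

section \<open>Power series behind the Bessel functions\<close>

text \<open>With \<open>t = (z / 2)\<^sup>2\<close>, the Bessel function of order \<open>n\<close> is \<open>(z / 2) ^ n * bessel_phi n t\<close>, and the Bessel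
function of the second kind is a linear combination of its product with \<open>Ln (z / 2) + euler_mascheroni\<close>, \<open>(2 / z) ^ n * bessel_polar n t\<close>
and \<open>(z / 2) ^ n * bessel_psi n t\<close>. The three functions are entire, so the singularity at the origin
sits in explicit factors.\<close>
definition bessel_phi :: "nat \<Rightarrow> complex \<Rightarrow> complex" where
  "bessel_phi n t = (\<Sum>p. (-1) ^ p / (fact p * fact (n + p)) * t ^ p)"

definition bessel_psi :: "nat \<Rightarrow> complex \<Rightarrow> complex" where
  "bessel_psi n t = (\<Sum>p. (-1) ^ p / (fact p * fact (n + p)) * (harm p + harm (n + p)) * t ^ p)"

definition bessel_polar :: "nat \<Rightarrow> complex \<Rightarrow> complex" where
  "bessel_polar n t = (\<Sum>p<n. fact (n - 1 - p) / fact p * t ^ p)"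

lemma norm_harm_le: "norm (harm n :: complex) \<le> real n"
proof -
  have "norm (harm n :: complex) \<le> (\<Sum>k=1..n. norm (inverse (of_nat k) :: complex))"
    unfolding harm_def by (rule norm_sum)
  also have "\<dots> \<le> (\<Sum>k=1..n. 1)"
    by (rule sum_mono) (auto simp: norm_inverse divide_simps Suc_le_eq norm_divide)
  finally show ?thesis by simp
qed

lemma phi_coeff_le:
  "norm ((-1) ^ p / (fact p * fact (n + p)) :: complex) \<le> 1 / fact n / fact p"
proof -
  have "norm ((-1) ^ p / (fact p * fact (n + p)) :: complex) = 1 / fact (n + p) / fact p"
    by (simp add: norm_divide norm_mult norm_power)
  also have "\<dots> \<le> 1 / fact n / fact p"
    by (intro divide_right_mono divide_left_mono fact_mono) auto
  finally show ?thesis .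
qed

lemma psi_coeff_le:
  "norm ((-1) ^ p / (fact p * fact (n + p)) * (harm p + harm (n + p)) :: complex)
     \<le> 2 / fact (n - 1) / fact p"
proof -
  have h: "norm (harm p + harm (n + p) :: complex) \<le> 2 * real (n + p)"
    using norm_triangle_ineq[of "harm p :: complex" "harm (n+p)"] norm_harm_le[of p] norm_harm_le[of "n+p"]
    by simp
  have f: "real (n + p) / fact (n + p) \<le> 1 / fact (n - 1)"
  proof (cases "n + p")
    case 0 then show ?thesis by simp
  next
    case (Suc q)
    have "(fact (n - 1) :: real) \<le> fact q" using Suc by (intro fact_mono) auto
    moreover have "real (n+p) / fact (n+p) = 1 / fact q" unfolding Suc by (simp add: divide_simps)
    ultimately show ?thesis by (simp add: frac_le)
  qed
  have "norm ((-1) ^ p / (fact p * fact (n + p)) * (harm p + harm (n + p)) :: complex)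
     = norm (harm p + harm (n + p) :: complex) / fact (n + p) / fact p"
    by (simp add: norm_divide norm_mult norm_power)
  also have "\<dots> \<le> 2 * real (n + p) / fact (n + p) / fact p"
    by (intro divide_right_mono h) auto
  also have "\<dots> = 2 * (real (n + p) / fact (n + p)) / fact p" by simp
  also have "\<dots> \<le> 2 * (1 / fact (n - 1)) / fact p"
    by (intro divide_right_mono mult_left_mono f) auto
  finally show ?thesis by simp
qed

text \<open>Both infinite series have coefficients \<open>O(1 / fact p)\<close>; the constants \<open>1 / fact n\<close> and
\<open>2 / fact (n - 1)\<close> keep the dependence on the order, which later cancels the factorial growth of the
Hankel functions.\<close>
lemma power_series_fact_bound:
  fixes c :: "nat \<Rightarrow> complex"
  assumes "\<And>p. norm (c p) \<le> C / fact p"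
  shows "summable (\<lambda>p. c p * t ^ p)" and "norm (\<Sum>p. c p * t ^ p) \<le> C * exp (norm t)"
proof -
  have s: "(\<lambda>p. C * (norm t ^ p / fact p)) sums (C * exp (norm t))"
    using exp_converges[of "norm t"] by (intro sums_mult) (simp add: divide_inverse mult.commute)
  have le: "norm (c p * t ^ p) \<le> C * (norm t ^ p / fact p)" for p
    using mult_right_mono[OF assms[of p], of "norm t ^ p"] by (simp add: norm_mult norm_power)
  show "summable (\<lambda>p. c p * t ^ p)"
    by (rule summable_comparison_test'[OF sums_summable[OF s], of 0]) (use le in auto)
  have "norm (\<Sum>p. c p * t ^ p) \<le> (\<Sum>p. C * (norm t ^ p / fact p))"
    by (rule order_trans[OF summable_norm suminf_le])
       (use le s summable_comparison_test'[OF sums_summable[OF s], of 0 "\<lambda>p. norm (c p * t ^ p)"] in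
         \<open>auto dest: sums_summable\<close>)
  then show "norm (\<Sum>p. c p * t ^ p) \<le> C * exp (norm t)" using s by (simp add: sums_iff)
qed

lemmas phi_summable = power_series_fact_bound(1)[OF phi_coeff_le]
lemmas psi_summable = power_series_fact_bound(1)[OF psi_coeff_le]

lemma norm_phi_le: "norm (bessel_phi n t) \<le> exp (norm t) / fact n"
  using power_series_fact_bound(2)[OF phi_coeff_le, of n t] unfolding bessel_phi_def by (rule order_trans) simp

lemma norm_psi_le: "norm (bessel_psi n t) \<le> 2 * exp (norm t) / fact (n - 1)"
  using power_series_fact_bound(2)[OF psi_coeff_le, of n t] unfolding bessel_psi_def by (rule order_trans) simp

lemma norm_polar_le: "norm (bessel_polar n t) \<le> fact (n - 1) * exp (norm t)"
proof -
  have "norm (bessel_polar n t) \<le> (\<Sum>p<n. fact (n - 1 - p) / fact p * norm t ^ p)"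
    unfolding bessel_polar_def by (rule order_trans[OF norm_sum]) (simp add: norm_mult norm_divide norm_power)
  also have "\<dots> \<le> (\<Sum>p<n. fact (n - 1) * (norm t ^ p / fact p))"
    by (intro sum_mono) (simp add: divide_simps mult_right_mono fact_mono)
  also have "\<dots> = fact (n - 1) * (\<Sum>p<n. norm t ^ p / fact p)" by (simp add: sum_distrib_left)
  also have "(\<Sum>p<n. norm t ^ p / fact p) \<le> exp (norm t)"
    using exp_converges[of "norm t"]
    by (intro order_trans[OF sum_le_suminf[of "\<lambda>p. norm t ^ p / fact p" "{..<n}"]])
       (auto simp: sums_iff divide_inverse mult.commute)
  finally show ?thesis by simp
qed

lemma phi_deriv: "(bessel_phi n has_field_derivative - bessel_phi (Suc n) t) (at t)"
proof -
  let ?c = "\<lambda>p. (-1) ^ p / (fact p * fact (n + p)) :: complex"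
  have "((\<lambda>t. \<Sum>p. ?c p * t ^ p) has_field_derivative (\<Sum>p. diffs ?c p * t ^ p)) (at t)"
    by (rule termdiffs_strong_converges_everywhere) (rule phi_summable)
  moreover have "diffs ?c p = - ((-1) ^ p / (fact p * fact (Suc n + p)))" for p
    by (simp add: diffs_def divide_simps del: of_nat_Suc)
  ultimately show ?thesis
    using phi_summable[of "Suc n" t] unfolding bessel_phi_def[abs_def]
    by (simp add: suminf_minus)
qed

lemma phi_shift:
  "(\<lambda>p. (-1) ^ p / (fact (Suc p) * fact (Suc (n + p))) * t ^ Suc p) sums (1 / fact n - bessel_phi n t)"
proof -
  have "(\<lambda>p. (-1) ^ p / (fact p * fact (n + p)) * t ^ p) sums bessel_phi n t"
    using phi_summable[of n t] by (simp add: bessel_phi_def sums_iff)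
  from sums_minus[OF sums_split_initial_segment[OF this, of 1]] show ?thesis by simp
qed

text \<open>At \<open>t = 0\<close> the right-hand side does not determine the derivative, hence the factor in front of \<open>d\<close>. The
term \<open>bessel_phi n t - 1 / fact n\<close> comes from
\<open>harm (Suc p) = harm p + 1 / Suc p\<close>; together with the corresponding term of \<open>bessel_polar\<close> it is
cancelled by the derivative of the logarithm.\<close>
lemma psi_deriv:
  "\<exists>d. (bessel_psi n has_field_derivative d) (at t) \<and>
       t * d = bessel_phi n t - 1 / fact n - t * bessel_psi (Suc n) t"
proof -
  let ?c = "\<lambda>p. (-1) ^ p / (fact p * fact (n + p)) * (harm p + harm (n + p)) :: complex"
  let ?c' = "\<lambda>p. (-1) ^ p / (fact p * fact (Suc n + p)) * (harm p + harm (Suc n + p)) :: complex"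
  have 1: "((\<lambda>t. \<Sum>p. ?c p * t ^ p) has_field_derivative (\<Sum>p. diffs ?c p * t ^ p)) (at t)"
    by (rule termdiffs_strong_converges_everywhere) (rule psi_summable)
  have h: "harm (Suc p) = (harm p + 1 / of_nat (Suc p) :: complex)" for p
    by (simp add: harm_Suc divide_inverse)
  have "t * (diffs ?c p * t ^ p) =
      - ((-1) ^ p / (fact (Suc p) * fact (Suc (n + p))) * t ^ Suc p) - t * (?c' p * t ^ p)" for p
    unfolding diffs_def h add_Suc add_Suc_right fact_Suc
    by (simp add: field_simps del: of_nat_Suc)
  moreover have "(\<lambda>p. - ((-1) ^ p / (fact (Suc p) * fact (Suc (n + p))) * t ^ Suc p) - t * (?c' p * t ^ p))
      sums (- (1 / fact n - bessel_phi n t) - t * bessel_psi (Suc n) t)"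
    by (intro sums_diff sums_minus phi_shift sums_mult)
       (use psi_summable[of "Suc n" t] in \<open>simp add: bessel_psi_def sums_iff\<close>)
  ultimately have 2: "(\<lambda>p. t * (diffs ?c p * t ^ p)) sums (- (1 / fact n - bessel_phi n t) - t * bessel_psi (Suc n) t)"
    by simp
  have "summable (\<lambda>p. diffs ?c p * t ^ p)"
    by (rule termdiff_converges_all) (rule psi_summable)
  then have "(\<lambda>p. t * (diffs ?c p * t ^ p)) sums (t * (\<Sum>p. diffs ?c p * t ^ p))"
    by (intro sums_mult summable_sums)
  then have "t * (\<Sum>p. diffs ?c p * t ^ p) = - (1 / fact n - bessel_phi n t) - t * bessel_psi (Suc n) t"
    using 2 sums_unique2 by blast
  moreover have "(bessel_psi n has_field_derivative (\<Sum>p. diffs ?c p * t ^ p)) (at t)"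
    using 1 unfolding bessel_psi_def[abs_def] .
  ultimately show ?thesis by (intro exI conjI) (assumption, simp)
qed

lemma polar_deriv:
  "\<exists>d. (bessel_polar n has_field_derivative d) (at t) \<and>
       t * d = of_nat n * bessel_polar n t - bessel_polar (Suc n) t + t ^ n / fact n"
proof -
  let ?d = "\<Sum>p<n. fact (n - 1 - p) / fact p * (of_nat p * t ^ (p - 1))"
  have "(bessel_polar n has_field_derivative ?d) (at t)"
    unfolding bessel_polar_def[abs_def] by (rule DERIV_sum) (auto intro!: derivative_eq_intros)
  moreover have "t * ?d = of_nat n * bessel_polar n t - (\<Sum>p<n. fact (n - p) / fact p * t ^ p)"
  proof -
    have "t * (fact (n - 1 - p) / fact p * (of_nat p * t ^ (p - 1))) =
        of_nat n * (fact (n - 1 - p) / fact p * t ^ p) - fact (n - p) / fact p * t ^ p" if "p < n" for p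
    proof -
      obtain m where n: "n = Suc (p + m)" using less_imp_Suc_add[OF \<open>p < n\<close>] by auto
      have a: "t * (of_nat p * t ^ (p - 1)) = of_nat p * t ^ p" by (cases p) (simp_all del: of_nat_Suc)
      have "t * (fact m / fact p * (of_nat p * t ^ (p - 1))) = fact m / fact p * (of_nat p * t ^ p)"
        by (simp only: mult.left_commute[of t "fact m / fact p"] a)
      moreover have "of_nat n = of_nat (Suc m) + (of_nat p :: complex)" unfolding n by simp
      moreover have "n - 1 - p = m" "n - p = Suc m" unfolding n by auto
      ultimately show ?thesis
        by (simp only: fact_Suc) (simp add: distrib_right add_divide_distrib del: of_nat_Suc)
    qed
    then show ?thesis unfolding bessel_polar_def sum_distrib_left sum_subtractf[symmetric] by (intro sum.cong) auto
  qed
  moreover have "(\<Sum>p<n. fact (n - p) / fact p * t ^ p) = bessel_polar (Suc n) t - t ^ n / fact n"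
    by (simp add: bessel_polar_def)
  ultimately show ?thesis by (intro exI conjI) (assumption, simp)
qed

text \<open>Comparison of coefficients: the factor \<open>of_nat (Suc n)\<close> is chosen such that the constant terms cancel,
which leaves a series that starts at \<open>t\<close>.\<close>
lemma phi_rec: "bessel_phi n t + t * bessel_phi (Suc (Suc n)) t = of_nat (Suc n) * bessel_phi (Suc n) t"
proof -
  have s: "(\<lambda>p. (-1) ^ p / (fact p * fact (n + p)) * t ^ p) sums bessel_phi n t" for n
    using phi_summable[of n t] by (simp add: bessel_phi_def sums_iff)
  have "(\<lambda>p. of_nat (Suc n) * ((-1) ^ p / (fact p * fact (Suc n + p)) * t ^ p)
       - (-1) ^ p / (fact p * fact (n + p)) * t ^ p) sums (of_nat (Suc n) * bessel_phi (Suc n) t - bessel_phi n t)"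
    (is "?f sums ?s") by (intro sums_diff sums_mult s)
  from sums_split_initial_segment[OF this, of 1]
  have "(\<lambda>p. ?f (Suc p)) sums (?s - ?f 0)" by simp
  moreover have "?f 0 = 0" by (simp add: divide_simps del: of_nat_Suc)
  moreover have "?f (Suc p) = t * ((-1) ^ p / (fact p * fact (Suc (Suc n) + p)) * t ^ p)" for p
  proof -
    define P Q Q' :: complex where "P = of_nat (Suc p)" and "Q = of_nat (Suc (n + p))" and "Q' = of_nat (Suc (Suc (n + p)))"
    have nz: "P \<noteq> 0" "Q \<noteq> 0" "Q' \<noteq> 0" unfolding P_def Q_def Q'_def by (simp_all del: of_nat_Suc)
    \<comment> \<open>In terms of \<open>P\<close>, \<open>Q\<close> and \<open>Q'\<close> the claim is a rational identity without factorials.\<close>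
    have N: "of_nat (Suc n) = Q' - P" unfolding P_def Q'_def by (simp)
    show ?thesis
      unfolding add_Suc add_Suc_right fact_Suc N
        P_def[symmetric] Q_def[symmetric] Q'_def[symmetric] power_Suc
      using nz by (simp add: field_simps)
  qed
  ultimately have "(\<lambda>p. t * ((-1) ^ p / (fact p * fact (Suc (Suc n) + p)) * t ^ p)) sums ?s" by simp
  moreover have "(\<lambda>p. t * ((-1) ^ p / (fact p * fact (Suc (Suc n) + p)) * t ^ p)) sums (t * bessel_phi (Suc (Suc n)) t)"
    by (intro sums_mult s)
  ultimately show ?thesis using sums_unique2 by (metis diff_add_cancel add.commute)
qed

lemma psi_rec: "bessel_psi n t + t * bessel_psi (Suc (Suc n)) t
    = of_nat (Suc n) * bessel_psi (Suc n) t - 1 / fact (Suc n)"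
proof -
  let ?c = "\<lambda>n p. (-1) ^ p / (fact p * fact (n + p)) * (harm p + harm (n + p)) * t ^ p"
  have s: "?c n sums bessel_psi n t" for n
    using psi_summable[of n t] by (simp add: bessel_psi_def sums_iff)
  have "(\<lambda>p. of_nat (Suc n) * ?c (Suc n) p - ?c n p) sums (of_nat (Suc n) * bessel_psi (Suc n) t - bessel_psi n t)"
    (is "?f sums ?s") by (intro sums_diff sums_mult s)
  from sums_split_initial_segment[OF this, of 1]
  have "(\<lambda>p. ?f (Suc p)) sums (?s - ?f 0)" by simp
  have h: "harm (Suc p) = (harm p + 1 / of_nat (Suc p) :: complex)" for p
    by (simp add: harm_Suc divide_inverse)
  have 0: "?f 0 = 1 / fact (Suc n)" unfolding add_Suc h by (simp add: field_simps harm_def del: of_nat_Suc)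
  have 1: "?f (Suc p) = t * ?c (Suc (Suc n)) p" for p
  proof -
    define A B :: complex where "A = harm p" and "B = harm (n + p)"
    define P Q Q' :: complex where "P = of_nat (Suc p)" and "Q = of_nat (Suc (n + p))" and "Q' = of_nat (Suc (Suc (n + p)))"
    have nz: "P \<noteq> 0" "Q \<noteq> 0" "Q' \<noteq> 0" unfolding P_def Q_def Q'_def by (simp_all del: of_nat_Suc)
    have N: "of_nat (Suc n) = Q' - P" unfolding P_def Q'_def by (simp)
    show ?thesis
      unfolding add_Suc add_Suc_right fact_Suc h N A_def[symmetric] B_def[symmetric]
        P_def[symmetric] Q_def[symmetric] Q'_def[symmetric] power_Suc
      using nz by (simp add: field_simps)
  qed
  have "(\<lambda>p. t * ?c (Suc (Suc n)) p) sums (?s - 1 / fact (Suc n))"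
    using \<open>(\<lambda>p. ?f (Suc p)) sums (?s - ?f 0)\<close> unfolding 1 0 .
  moreover have "(\<lambda>p. t * ?c (Suc (Suc n)) p) sums (t * bessel_psi (Suc (Suc n)) t)"
    by (intro sums_mult s)
  ultimately have "t * bessel_psi (Suc (Suc n)) t = ?s - 1 / fact (Suc n)"
    using sums_unique2 by blast
  then show ?thesis by (simp add: algebra_simps)
qed

text \<open>The inhomogeneous term is opposite to the one in \<open>psi_rec\<close> once both are weighted with their powers of
\<open>z / 2\<close>, so that the combination in the Bessel function of the second kind satisfies the homogeneous
recurrence. The derivative of \<open>bessel_polar (Suc n)\<close> is \<open>bessel_polar n\<close>, and \<open>polar_deriv\<close> gives it in terms of
neighbouring orders.\<close>
lemma polar_rec: "t * bessel_polar n t + bessel_polar (Suc (Suc n)) t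
    = of_nat (Suc n) * bessel_polar (Suc n) t + t ^ Suc n / fact (Suc n)"
proof -
  obtain d where d: "t * d = of_nat (Suc n) * bessel_polar (Suc n) t - bessel_polar (Suc (Suc n)) t + t ^ Suc n / fact (Suc n)"
    and D: "(bessel_polar (Suc n) has_field_derivative d) (at t)" using polar_deriv[of "Suc n" t] by blast
  have "(bessel_polar (Suc n) has_field_derivative bessel_polar n t) (at t)"
  proof -
    have e: "bessel_polar (Suc n) t = fact n + (\<Sum>p<n. fact (n - 1 - p) / fact (Suc p) * t ^ Suc p)" for t
      unfolding bessel_polar_def sum.lessThan_Suc_shift by (simp cong: sum.cong)
    have "((\<lambda>t. fact n + (\<Sum>p<n. fact (n - 1 - p) / fact (Suc p) * t ^ Suc p)) has_field_derivative
        0 + (\<Sum>p<n. fact (n - 1 - p) / fact p * t ^ p)) (at t)"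
    proof (intro DERIV_add DERIV_const DERIV_sum)
      fix p
      have "((\<lambda>t. fact (n - 1 - p) / fact (Suc p) * t ^ Suc p) has_field_derivative
        fact (n - 1 - p) / fact (Suc p) * (of_nat (Suc p) * t ^ p)) (at t)"
        by (rule derivative_eq_intros refl | simp)+
      moreover have "fact (n - 1 - p) / fact (Suc p) * (of_nat (Suc p) * t ^ p) = (fact (n - 1 - p) / fact p * t ^ p :: complex)"
        by (simp add: divide_simps del: of_nat_Suc)
      ultimately show "((\<lambda>t. fact (n - 1 - p) / fact (Suc p) * t ^ Suc p) has_field_derivative
        fact (n - 1 - p) / fact p * t ^ p) (at t)" by simp
    qed
    then show ?thesis unfolding e[abs_def] by (simp add: bessel_polar_def)
  qed
  then have "d = bessel_polar n t" using D DERIV_unique by blast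
  with d show ?thesis by (simp add: algebra_simps)
qed

section \<open>Derivatives and recurrences of Bessel and Hankel functions\<close>

lemma bessel_J_nat_eq: "bessel_J_nat n z = (z / 2) ^ n * bessel_phi n ((z / 2)\<^sup>2)"
proof -
  have "(\<Sum>p. (z / 2) ^ n * ((-1) ^ p / (fact p * fact (n + p)) * ((z / 2)\<^sup>2) ^ p))
      = (z / 2) ^ n * (\<Sum>p. (-1) ^ p / (fact p * fact (n + p)) * ((z / 2)\<^sup>2) ^ p)"
    by (rule suminf_mult[OF phi_summable])
  moreover have "(z / 2) ^ n * ((-1) ^ p / (fact p * fact (n + p)) * ((z / 2)\<^sup>2) ^ p)
     = (-1) ^ p / (fact p * fact (n + p)) * (z / 2) ^ (n + 2 * p)" for p
    unfolding power_add power_mult by (simp only: mult_ac)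
  ultimately show ?thesis unfolding bessel_J_nat_def bessel_phi_def by (simp only:)
qed

lemma bessel_Y_nat_eq: "bessel_Y_nat n z = 2 / of_real pi * (Ln (z / 2) + euler_mascheroni) * bessel_J_nat n z
   - 1 / of_real pi * ((2 / z) ^ n * bessel_polar n ((z / 2)\<^sup>2))
   - 1 / of_real pi * ((z / 2) ^ n * bessel_psi n ((z / 2)\<^sup>2))"
proof -
  have "(\<Sum>p. (z / 2) ^ n * ((-1) ^ p / (fact p * fact (n + p)) * (harm p + harm (n + p)) * ((z / 2)\<^sup>2) ^ p))
      = (z / 2) ^ n * bessel_psi n ((z / 2)\<^sup>2)"
    unfolding bessel_psi_def by (rule suminf_mult[OF psi_summable])
  moreover have "(z / 2) ^ n * ((-1) ^ p / (fact p * fact (n + p)) * (harm p + harm (n + p)) * ((z / 2)\<^sup>2) ^ p)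
     = (-1) ^ p / (fact p * fact (n + p)) * (z / 2) ^ (n + 2 * p) * (harm p + harm (n + p))" for p
    unfolding power_add power_mult by (simp only: mult_ac)
  moreover have "(\<Sum>p<n. fact (n - 1 - p) / fact p * (2 / z) ^ n * (z / 2) ^ (2 * p)) = (2 / z) ^ n * bessel_polar n ((z / 2)\<^sup>2)"
    unfolding bessel_polar_def sum_distrib_left unfolding power_mult by (intro sum.cong refl) (simp only: mult_ac)
  ultimately show ?thesis unfolding bessel_Y_nat_def by (simp only:)
qed

definition hankel_nat :: "nat \<Rightarrow> complex \<Rightarrow> complex" where
  "hankel_nat n z = bessel_J_nat n z + \<i> * bessel_Y_nat n z"

lemma bessel_J_nat_deriv:
  assumes "z \<noteq> 0"
  shows "(bessel_J_nat n has_field_derivative of_nat n / z * bessel_J_nat n z - bessel_J_nat (Suc n) z) (at z)"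
proof -
  have "((\<lambda>z. bessel_phi n ((z / 2)\<^sup>2)) has_field_derivative - bessel_phi (Suc n) ((z / 2)\<^sup>2) * (z / 2)) (at z)"
    by (rule DERIV_chain'[where g = "bessel_phi n", OF _ phi_deriv]) (auto intro!: derivative_eq_intros simp: power2_eq_square)
  then have D: "((\<lambda>z. (z / 2) ^ n * bessel_phi n ((z / 2)\<^sup>2)) has_field_derivative
      (of_nat n * (z / 2) ^ (n - 1) / 2) * bessel_phi n ((z / 2)\<^sup>2)
      + (- bessel_phi (Suc n) ((z / 2)\<^sup>2) * (z / 2)) * (z / 2) ^ n) (at z)"
    by (intro DERIV_mult) (auto intro!: derivative_eq_intros)
  have e: "of_nat n * (z / 2) ^ (n - 1) / 2 = of_nat n / z * (z / 2) ^ n"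
    using assms by (cases n) (simp_all add: field_simps del: of_nat_Suc)
  show ?thesis
    using D unfolding e bessel_J_nat_eq[abs_def] by (rule DERIV_cong) (simp add: algebra_simps)
qed

text \<open>The logarithm contributes \<open>2 / pi * bessel_J_nat n z / z\<close>, which is cancelled by the inhomogeneous
terms of \<open>polar_deriv\<close> and \<open>psi_deriv\<close>. What remains is the rule that the functions of the first kind
satisfy as well, so that the Hankel functions inherit it.\<close>
lemma bessel_Y_nat_deriv:
  assumes "z \<notin> \<real>\<^sub>\<le>\<^sub>0"
  shows "(bessel_Y_nat n has_field_derivative of_nat n / z * bessel_Y_nat n z - bessel_Y_nat (Suc n) z) (at z)"
proof -
  have z: "z \<noteq> 0" using assms by auto
  define w where "w = z / 2"
  define t where "t = w\<^sup>2"
  have w0: "w \<noteq> 0" using z by (simp add: w_def)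
  have z2: "z / 2 \<notin> \<real>\<^sub>\<le>\<^sub>0" using assms by (auto simp: complex_nonpos_Reals_iff)
  obtain dq where dq: "(bessel_polar n has_field_derivative dq) (at t)"
    "t * dq = of_nat n * bessel_polar n t - bessel_polar (Suc n) t + t ^ n / fact n"
    using polar_deriv[of n t] by blast
  obtain dp where dp: "(bessel_psi n has_field_derivative dp) (at t)"
    "t * dp = bessel_phi n t - 1 / fact n - t * bessel_psi (Suc n) t"
    using psi_deriv[of n t] by blast
  have sq: "((\<lambda>z. (z / 2)\<^sup>2) has_field_derivative w) (at z)"
    by (auto intro!: derivative_eq_intros simp: power2_eq_square w_def)
  have Q: "((\<lambda>z. bessel_polar n ((z / 2)\<^sup>2)) has_field_derivative dq * w) (at z)"
    using DERIV_chain'[OF sq, of "bessel_polar n" dq] dq(1) unfolding t_def w_def .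
  have P: "((\<lambda>z. bessel_psi n ((z / 2)\<^sup>2)) has_field_derivative dp * w) (at z)"
    using DERIV_chain'[OF sq, of "bessel_psi n" dp] dp(1) unfolding t_def w_def .
  have wn: "((\<lambda>z. (z / 2) ^ n) has_field_derivative of_nat n / z * w ^ n) (at z)"
  proof -
    have "((\<lambda>z. (z / 2) ^ n) has_field_derivative of_nat n * (z / 2) ^ (n - 1) / 2) (at z)"
      by (auto intro!: derivative_eq_intros)
    moreover have "of_nat n * (z / 2) ^ (n - 1) / 2 = of_nat n / z * w ^ n"
      using z unfolding w_def by (cases n) (simp_all add: field_simps del: of_nat_Suc)
    ultimately show ?thesis by simp
  qed
  have iwn: "((\<lambda>z. (2 / z) ^ n) has_field_derivative - (of_nat n / z * (2 / z) ^ n)) (at z)"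
  proof -
    have "((\<lambda>z. inverse ((z / 2) ^ n)) has_field_derivative - (inverse (w ^ n) * (of_nat n / z * w ^ n) * inverse (w ^ n))) (at z)"
      using DERIV_inverse'[OF wn] w0 unfolding w_def by simp
    moreover have i: "inverse ((z / 2) ^ n) = (2 / z) ^ n" for z :: complex by (simp add: power_divide)
    moreover have "inverse (w ^ n) = (2 / z) ^ n" using i[of z] by (simp add: w_def)
    moreover have "(2 / z) ^ n * (of_nat n / z * w ^ n) * (2 / z) ^ n = of_nat n / z * (2 / z) ^ n"
      using z by (simp add: w_def field_simps)
    ultimately show ?thesis by (simp only:)
  qed
  have L: "((\<lambda>z. Ln (z / 2)) has_field_derivative 1 / z) (at z)"
    using z2 z by (auto intro!: derivative_eq_intros simp: field_simps)
  have L': "((\<lambda>z. Ln (z / 2) + euler_mascheroni) has_field_derivative 1 / z) (at z)"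
    using DERIV_add[OF L DERIV_const] by simp
  define Lg where "Lg = Ln (z / 2) + euler_mascheroni"
  define Jn where "Jn = bessel_J_nat n z"
  define Js where "Js = bessel_J_nat (Suc n) z"
  have F: "bessel_Y_nat n = (\<lambda>z. 2 / of_real pi * (Ln (z / 2) + euler_mascheroni) * bessel_J_nat n z
      - 1 / of_real pi * ((2 / z) ^ n * bessel_polar n ((z / 2)\<^sup>2))
      - 1 / of_real pi * ((z / 2) ^ n * bessel_psi n ((z / 2)\<^sup>2)))"
    by (rule ext) (rule bessel_Y_nat_eq)
  have "((\<lambda>z. 2 / of_real pi * (Ln (z / 2) + euler_mascheroni) * bessel_J_nat n z
      - 1 / of_real pi * ((2 / z) ^ n * bessel_polar n ((z / 2)\<^sup>2))
      - 1 / of_real pi * ((z / 2) ^ n * bessel_psi n ((z / 2)\<^sup>2))) has_field_derivative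
      2 / of_real pi * Lg * (of_nat n / z * Jn - Js) + 2 / of_real pi * (1 / z) * Jn
      - 1 / of_real pi * ((2 / z) ^ n * (dq * w) + - (of_nat n / z * (2 / z) ^ n) * bessel_polar n t)
      - 1 / of_real pi * (w ^ n * (dp * w) + of_nat n / z * w ^ n * bessel_psi n t)) (at z)"
    unfolding Lg_def Jn_def Js_def t_def
    unfolding w_def
    by (intro DERIV_diff DERIV_cmult DERIV_mult' L' bessel_J_nat_deriv[OF z] iwn wn[unfolded w_def] P[unfolded w_def] Q[unfolded w_def])
  note D = this[folded F]
  have "2 / of_real pi * Lg * (of_nat n / z * Jn - Js) + 2 / of_real pi * (1 / z) * Jn
      - 1 / of_real pi * ((2 / z) ^ n * (dq * w) + - (of_nat n / z * (2 / z) ^ n) * bessel_polar n t)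
      - 1 / of_real pi * (w ^ n * (dp * w) + of_nat n / z * w ^ n * bessel_psi n t)
     = of_nat n / z * bessel_Y_nat n z - bessel_Y_nat (Suc n) z"
  proof -
    have zw: "z = 2 * w" by (simp add: w_def)
    have J: "Jn = w ^ n * bessel_phi n t" by (simp add: Jn_def bessel_J_nat_eq t_def w_def)
    have Y: "bessel_Y_nat n z = 2 / of_real pi * Lg * Jn - 1 / of_real pi * ((1 / w) ^ n * bessel_polar n t)
        - 1 / of_real pi * (w ^ n * bessel_psi n t)"
      by (simp add: bessel_Y_nat_eq Lg_def Jn_def t_def w_def)
    have Ys: "bessel_Y_nat (Suc n) z = 2 / of_real pi * Lg * Js - 1 / of_real pi * ((1 / w) ^ Suc n * bessel_polar (Suc n) t)
        - 1 / of_real pi * (w ^ Suc n * bessel_psi (Suc n) t)"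
      by (simp add: bessel_Y_nat_eq Lg_def Js_def t_def w_def)
    have t: "t = w * w" by (simp add: t_def power2_eq_square)
    have A: "dq * w = (of_nat n * bessel_polar n t - bessel_polar (Suc n) t + w ^ n * w ^ n / fact n) / w"
      using dq(2) w0 by (simp add: t power_mult_distrib field_simps)
    have B: "dp * w = (bessel_phi n t - 1 / fact n - w * w * bessel_psi (Suc n) t) / w"
      using dp(2) w0 by (simp add: t field_simps)
    show ?thesis unfolding Y Ys A B unfolding zw J
      using w0 by (simp add: field_simps)
  qed
  with D show ?thesis by (simp only:)
qed

lemma bessel_J_nat_rec: "z \<noteq> 0 \<Longrightarrow> bessel_J_nat n z + bessel_J_nat (Suc (Suc n)) z = 2 * of_nat (Suc n) / z * bessel_J_nat (Suc n) z"
proof -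
  assume z: "z \<noteq> 0"
  define w where "w = z / 2"
  have zw: "z = 2 * w" and w0: "w \<noteq> 0" using z by (simp_all add: w_def)
  have "bessel_phi n (w\<^sup>2) = of_nat (Suc n) * bessel_phi (Suc n) (w\<^sup>2) - w\<^sup>2 * bessel_phi (Suc (Suc n)) (w\<^sup>2)"
    using phi_rec[of n "w\<^sup>2"] by (simp add: algebra_simps)
  moreover have "2 * of_nat (Suc n) / z = of_nat (Suc n) / w" by (simp add: zw del: of_nat_Suc)
  ultimately show ?thesis unfolding bessel_J_nat_eq w_def[symmetric]
    using w0 by (simp only:) (simp add: field_simps power2_eq_square del: of_nat_Suc)
qed

lemma bessel_Y_nat_rec: "z \<noteq> 0 \<Longrightarrow> bessel_Y_nat n z + bessel_Y_nat (Suc (Suc n)) z = 2 * of_nat (Suc n) / z * bessel_Y_nat (Suc n) z"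
proof -
  assume z: "z \<noteq> 0"
  define w where "w = z / 2"
  define t where "t = w\<^sup>2"
  have zw: "z = 2 * w" and w0: "w \<noteq> 0" using z by (simp_all add: w_def)
  define Lg where "Lg = Ln (z / 2) + euler_mascheroni"
  have Y: "bessel_Y_nat n z = 2 / of_real pi * Lg * bessel_J_nat n z - 1 / of_real pi * ((1 / w) ^ n * bessel_polar n t + w ^ n * bessel_psi n t)" for n
    by (simp add: bessel_Y_nat_eq Lg_def t_def w_def algebra_simps)
  have ps: "bessel_psi n t = of_nat (Suc n) * bessel_psi (Suc n) t - 1 / fact (Suc n) - t * bessel_psi (Suc (Suc n)) t"
    using psi_rec[of n t] by (simp add: algebra_simps del: of_nat_Suc)
  have po: "bessel_polar (Suc (Suc n)) t = of_nat (Suc n) * bessel_polar (Suc n) t + t ^ Suc n / fact (Suc n) - t * bessel_polar n t"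
    using polar_rec[of t n] by (simp add: algebra_simps del: of_nat_Suc)
  have e: "((1 / w) ^ n * bessel_polar n t + w ^ n * bessel_psi n t) +
    ((1 / w) ^ Suc (Suc n) * bessel_polar (Suc (Suc n)) t + w ^ Suc (Suc n) * bessel_psi (Suc (Suc n)) t)
    = 2 * of_nat (Suc n) / z * ((1 / w) ^ Suc n * bessel_polar (Suc n) t + w ^ Suc n * bessel_psi (Suc n) t)"
  proof -
    have t: "t = w * w" and tn: "t ^ Suc n = w ^ n * w ^ n * w * w" by (simp_all add: t_def power2_eq_square power_mult_distrib)
    show ?thesis unfolding ps po tn unfolding t zw using w0 by (simp add: field_simps del: of_nat_Suc fact_Suc)
  qed
  have "(c * x1 - d * p1) + (c * x2 - d * p2) = r * (c * x3 - d * p3)"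
    if "x1 + x2 = r * x3" "p1 + p2 = r * p3" for c d r x1 x2 x3 p1 p2 p3 :: complex
  proof -
    have "(c * x1 - d * p1) + (c * x2 - d * p2) = c * (x1 + x2) - d * (p1 + p2)" by (simp add: algebra_simps)
    then show ?thesis unfolding that by (simp add: algebra_simps)
  qed
  from this[OF bessel_J_nat_rec[OF z] e] show ?thesis unfolding Y .
qed

lemma hankel_nat_deriv:
  assumes "z \<notin> \<real>\<^sub>\<le>\<^sub>0"
  shows "(hankel_nat n has_field_derivative of_nat n / z * hankel_nat n z - hankel_nat (Suc n) z) (at z)"
proof -
  have z: "z \<noteq> 0" using assms by auto
  have "((\<lambda>z. bessel_J_nat n z + \<i> * bessel_Y_nat n z) has_field_derivative
     (of_nat n / z * bessel_J_nat n z - bessel_J_nat (Suc n) z) + \<i> * (of_nat n / z * bessel_Y_nat n z - bessel_Y_nat (Suc n) z)) (at z)"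
    by (intro DERIV_add DERIV_cmult bessel_J_nat_deriv bessel_Y_nat_deriv assms z)
  then show ?thesis unfolding hankel_nat_def[abs_def] by (simp add: algebra_simps)
qed

lemma hankel_nat_rec: "z \<noteq> 0 \<Longrightarrow> hankel_nat n z + hankel_nat (Suc (Suc n)) z = 2 * of_nat (Suc n) / z * hankel_nat (Suc n) z"
proof -
  assume z: "z \<noteq> 0"
  have "(x1 + \<i> * p1) + (x2 + \<i> * p2) = r * (x3 + \<i> * p3)"
    if "x1 + x2 = r * x3" "p1 + p2 = r * p3" for r x1 x2 x3 p1 p2 p3 :: complex
  proof -
    have "(x1 + \<i> * p1) + (x2 + \<i> * p2) = (x1 + x2) + \<i> * (p1 + p2)" by (simp add: algebra_simps)
    then show ?thesis unfolding that by (simp add: algebra_simps)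
  qed
  from this[OF bessel_J_nat_rec[OF z] bessel_Y_nat_rec[OF z]] show ?thesis unfolding hankel_nat_def .
qed

lemma hankel1_of_nat: "hankel1 (int n) z = hankel_nat n z"
  by (simp add: hankel1_def hankel_nat_def bessel_J_def bessel_Y_def)

lemma neg_one_powi_minus: "((-1) :: complex) powi (- m) = (-1) powi m"
  by (simp add: power_int_minus_one_minus)

lemma neg_one_powi_sq: "((-1) :: complex) powi m * ((-1) powi m * x) = x"
  by (simp flip: mult.assoc power_int_mult_distrib)

lemma hankel1_minus: "hankel1 (- m) z = (-1) powi m * hankel1 m z"
proof -
  have 1: "hankel1 (- int n) z = (-1) ^ n * hankel1 (int n) z" for n
    by (cases "n = 0") (auto simp: hankel1_def bessel_J_def bessel_Y_def algebra_simps)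
  show ?thesis
  proof (cases m rule: int_cases2)
    case (nonneg n) then show ?thesis using 1[of n] by simp
  next
    case (nonpos n)
    have "(-1) powi m * ((-1) ^ n * hankel1 (int n) z) = hankel1 (int n) z"
      using neg_one_powi_sq[of "int n"] by (simp add: nonpos neg_one_powi_minus)
    then show ?thesis using 1[of n] by (simp add: nonpos)
  qed
qed

text \<open>For negative orders the recurrence is the one for the opposite order, by \<open>hankel1_minus\<close>; at order
\<open>0\<close> it is the antisymmetry of orders \<open>1\<close> and \<open>- 1\<close>.\<close>
lemma hankel1_rec:
  assumes "z \<noteq> 0"
  shows "hankel1 (m - 1) z + hankel1 (m + 1) z = 2 * of_int m / z * hankel1 m z"
proof -
  have 1: "hankel1 (int (Suc n) - 1) z + hankel1 (int (Suc n) + 1) z = 2 * of_int (int (Suc n)) / z * hankel1 (int (Suc n)) z" for n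
    using hankel_nat_rec[OF assms, of n] hankel1_of_nat[of n z] hankel1_of_nat[of "Suc n" z] hankel1_of_nat[of "Suc (Suc n)" z]
    by (simp add: algebra_simps)
  consider "m = 0" | n where "m = int (Suc n)" | n where "m = - int (Suc n)"
    by (cases m rule: int_cases3) (auto dest!: gr0_implies_Suc)
  then show ?thesis
  proof cases
    case 1 then show ?thesis using hankel1_minus[of 1 z] by simp
  next
    case 2 then show ?thesis using 1 by simp
  next
    case 3
    define q where "q = int (Suc n)"
    have "hankel1 (m - 1) z + hankel1 (m + 1) z = hankel1 (- (q + 1)) z + hankel1 (- (q - 1)) z"
      by (simp add: 3 q_def algebra_simps)
    also have "\<dots> = (-1) powi (q + 1) * hankel1 (q + 1) z + (-1) powi (q - 1) * hankel1 (q - 1) z"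
      by (simp only: hankel1_minus)
    also have "\<dots> = - ((-1) powi q) * (hankel1 (q - 1) z + hankel1 (q + 1) z)"
      by (simp add: power_int_add power_int_diff algebra_simps)
    also have "\<dots> = - ((-1) powi q) * (2 * of_int q / z * hankel1 q z)"
      using 1[of n] unfolding q_def by simp
    also have "\<dots> = 2 * of_int (- q) / z * hankel1 (- q) z"
      by (simp add: hankel1_minus)
    finally show ?thesis by (simp add: 3 q_def)
  qed
qed

lemma hankel1_deriv:
  assumes "z \<notin> \<real>\<^sub>\<le>\<^sub>0"
  shows "(hankel1 m has_field_derivative of_int m / z * hankel1 m z - hankel1 (m + 1) z) (at z)"
proof -
  have z: "z \<noteq> 0" using assms by auto
  have eq: "hankel1 (int n) = hankel_nat n" for n using hankel1_of_nat by blast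
  have 1: "(hankel1 (int n) has_field_derivative of_nat n / z * hankel1 (int n) z - hankel1 (int n + 1) z) (at z)" for n
    using hankel_nat_deriv[OF assms, of n] eq[of n] eq[of "Suc n"] by (simp add: add.commute)
  show ?thesis
  proof (cases m rule: int_cases2)
    case (nonneg n) then show ?thesis using 1[of n] by simp
  next
    case (nonpos n)
    have "((\<lambda>z. (-1) powi (int n) * hankel1 (int n) z) has_field_derivative
       (-1) powi (int n) * (of_nat n / z * hankel1 (int n) z - hankel1 (int n + 1) z)) (at z)"
      by (intro DERIV_cmult 1)
    moreover have "(\<lambda>z. (-1) powi (int n) * hankel1 (int n) z) = hankel1 m"
      by (rule ext) (simp only: nonpos hankel1_minus)
    moreover have "hankel1 (int n + 1) z = 2 * of_nat n / z * hankel1 (int n) z - hankel1 (int n - 1) z"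
      using hankel1_rec[OF z, of "int n"] by (simp add: algebra_simps)
    moreover have "hankel1 (int n - 1) z = (-1) powi (int n - 1) * hankel1 (m + 1) z"
      using hankel1_minus[of "int n - 1" z] neg_one_powi_sq[of "int n - 1"] by (simp add: nonpos)
    moreover have "hankel1 (int n) z = (-1) powi (int n) * hankel1 m z"
      using hankel1_minus[of m z] by (simp add: nonpos neg_one_powi_minus)
    moreover have "(-1) powi (int n - 1) = - ((-1 :: complex) powi int n)"
      by (simp add: power_int_diff)
    moreover have "e * (a / z * (e * h) - (2 * a / z * (e * h) - (- e * h'))) = - a / z * h - h'"
      if "e * e = 1" for e a h h' :: complex
    proof -
      have "e * (a / z * (e * h) - (2 * a / z * (e * h) - (- e * h'))) = (e * e) * (- a / z * h - h')"
        by (simp add: algebra_simps)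
      then show ?thesis using that by simp
    qed
    note this[of "(-1) powi int n" "of_nat n" "hankel1 m z" "hankel1 (m + 1) z"]
    ultimately show ?thesis using neg_one_powi_sq[of "int n" 1]
      by (simp add: nonpos mult.assoc)
  qed
qed

section \<open>Cylindrical waves in the complex plane\<close>

text \<open>The plane is identified with the complex numbers and \<open>exp (\<i> m arg z)\<close> is written as a power of
\<open>z / \<bar>z\<bar>\<close>, so that no branch of the argument has to be differentiated.\<close>
definition hankel_wave :: "complex \<Rightarrow> int \<Rightarrow> complex \<Rightarrow> complex" where
  "hankel_wave k m z = (z / of_real (cmod z)) powi m * hankel1 m (k * of_real (cmod z))"

text \<open>The wave of order \<open>- n\<close> up to sign: \<open>bessel_J_nat n (k * \<bar>w\<bar>) * exp (\<i> n arg w)\<close> is the \<open>n\<close>-th power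
of \<open>k / 2 * w\<close> times an entire function of \<open>\<bar>w\<bar>\<^sup>2 = w * cnj w\<close>. In this form smoothness at the origin
is evident.\<close>
definition bessel_mono :: "complex \<Rightarrow> nat \<Rightarrow> complex \<Rightarrow> complex" where
  "bessel_mono k n w = (k / 2 * w) ^ n * bessel_phi n ((k / 2)\<^sup>2 * (w * cnj w))"

definition bessel_wave :: "complex \<Rightarrow> int \<Rightarrow> complex \<Rightarrow> complex" where
  "bessel_wave k m w = (if m \<ge> 0 then bessel_mono k (nat m) (cnj w)
                        else (-1) ^ nat (- m) * bessel_mono k (nat (- m)) w)"

text \<open>Total derivatives of the waves at a point in the direction \<open>h\<close>. In the Wirtinger derivatives each term
shifts the order of the wave by exactly one; this is what makes the sums in Graf's theorem telescope.\<close>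
definition bessel_wave_D :: "complex \<Rightarrow> int \<Rightarrow> complex \<Rightarrow> complex \<Rightarrow> complex" where
  "bessel_wave_D k m w h = k / 2 * (bessel_wave k (m - 1) w * cnj h - bessel_wave k (m + 1) w * h)"

definition hankel_wave_D :: "complex \<Rightarrow> int \<Rightarrow> complex \<Rightarrow> complex \<Rightarrow> complex" where
  "hankel_wave_D k m z h = k / 2 * (hankel_wave k (m - 1) z * h - hankel_wave k (m + 1) z * cnj h)"

lemma wave_number_times_pos: "(k :: complex) \<notin> \<real>\<^sub>\<le>\<^sub>0 \<Longrightarrow> r > 0 \<Longrightarrow> k * of_real r \<notin> \<real>\<^sub>\<le>\<^sub>0"
  by (auto simp: complex_nonpos_Reals_iff mult_le_0_iff complex_is_Real_iff)

lemma hankel_radial_deriv: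
  assumes k: "k \<notin> \<real>\<^sub>\<le>\<^sub>0" and r: "r > 0"
  shows "((\<lambda>x. x powi (- m) * hankel1 m (k * x)) has_field_derivative
     - k * of_real r powi (- m) * hankel1 (m + 1) (k * of_real r)) (at (of_real r))"
proof -
  have kr: "k * of_real r \<notin> \<real>\<^sub>\<le>\<^sub>0" using wave_number_times_pos[OF k r] .
  then have k0: "k \<noteq> 0" by auto
  have 1: "((\<lambda>x. hankel1 m (k * x)) has_field_derivative
      (of_int m / (k * of_real r) * hankel1 m (k * of_real r) - hankel1 (m + 1) (k * of_real r)) * k) (at (of_real r))"
    using DERIV_chain'[where g = "hankel1 m" and f = "\<lambda>x. k * x" and x = "of_real r", OF _ hankel1_deriv[OF kr]]
      DERIV_cmult_Id[of k] by blast
  have 2: "((\<lambda>x. x powi (- m)) has_field_derivative of_int (- m) * of_real r powi (- m - 1)) (at (of_real r :: complex))"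
    using r by (auto intro!: derivative_eq_intros)
  have p: "of_real r powi (- m - 1) = (of_real r powi (- m) / of_real r :: complex)"
    using r by (simp add: power_int_diff)
  show ?thesis
    by (rule DERIV_cong[OF DERIV_mult'[OF 2 1]]) (use r k0 in \<open>simp add: p field_simps\<close>)
qed

lemma hankel_wave_eq: "z \<noteq> 0 \<Longrightarrow> hankel_wave k m z = z powi m * (of_real (cmod z) powi (- m) * hankel1 m (k * of_real (cmod z)))"
  by (simp add: hankel_wave_def power_int_divide_distrib power_int_minus field_simps)

text \<open>Away from the origin the wave is \<open>z powi m\<close> times a function of \<open>\<bar>z\<bar>\<close>. The derivative of
the second factor is of order \<open>m + 1\<close> (\<open>hankel_radial_deriv\<close>), and the recurrence rewrites the
derivative of the first in terms of the orders \<open>m - 1\<close> and \<open>m + 1\<close>.\<close>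
lemma hankel_wave_deriv:
  assumes k: "k \<notin> \<real>\<^sub>\<le>\<^sub>0" and z: "z \<noteq> 0"
  shows "(hankel_wave k m has_derivative hankel_wave_D k m z) (at z)"
proof -
  define r where "r = cmod z"
  define R where "R = complex_of_real r"
  have r: "r > 0" and R: "R \<noteq> 0" using z by (simp_all add: r_def R_def)
  have k0: "k \<noteq> 0" using k by auto
  have nd: "((\<lambda>z. complex_of_real (cmod z)) has_derivative (\<lambda>h. of_real (h \<bullet> sgn z))) (at z)"
    using has_derivative_norm[OF z] by (auto intro!: has_derivative_of_real simp: inner_commute)
  have G: "((\<lambda>x. x powi (- m) * hankel1 m (k * x)) has_derivative
     (\<lambda>h. - k * R powi (- m) * hankel1 (m + 1) (k * R) * h)) (at (of_real (cmod z)))"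
    using hankel_radial_deriv[OF k r, of m] unfolding has_field_derivative_def R_def r_def .
  have 1: "((\<lambda>z. of_real (cmod z) powi (- m) * hankel1 m (k * of_real (cmod z))) has_derivative
     (\<lambda>h. - k * R powi (- m) * hankel1 (m + 1) (k * R) * of_real (h \<bullet> sgn z))) (at z)"
    using has_derivative_compose[OF nd G] .
  have 2: "((\<lambda>z. z powi m) has_derivative (\<lambda>h. of_int m * z powi (m - 1) * h)) (at z)"
    unfolding has_field_derivative_def[symmetric] using z by (auto intro!: derivative_eq_intros)
  have D: "((\<lambda>z. z powi m * (of_real (cmod z) powi (- m) * hankel1 m (k * of_real (cmod z)))) has_derivative
     hankel_wave_D k m z) (at z)"
  proof (rule has_derivative_eq_rhs[OF has_derivative_mult[OF 2 1]], rule ext)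
    fix h
    have zz: "z * cnj z = R * R" using complex_norm_square[of z] by (simp add: R_def r_def power2_eq_square)
    have dr: "of_real (h \<bullet> sgn z) = (cnj z * h + z * cnj h) / (2 * R)"
    proof -
      have e1: "h \<bullet> sgn z = (h \<bullet> z) / r" by (simp add: sgn_div_norm r_def divide_inverse)
      have e2: "complex_of_real (h \<bullet> z) = (cnj z * h + z * cnj h) / 2"
        by (simp add: complex_eq_iff inner_complex_def)
      show ?thesis by (simp only: e1 of_real_divide e2 R_def[symmetric] divide_divide_eq_left)
    qed
    have rec: "hankel1 (m + 1) (k * R) = 2 * of_int m / (k * R) * hankel1 m (k * R) - hankel1 (m - 1) (k * R)"
      using hankel1_rec[of "k * R" m] k0 R by (simp add: algebra_simps)
    define A where "A = z powi m"
    define B where "B = R powi m"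
    have B: "B \<noteq> 0" using R by (simp add: B_def)
    have pw: "z powi (m - 1) = A / z" "z powi (m + 1) = A * z" "R powi (- m) = 1 / B"
       "R powi (m - 1) = B / R" "R powi (m + 1) = B * R"
      using z R by (auto simp: A_def B_def power_int_diff power_int_add power_int_minus divide_inverse)
    define H Hm where "H = hankel1 m (k * R)" and "Hm = hankel1 (m - 1) (k * R)"
    have cz: "cnj z = R * R / z" using zz z by (simp add: field_simps)
    have l: "z powi m * (- k * R powi (- m) * hankel1 (m + 1) (k * R) * of_real (h \<bullet> sgn z)) +
       of_int m * z powi (m - 1) * h * (R powi (- m) * hankel1 m (k * R)) =
       A * (- k * (1 / B) * (2 * of_int m / (k * R) * H - Hm) * ((R * R / z * h + z * cnj h) / (2 * R))) +
       of_int m * (A / z) * h * (1 / B * H)"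
      unfolding dr rec H_def[symmetric] Hm_def[symmetric] pw cz A_def[symmetric] ..
    have q: "hankel_wave_D k m z h = k / 2 * ((A / z) / (B / R) * Hm * h - (A * z) / (B * R) * (2 * of_int m / (k * R) * H - Hm) * cnj h)"
      unfolding hankel_wave_D_def hankel_wave_def r_def[symmetric] R_def[symmetric] power_int_divide_distrib pw
        rec H_def[symmetric] Hm_def[symmetric] ..
    show "z powi m * (- k * R powi (- m) * hankel1 (m + 1) (k * R) * of_real (h \<bullet> sgn z)) +
       of_int m * z powi (m - 1) * h * (of_real (cmod z) powi (- m) * hankel1 m (k * of_real (cmod z))) = hankel_wave_D k m z h"
      unfolding r_def[symmetric] R_def[symmetric] l q using z R B k0 by (simp add: field_simps)
  qed
  show ?thesis
    by (rule has_derivative_transform_within_open[OF D, of "- {0}"]) (use z hankel_wave_eq in auto)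
qed

text \<open>Differentiating the power and the entire factor gives orders \<open>n - 1\<close> and \<open>n + 1\<close> after \<open>phi_rec\<close> has
been used. At \<open>n = 0\<close> the truncated \<open>n - 1\<close> would be wrong: order \<open>- 1\<close> is minus the conjugated
order \<open>1\<close>.\<close>
lemma bessel_mono_deriv:
  "(bessel_mono k n has_derivative (\<lambda>h. k / 2 *
     ((if n = 0 then - bessel_mono k 1 (cnj w) else bessel_mono k (n - 1) w) * h - bessel_mono k (Suc n) w * cnj h))) (at w)"
proof -
  define t where "t = (k / 2)\<^sup>2 * (w * cnj w)"
  have c: "(cnj has_derivative cnj) (at w)" by (simp add: bounded_linear_imp_has_derivative bounded_linear_cnj)
  have "((\<lambda>w. (k / 2)\<^sup>2 * (w * cnj w)) has_derivative (\<lambda>h. (k / 2)\<^sup>2 * (w * cnj h + h * cnj w))) (at w)"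
    by (intro has_derivative_mult_right has_derivative_mult has_derivative_ident c)
  from has_derivative_compose[OF this phi_deriv[unfolded has_field_derivative_def], of n]
  have 1: "((\<lambda>w. bessel_phi n ((k / 2)\<^sup>2 * (w * cnj w))) has_derivative
      (\<lambda>h. - bessel_phi (Suc n) t * ((k / 2)\<^sup>2 * (w * cnj h + h * cnj w)))) (at w)"
    unfolding t_def .
  have 2: "((\<lambda>w. (k / 2 * w) ^ n) has_derivative (\<lambda>h. of_nat n * (k / 2 * w) ^ (n - 1) * (k / 2) * h)) (at w)"
    unfolding has_field_derivative_def[symmetric] by (auto intro!: derivative_eq_intros)
  have ph: "bessel_phi (Suc m) t * of_nat (Suc m) = bessel_phi m t + t * bessel_phi (Suc (Suc m)) t" for m
    using phi_rec[of m t] by (simp add: mult.commute)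
  show ?thesis unfolding bessel_mono_def[abs_def]
  proof (rule has_derivative_eq_rhs[OF has_derivative_mult[OF 2 1]], rule ext)
    fix h
    let ?u = "k / 2 * w"
    show "?u ^ n * (- bessel_phi (Suc n) t * ((k / 2)\<^sup>2 * (w * cnj h + h * cnj w))) +
       of_nat n * ?u ^ (n - 1) * (k / 2) * h * bessel_phi n ((k / 2)\<^sup>2 * (w * cnj w)) =
       k / 2 * ((if n = 0 then - ((k / 2 * cnj w) ^ 1 * bessel_phi 1 ((k / 2)\<^sup>2 * (cnj w * cnj (cnj w))))
          else ?u ^ (n - 1) * bessel_phi (n - 1) ((k / 2)\<^sup>2 * (w * cnj w))) * h -
         ?u ^ Suc n * bessel_phi (Suc n) ((k / 2)\<^sup>2 * (w * cnj w)) * cnj h)"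
    proof (cases n)
      case 0
      then show ?thesis unfolding t_def by (simp add: algebra_simps power2_eq_square)
    next
      case (Suc m)
      define P where "P = ?u ^ m"
      define F1 F2 where "F1 = bessel_phi m t" and "F2 = bessel_phi (Suc (Suc m)) t"
      have tt: "t = (k / 2) * (k / 2) * (w * cnj w)" by (simp add: t_def power2_eq_square)
      have e: "of_nat (Suc m) * P * (k / 2) * h * bessel_phi (Suc m) t = P * (k / 2) * h * (F1 + t * F2)"
        using ph[of m] unfolding F1_def F2_def by (metis (no_types, lifting) mult.assoc mult.commute)
      show ?thesis
        unfolding Suc power_Suc t_def[symmetric] diff_Suc_1 P_def[symmetric] F1_def[symmetric] F2_def[symmetric] e
        unfolding tt by (simp add: algebra_simps power2_eq_square F1_def)
    qed
  qed
qed

lemma bessel_wave_deriv: "(bessel_wave k m has_derivative bessel_wave_D k m w) (at w)"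
proof -
  have c: "(cnj has_derivative cnj) (at w)" by (simp add: bounded_linear_imp_has_derivative bounded_linear_cnj)
  have m0: "bessel_mono k 0 (cnj w) = bessel_mono k 0 w" by (simp add: bessel_mono_def mult.commute)
  show ?thesis
  proof (cases m rule: int_cases3)
    case zero
    have b: "bessel_wave k m = (\<lambda>w. bessel_mono k 0 (cnj w))" by (auto simp: zero bessel_wave_def)
    show ?thesis unfolding b
      by (rule has_derivative_eq_rhs[OF has_derivative_compose[OF c bessel_mono_deriv]])
         (auto simp: fun_eq_iff bessel_wave_D_def bessel_wave_def zero algebra_simps)
  next
    case (pos n)
    have b: "bessel_wave k m = (\<lambda>w. bessel_mono k n (cnj w))" by (auto simp: pos bessel_wave_def)
    have n: "nat (int n - 1) = n - 1" "nat (int n + 1) = Suc n" "nat (1 + int n) = Suc n" using pos by auto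
    show ?thesis unfolding b
      by (rule has_derivative_eq_rhs[OF has_derivative_compose[OF c bessel_mono_deriv]])
         (use pos in \<open>auto simp: fun_eq_iff bessel_wave_D_def bessel_wave_def n algebra_simps\<close>)
  next
    case (neg n)
    have b: "bessel_wave k m = (\<lambda>w. (-1) ^ n * bessel_mono k n w)" using neg by (auto simp: bessel_wave_def)
    obtain q where q: "n = Suc q" using neg(2) gr0_implies_Suc by blast
    have B1: "bessel_wave k (m + 1) w = (-1) ^ q * bessel_mono k q w"
      using m0 by (auto simp: neg q bessel_wave_def)
    have B2: "bessel_wave k (m - 1) w = (-1) ^ (Suc n) * bessel_mono k (Suc n) w"
      by (auto simp: neg q bessel_wave_def nat_add_distrib)
    show ?thesis unfolding b
      by (rule has_derivative_eq_rhs[OF has_derivative_mult_right[OF bessel_mono_deriv]])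
         (auto simp: fun_eq_iff bessel_wave_D_def B1 B1[unfolded add.commute[of m]] B2 q algebra_simps)
  qed
qed

lemma norm_bessel_wave_le:
  "cmod (bessel_wave k m w) \<le> (cmod k * cmod w / 2) ^ nat \<bar>m\<bar> / fact (nat \<bar>m\<bar>) * exp ((cmod k * cmod w / 2)\<^sup>2)"
proof -
  have 1: "cmod (bessel_mono k n w) \<le> (cmod k * cmod w / 2) ^ n / fact n * exp ((cmod k * cmod w / 2)\<^sup>2)" for n w
  proof -
    have "cmod (bessel_mono k n w) = (cmod k * cmod w / 2) ^ n * cmod (bessel_phi n ((k / 2)\<^sup>2 * (w * cnj w)))"
      by (simp add: bessel_mono_def norm_mult norm_power norm_divide)
    also have "\<dots> \<le> (cmod k * cmod w / 2) ^ n * (exp (cmod ((k / 2)\<^sup>2 * (w * cnj w))) / fact n)"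
      by (intro mult_left_mono norm_phi_le) auto
    also have "cmod ((k / 2)\<^sup>2 * (w * cnj w)) = (cmod k * cmod w / 2)\<^sup>2"
      by (simp add: norm_mult norm_power norm_divide power2_eq_square)
    finally show ?thesis by simp
  qed
  show ?thesis using 1[of "nat m" "cnj w"] 1[of "nat (- m)" w]
    by (auto simp: bessel_wave_def norm_mult norm_power)
qed

section \<open>Growth of the waves in the order\<close>

text \<open>The three summands bound the first-kind parts (with the logarithm), the polar part, and the
regular part of the second kind, each after division by \<open>fact (n - 1) * (2 / \<bar>z\<bar>) ^ n\<close>. They do
not depend on \<open>n\<close>.\<close>
definition hankel_const :: "complex \<Rightarrow> real" where
  "hankel_const z = (let t = (cmod z / 2)\<^sup>2 in
     exp (2 * t) * (1 + 2 * cmod (Ln (z / 2) + euler_mascheroni)) + exp t + 2 * (1 + t) * exp (2 * t))"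

lemma power_fact_le_exp: "t \<ge> 0 \<Longrightarrow> t ^ n / fact n \<le> exp (t::real)"
proof -
  assume t: "t \<ge> 0"
  have "(\<Sum>p\<in>{n}. t ^ p / fact p) \<le> (\<Sum>p. t ^ p / fact p)"
    using exp_converges[of t] t by (intro sum_le_suminf) (auto simp: sums_iff divide_inverse mult.commute)
  also have "\<dots> = exp t" using exp_converges[of t] by (auto simp: sums_iff divide_inverse mult.commute)
  finally show ?thesis by simp
qed

text \<open>The polar part has the size \<open>fact (n - 1) * (2 / \<bar>z\<bar>) ^ n\<close>. The other parts carry \<open>(\<bar>z\<bar> / 2) ^ n\<close>
divided by a factorial, and since \<open>x ^ n = (1 / x) ^ n * t ^ n\<close> with \<open>t = x\<^sup>2\<close> and \<open>t ^ n / fact n \<le> exp t\<close>,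
they fit under the same bound.\<close>
lemma norm_hankel_nat_le:
  assumes z: "z \<noteq> 0"
  shows "cmod (hankel_nat n z) \<le> fact (n - 1) * (2 / cmod z) ^ n * hankel_const z"
proof -
  define x where "x = cmod z / 2"
  define t where "t = x\<^sup>2"
  define P where "P = fact (n - 1) * (1 / x) ^ n"
  define L where "L = cmod (Ln (z / 2) + euler_mascheroni)"
  have x: "x > 0" and t: "t \<ge> 0" using z by (auto simp: x_def t_def)
  have P: "P \<ge> 0" using x by (simp add: P_def)
  have cz: "cmod (z / 2) = x" "cmod ((z / 2)\<^sup>2) = t" "cmod (2 / z) = 1 / x"
    by (simp_all add: x_def t_def norm_divide norm_power)
  have xt: "x ^ n = (1 / x) ^ n * t ^ n" using x by (simp add: t_def power_divide power2_eq_square power_mult_distrib)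
  have J: "cmod (bessel_J_nat n z) \<le> P * exp (2 * t)"
  proof -
    have "cmod (bessel_J_nat n z) \<le> x ^ n * (exp t / fact n)"
      unfolding bessel_J_nat_eq norm_mult norm_power using norm_phi_le[of n "(z / 2)\<^sup>2"] cz x
      by (intro mult_mono) (auto simp: norm_power)
    also have "\<dots> = (1 / x) ^ n * (t ^ n / fact n) * exp t" unfolding xt by simp
    also have "\<dots> \<le> (1 / x) ^ n * exp t * exp t"
      using x t by (intro mult_right_mono mult_left_mono power_fact_le_exp) auto
    also have "\<dots> = 1 * (1 / x) ^ n * exp (2 * t)" by (simp flip: exp_add)
    also have "\<dots> \<le> P * exp (2 * t)" unfolding P_def using x by (intro mult_right_mono) auto
    finally show ?thesis .
  qed
  have Q: "cmod ((2 / z) ^ n * bessel_polar n ((z / 2)\<^sup>2)) \<le> P * exp t"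
  proof -
    have "cmod ((2 / z) ^ n * bessel_polar n ((z / 2)\<^sup>2)) \<le> (1 / x) ^ n * (fact (n - 1) * exp t)"
      unfolding norm_mult norm_power[of "2 / z"] cz(3) using norm_polar_le[of n "(z / 2)\<^sup>2"] cz x by (intro mult_left_mono) auto
    then show ?thesis by (simp add: P_def mult_ac)
  qed
  have S: "cmod ((z / 2) ^ n * bessel_psi n ((z / 2)\<^sup>2)) \<le> P * (2 * (1 + t) * exp (2 * t))"
  proof -
    have f: "t ^ n / fact (n - 1) \<le> (1 + t) * exp t"
    proof (cases n)
      case 0
      have "1 * 1 \<le> (1 + t) * exp t" using t by (intro mult_mono) auto
      then show ?thesis using 0 by simp
    next
      case (Suc m)
      have "t ^ n / fact (n - 1) = t * (t ^ m / fact m)" by (simp add: Suc)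
      also have "\<dots> \<le> t * exp t" using t by (intro mult_left_mono power_fact_le_exp)
      also have "\<dots> \<le> (1 + t) * exp t" by (intro mult_right_mono) auto
      finally show ?thesis .
    qed
    have "cmod ((z / 2) ^ n * bessel_psi n ((z / 2)\<^sup>2)) \<le> x ^ n * (2 * exp t / fact (n - 1))"
      unfolding norm_mult norm_power[of "z / 2"] cz(1) using norm_psi_le[of n "(z / 2)\<^sup>2"] cz x by (intro mult_left_mono) auto
    also have "\<dots> = (1 / x) ^ n * (2 * exp t) * (t ^ n / fact (n - 1))" unfolding xt by simp
    also have "\<dots> \<le> (1 / x) ^ n * (2 * exp t) * ((1 + t) * exp t)"
      using x by (intro mult_left_mono f) auto
    also have "\<dots> = 1 * (1 / x) ^ n * (2 * (1 + t) * exp (2 * t))" unfolding mult_2[of t] exp_add by (simp add: algebra_simps)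
    also have "\<dots> \<le> P * (2 * (1 + t) * exp (2 * t))" unfolding P_def using x t by (intro mult_right_mono) auto
    finally show ?thesis .
  qed
  have pi1: "1 / pi \<le> 1" "2 / pi \<le> 2" using pi_gt3 by (auto simp: field_simps)
  have "cmod (hankel_nat n z) \<le> cmod (bessel_J_nat n z) + (cmod (2 / of_real pi * (Ln (z / 2) + euler_mascheroni) * bessel_J_nat n z)
     + cmod (1 / of_real pi * ((2 / z) ^ n * bessel_polar n ((z / 2)\<^sup>2)))
     + cmod (1 / of_real pi * ((z / 2) ^ n * bessel_psi n ((z / 2)\<^sup>2))))"
  proof -
    have 3: "cmod (a - b - c) \<le> cmod a + cmod b + cmod c" for a b c
      using norm_triangle_ineq4[of "a - b" c] norm_triangle_ineq4[of a b] by linarith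
    have "cmod (hankel_nat n z) \<le> cmod (bessel_J_nat n z) + cmod (bessel_Y_nat n z)"
      unfolding hankel_nat_def by (rule order_trans[OF norm_triangle_ineq]) (simp add: norm_mult)
    then show ?thesis unfolding bessel_Y_nat_eq using 3 by (meson add_left_mono order_trans)
  qed
  also have "cmod (2 / of_real pi * (Ln (z / 2) + euler_mascheroni) * bessel_J_nat n z) \<le> 2 * L * (P * exp (2 * t))"
    unfolding norm_mult L_def[symmetric] using pi1 J P by (intro mult_mono) (auto simp: norm_divide L_def)
  also have "cmod (1 / of_real pi * ((2 / z) ^ n * bessel_polar n ((z / 2)\<^sup>2))) \<le> 1 * (P * exp t)"
    unfolding norm_mult[of "1 / of_real pi"] using pi1 Q P by (intro mult_mono) (auto simp: norm_divide)
  also have "cmod (1 / of_real pi * ((z / 2) ^ n * bessel_psi n ((z / 2)\<^sup>2))) \<le> 1 * (P * (2 * (1 + t) * exp (2 * t)))"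
    unfolding norm_mult[of "1 / of_real pi"] using pi1 S P by (intro mult_mono) (auto simp: norm_divide)
  also note J
  finally have "cmod (hankel_nat n z) \<le> P * exp (2 * t) + (2 * L * (P * exp (2 * t)) + 1 * (P * exp t) + 1 * (P * (2 * (1 + t) * exp (2 * t))))"
    by simp
  also have "\<dots> = P * hankel_const z"
    unfolding hankel_const_def Let_def x_def[symmetric] t_def[symmetric] L_def[symmetric] by (simp only: algebra_simps)
  finally show ?thesis by (simp add: P_def x_def)
qed

lemma norm_hankel1_le:
  assumes "z \<noteq> 0"
  shows "cmod (hankel1 m z) \<le> fact (nat \<bar>m\<bar> - 1) * (2 / cmod z) ^ nat \<bar>m\<bar> * hankel_const z"
proof -
  have "cmod (hankel1 (- int n) z) = cmod (hankel_nat n z)" for n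
    by (simp add: hankel1_minus hankel1_of_nat norm_mult norm_power)
  then show ?thesis using norm_hankel_nat_le[OF assms] hankel1_of_nat
    by (cases m rule: int_cases2) auto
qed

text \<open>The logarithm is continuous off its cut, and \<open>K\<close> stays off the cut when scaled by positive numbers.\<close>
lemma hankel_const_bounded:
  assumes K: "compact K" "K \<subseteq> - \<real>\<^sub>\<le>\<^sub>0" and r0: "r0 > 0"
  shows "\<exists>B>0. \<forall>k\<in>K. \<forall>r\<in>{r0..r1}. hankel_const (k * of_real r) \<le> B"
proof -
  let ?f = "\<lambda>p :: complex \<times> real. hankel_const (fst p * of_real (snd p))"
  have nz: "a * of_real b / 2 \<notin> \<real>\<^sub>\<le>\<^sub>0" if "a \<in> K" "b \<ge> r0" for a b
    using wave_number_times_pos[of a "b / 2"] that r0 K by auto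
  have "continuous_on (K \<times> {r0..r1}) ?f" unfolding hankel_const_def Let_def
    by (intro continuous_intros) (use nz in auto)
  then have "bounded (?f ` (K \<times> {r0..r1}))"
    using K by (intro compact_imp_bounded compact_continuous_image compact_Times) auto
  then obtain B where B: "\<And>y. y \<in> ?f ` (K \<times> {r0..r1}) \<Longrightarrow> norm y \<le> B" unfolding bounded_iff by blast
  have "\<forall>k\<in>K. \<forall>r\<in>{r0..r1}. hankel_const (k * of_real r) \<le> \<bar>B\<bar> + 1"
  proof (intro ballI)
    fix k r assume "k \<in> K" "r \<in> {r0..r1}"
    then have "norm (?f (k, r)) \<le> B" by (intro B imageI) auto
    then show "hankel_const (k * of_real r) \<le> \<bar>B\<bar> + 1" by simp
  qed
  then show ?thesis by (intro exI[of _ "\<bar>B\<bar> + 1"]) auto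
qed

lemma norm_hankel_wave_le:
  assumes "k \<noteq> 0" "z \<noteq> 0" "hankel_const (k * of_real (cmod z)) \<le> B"
  shows "cmod (hankel_wave k m z) \<le> B * fact (nat \<bar>m\<bar> - 1) * (2 / (cmod k * cmod z)) ^ nat \<bar>m\<bar>"
proof -
  have "cmod (hankel_wave k m z) = cmod (hankel1 m (k * of_real (cmod z)))"
    using assms(2) by (simp add: hankel_wave_def norm_mult norm_power_int norm_divide)
  also have "\<dots> \<le> fact (nat \<bar>m\<bar> - 1) * (2 / (cmod k * cmod z)) ^ nat \<bar>m\<bar> * hankel_const (k * of_real (cmod z))"
    using norm_hankel1_le[of "k * of_real (cmod z)" m] assms by (simp add: norm_mult)
  also have "\<dots> \<le> fact (nat \<bar>m\<bar> - 1) * (2 / (cmod k * cmod z)) ^ nat \<bar>m\<bar> * B"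
    using assms by (intro mult_left_mono) auto
  finally show ?thesis by (simp add: mult_ac)
qed

section \<open>Graf's addition theorem\<close>

lemma sum_telescope_int:
  fixes f :: "int \<Rightarrow> 'a :: ab_group_add"
  shows "(\<Sum>m=-int M..int M. f (m + 1) - f m) = f (int M + 1) - f (- int M)"
proof (induction M)
  case (Suc M)
  have "{- int (Suc M)..int (Suc M)} = insert (int M + 1) (insert (- 1 - int M) {- int M..int M})" by auto
  then show ?case using Suc by (simp add: algebra_simps)
qed simp

lemma sum_symmetric_int_Suc:
  fixes f :: "int \<Rightarrow> 'a :: ab_group_add"
  shows "(\<Sum>m=-int (Suc M)..int (Suc M). f m) = (\<Sum>m=-int M..int M. f m) + (f (int (Suc M)) + f (- int (Suc M)))"
proof -
  have "{- int (Suc M)..int (Suc M)} = insert (int M + 1) (insert (- 1 - int M) {- int M..int M})" by auto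
  then show ?thesis by (simp add: algebra_simps)
qed

text \<open>Products of a Hankel wave of order \<open>p\<close> and a Bessel wave of order \<open>q\<close>, with orders that differ by at
most two: if they were equal, the factorials would cancel and leave \<open>(y / x) ^ p\<close>. A discrepancy of
two costs at most two factors \<open>y\<close> or \<open>1 / x\<close> and a quadratic factor in the order.\<close>
lemma fact_power_quotient_bound:
  fixes x y \<rho> :: real
  assumes "0 < x0" "x0 \<le> x" "0 \<le> y" "y \<le> \<rho> * x" "0 \<le> \<rho>" "\<rho> \<le> 1" "y \<le> y1"
    and "p \<le> q + 2" "q \<le> p + 2" "N \<le> p" "N \<le> q"
  shows "fact p / x ^ p * (y ^ q / fact q) \<le> (1 + y1)\<^sup>2 * (1 + 1 / x0)\<^sup>2 * (real q + 2)\<^sup>2 * \<rho> ^ N"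
proof -
  have x: "x > 0" using assms by linarith
  have yx: "(y / x) ^ n \<le> \<rho> ^ N" if "N \<le> n" for n
  proof -
    have "y / x \<le> \<rho>" using x assms by (simp add: divide_simps)
    then have "(y / x) ^ n \<le> \<rho> ^ n" using x assms by (intro power_mono) auto
    also have "\<dots> \<le> \<rho> ^ N" using that assms by (intro power_decreasing) auto
    finally show ?thesis .
  qed
  have ge1: "1 \<le> (1 + y1)\<^sup>2" "1 \<le> (1 + 1 / x0)\<^sup>2" "1 \<le> (real q + 2)\<^sup>2" using assms by (auto intro!: one_le_power)
  have rN: "0 \<le> \<rho> ^ N" using assms by simp
  show ?thesis
  proof (cases "p \<le> q")
    case True
    then obtain d where d: "q = p + d" using le_Suc_ex by blast
    have "y ^ d \<le> (1 + y1) ^ d" using assms by (intro power_mono) auto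
    also have "\<dots> \<le> (1 + y1)\<^sup>2" using assms d by (intro power_increasing) auto
    finally have yd: "y ^ d \<le> (1 + y1)\<^sup>2" .
    have f: "fact p / fact q \<le> (1::real)" using True by (simp add: fact_mono)
    have "fact p / x ^ p * (y ^ q / fact q) = y ^ d * (fact p / fact q) * (y / x) ^ p"
      using x by (simp add: d power_add power_divide mult_ac)
    also have "\<dots> \<le> (1 + y1)\<^sup>2 * 1 * \<rho> ^ N"
      using yd f yx[OF assms(10)] x assms by (intro mult_mono) auto
    also have "\<dots> \<le> (1 + y1)\<^sup>2 * ((1 + 1 / x0)\<^sup>2 * (real q + 2)\<^sup>2) * \<rho> ^ N"
      using rN ge1 mult_mono[OF ge1(2,3)] by (intro mult_right_mono mult_left_mono) auto
    finally show ?thesis by (simp add: mult.assoc)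
  next
    case False
    then obtain d where d: "p = q + d" using le_Suc_ex nat_le_linear by blast
    have d2: "d = 1 \<or> d = 2" using d False assms(8) by auto
    have "(1 / x) ^ d \<le> (1 + 1 / x0) ^ d" using assms x by (intro power_mono) (auto simp: frac_le intro: add_increasing)
    also have "\<dots> \<le> (1 + 1 / x0)\<^sup>2" using assms d2 by (intro power_increasing) auto
    finally have xd: "(1 / x) ^ d \<le> (1 + 1 / x0)\<^sup>2" .
    have f: "fact p / fact q \<le> (real q + 2)\<^sup>2"
    proof -
      have "fact p / fact q = (if d = 1 then real q + 1 else (real q + 1) * (real q + 2))"
        using d2 by (auto simp: d numeral_2_eq_2 algebra_simps divide_simps)
      also have "\<dots> \<le> (real q + 2)\<^sup>2" by (auto simp: power2_eq_square algebra_simps)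
      finally show ?thesis .
    qed
    have "fact p / x ^ p * (y ^ q / fact q) = (1 / x) ^ d * (fact p / fact q) * (y / x) ^ q"
      using x by (simp add: d power_add power_divide mult_ac)
    also have "\<dots> \<le> (1 + 1 / x0)\<^sup>2 * (real q + 2)\<^sup>2 * \<rho> ^ N"
      using xd f yx[OF assms(11)] x assms by (intro mult_mono) auto
    also have "\<dots> \<le> (1 + y1)\<^sup>2 * ((1 + 1 / x0)\<^sup>2 * (real q + 2)\<^sup>2 * \<rho> ^ N)"
      using mult_right_mono[OF ge1(1), of "(1 + 1 / x0)\<^sup>2 * (real q + 2)\<^sup>2 * \<rho> ^ N"] rN by simp
    finally show ?thesis by (simp add: mult.assoc)
  qed
qed

lemma bessel_wave_0: "bessel_wave k m 0 = (if m = 0 then 1 else 0)"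
proof -
  have "bessel_phi 0 0 = 1" unfolding bessel_phi_def
    using powser_zero[of "\<lambda>p. (-1) ^ p / (fact p * fact (0 + p)) :: complex"] by simp
  then show ?thesis by (auto simp: bessel_wave_def bessel_mono_def)
qed

lemma hankel_wave_D_scaleR: "hankel_wave_D k m z (t *\<^sub>R h) = t *\<^sub>R hankel_wave_D k m z h"
  by (simp add: hankel_wave_D_def scaleR_conv_of_real algebra_simps)

lemma bessel_wave_D_scaleR: "bessel_wave_D k m z (t *\<^sub>R h) = t *\<^sub>R bessel_wave_D k m z h"
  by (simp add: bessel_wave_D_def scaleR_conv_of_real algebra_simps)

text \<open>Along \<open>z - s w\<close> and \<open>(1 - s) w\<close> both arguments move with velocity \<open>- w\<close>. By the shift rules for
the derivatives, the \<open>m\<close>-th summand has a derivative of the form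
\<open>k / 2 * (w * (A (m + 1) - A m) + cnj w * (B (m + 1) - B m))\<close>, so only the two ends of the
range of summation survive.\<close>
lemma graf_homotopy_deriv:
  assumes k: "k \<notin> \<real>\<^sub>\<le>\<^sub>0" and z: "z - s *\<^sub>R w \<noteq> 0"
  shows "((\<lambda>s. \<Sum>m=-int M..int M. hankel_wave k (m + l) (z - s *\<^sub>R w) * bessel_wave k m ((1 - s) *\<^sub>R w))
     has_vector_derivative
       (k / 2 * (w * (hankel_wave k (int M + l) (z - s *\<^sub>R w) * bessel_wave k (int M + 1) ((1 - s) *\<^sub>R w)
               - hankel_wave k (- int M - 1 + l) (z - s *\<^sub>R w) * bessel_wave k (- int M) ((1 - s) *\<^sub>R w))
        + cnj w * (hankel_wave k (int M + 1 + l) (z - s *\<^sub>R w) * bessel_wave k (int M) ((1 - s) *\<^sub>R w)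
               - hankel_wave k (- int M + l) (z - s *\<^sub>R w) * bessel_wave k (- int M - 1) ((1 - s) *\<^sub>R w))))) (at s within S)"
proof -
  define V U where "V = (\<lambda>m. hankel_wave k m (z - s *\<^sub>R w))" and "U = (\<lambda>m. bessel_wave k m ((1 - s) *\<^sub>R w))"
  have dV: "((\<lambda>s. hankel_wave k m (z - s *\<^sub>R w)) has_vector_derivative hankel_wave_D k m (z - s *\<^sub>R w) (- w)) (at s within S)" for m
  proof -
    have "((\<lambda>s. z - s *\<^sub>R w) has_derivative (\<lambda>t. t *\<^sub>R (- w))) (at s within S)"
      by (auto intro!: derivative_eq_intros)
    from has_derivative_compose[OF this hankel_wave_deriv[OF k z]] show ?thesis
      by (simp only: has_vector_derivative_def hankel_wave_D_scaleR)
  qed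
  have dU: "((\<lambda>s. bessel_wave k m ((1 - s) *\<^sub>R w)) has_vector_derivative bessel_wave_D k m ((1 - s) *\<^sub>R w) (- w)) (at s within S)" for m
  proof -
    have "((\<lambda>s. (1 - s) *\<^sub>R w) has_derivative (\<lambda>t. t *\<^sub>R (- w))) (at s within S)"
      by (auto intro!: derivative_eq_intros simp: algebra_simps)
    from has_derivative_compose[OF this bessel_wave_deriv] show ?thesis
      by (simp only: has_vector_derivative_def bessel_wave_D_scaleR)
  qed
  have "((\<lambda>s. \<Sum>m=-int M..int M. hankel_wave k (m + l) (z - s *\<^sub>R w) * bessel_wave k m ((1 - s) *\<^sub>R w))
     has_vector_derivative (\<Sum>m=-int M..int M. hankel_wave k (m + l) (z - s *\<^sub>R w) * bessel_wave_D k m ((1 - s) *\<^sub>R w) (- w)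
        + hankel_wave_D k (m + l) (z - s *\<^sub>R w) (- w) * bessel_wave k m ((1 - s) *\<^sub>R w))) (at s within S)"
    by (intro has_vector_derivative_sum has_vector_derivative_mult dU dV)
  moreover have "(\<Sum>m=-int M..int M. hankel_wave k (m + l) (z - s *\<^sub>R w) * bessel_wave_D k m ((1 - s) *\<^sub>R w) (- w)
        + hankel_wave_D k (m + l) (z - s *\<^sub>R w) (- w) * bessel_wave k m ((1 - s) *\<^sub>R w))
     = (\<Sum>m=-int M..int M. k / 2 * w * (V (m + 1 - 1 + l) * U (m + 1) - V (m - 1 + l) * U m)
         + k / 2 * cnj w * (V (m + 1 + l) * U (m + 1 - 1) - V (m + l) * U (m - 1)))"
    by (intro sum.cong refl) (simp add: bessel_wave_D_def hankel_wave_D_def V_def U_def algebra_simps add_divide_distrib)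
  moreover have "\<dots> = k / 2 * w * (\<Sum>m=-int M..int M. V (m + 1 - 1 + l) * U (m + 1) - V (m - 1 + l) * U m)
     + k / 2 * cnj w * (\<Sum>m=-int M..int M. V (m + 1 + l) * U (m + 1 - 1) - V (m + l) * U (m - 1))"
    unfolding sum.distrib sum_distrib_left ..
  moreover have "\<dots> = k / 2 * (w * (V (int M + l) * U (int M + 1) - V (- int M - 1 + l) * U (- int M))
     + cnj w * (V (int M + 1 + l) * U (int M) - V (- int M + l) * U (- int M - 1)))"
    unfolding sum_telescope_int[of "\<lambda>m. V (m - 1 + l) * U m" M] sum_telescope_int[of "\<lambda>m. V (m + l) * U (m - 1)" M]
    by (simp add: algebra_simps)
  ultimately show ?thesis unfolding V_def U_def by (simp only:)
qed

text \<open>Bounds one boundary term of the homotopy. The quantities \<open>x0\<close> and \<open>y1\<close> make the constant uniform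
along the path, and \<open>N\<close> is a common lower bound of the two orders.\<close>
lemma norm_wave_product_le:
  assumes k0: "k \<noteq> 0" and z: "z \<noteq> 0" and B: "hankel_const (k * of_real (cmod z)) \<le> B"
    and x0: "0 < x0" "x0 \<le> cmod k * cmod z / 2"
    and w: "cmod w \<le> \<rho> * cmod z" "0 \<le> \<rho>" "\<rho> \<le> 1" and y1: "cmod k * cmod w / 2 \<le> y1"
    and n: "nat \<bar>n\<bar> \<le> nat \<bar>q\<bar> + 2" "nat \<bar>q\<bar> \<le> nat \<bar>n\<bar> + 2" "N \<le> nat \<bar>n\<bar>" "N \<le> nat \<bar>q\<bar>" "nat \<bar>q\<bar> \<le> N + 2"
    and B0: "B \<ge> 0"
  shows "cmod (hankel_wave k n z * bessel_wave k q w)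
    \<le> B * exp (y1\<^sup>2) * (1 + y1)\<^sup>2 * (1 + 1 / x0)\<^sup>2 * ((real N + 4)\<^sup>2 * \<rho> ^ N)"
proof -
  define x where "x = cmod k * cmod z / 2"
  define y where "y = cmod k * cmod w / 2"
  let ?p = "nat \<bar>n\<bar>" and ?q = "nat \<bar>q\<bar>"
  have x: "x > 0" and y: "y \<ge> 0" "y \<le> y1" using x0 y1 by (auto simp: x_def y_def)
  have yx: "y \<le> \<rho> * x" using mult_left_mono[OF w(1), of "cmod k"] by (simp add: x_def y_def mult_ac)
  have "cmod (hankel_wave k n z) \<le> B * fact (?p - 1) * (2 / (cmod k * cmod z)) ^ ?p"
    by (rule norm_hankel_wave_le[OF k0 z B])
  also have "\<dots> \<le> B * (fact ?p / x ^ ?p)"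
  proof -
    have e: "2 / (cmod k * cmod z) = 1 / x" by (simp add: x_def)
    have "fact (?p - 1) * (1 / x) ^ ?p \<le> fact ?p * (1 / x) ^ ?p"
      using x by (intro mult_right_mono fact_mono) auto
    from mult_left_mono[OF this B0] show ?thesis unfolding e by (simp add: power_divide mult.assoc)
  qed
  finally have V: "cmod (hankel_wave k n z) \<le> B * (fact ?p / x ^ ?p)" .
  have "cmod (bessel_wave k q w) \<le> y ^ ?q / fact ?q * exp (y\<^sup>2)"
    using norm_bessel_wave_le[of k q w] by (simp add: y_def)
  also have "\<dots> \<le> y ^ ?q / fact ?q * exp (y1\<^sup>2)"
    using y by (intro mult_left_mono) (auto intro: power_mono)
  finally have U: "cmod (bessel_wave k q w) \<le> y ^ ?q / fact ?q * exp (y1\<^sup>2)" .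
  have "cmod (hankel_wave k n z * bessel_wave k q w) \<le> (B * (fact ?p / x ^ ?p)) * (y ^ ?q / fact ?q * exp (y1\<^sup>2))"
    unfolding norm_mult using V U B0 x by (intro mult_mono) auto
  also have "\<dots> = B * exp (y1\<^sup>2) * (fact ?p / x ^ ?p * (y ^ ?q / fact ?q))" by (simp add: mult_ac)
  also have "\<dots> \<le> B * exp (y1\<^sup>2) * ((1 + y1)\<^sup>2 * (1 + 1 / x0)\<^sup>2 * (real ?q + 2)\<^sup>2 * \<rho> ^ N)"
    using B0 x0 w y yx n by (intro mult_left_mono fact_power_quotient_bound) (auto simp: x_def)
  also have "\<dots> \<le> B * exp (y1\<^sup>2) * ((1 + y1)\<^sup>2 * (1 + 1 / x0)\<^sup>2 * (real N + 4)\<^sup>2 * \<rho> ^ N)"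
    using B0 n(5) w(2) by (intro mult_left_mono mult_right_mono power_mono) auto
  finally show ?thesis by (simp only: mult.assoc)
qed

lemma square_times_power_tendsto_0:
  fixes \<rho> :: real assumes "0 \<le> \<rho>" "\<rho> < 1"
  shows "(\<lambda>n. (real n + 4)\<^sup>2 * \<rho> ^ n) \<longlonglongrightarrow> 0"
proof -
  define q where "q = sqrt \<rho>"
  have q: "norm q < 1" "q * q = \<rho>" using assms by (auto simp: q_def real_sqrt_lt_1_iff)
  have "(\<lambda>n. real n * q ^ n + 4 * q ^ n) \<longlonglongrightarrow> 0 + 4 * 0"
    using q by (intro tendsto_intros powser_times_n_limit_0 LIMSEQ_power_zero)
  then have "(\<lambda>n. (real n * q ^ n + 4 * q ^ n)\<^sup>2) \<longlonglongrightarrow> 0\<^sup>2" by (intro tendsto_power) simp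
  moreover have "(real n * q ^ n + 4 * q ^ n)\<^sup>2 = (real n + 4)\<^sup>2 * \<rho> ^ n" for n
  proof -
    have "real n * q ^ n + 4 * q ^ n = (real n + 4) * q ^ n" by (simp add: distrib_right)
    then show ?thesis by (simp add: power_mult_distrib q(2)[symmetric]) (simp add: power2_eq_square power_mult_distrib)
  qed
  ultimately show ?thesis by simp
qed

text \<open>The sum with \<open>M = Suc N\<close> terms on each side changes along the homotopy by at most the size of four
products of waves whose orders are at least \<open>N\<close>, which tends to \<open>0\<close>. The shift \<open>l\<close> by \<open>\<plusminus> 1\<close> is
included because the derivatives of the Hankel wave of order \<open>0\<close> have orders \<open>\<plusminus> 1\<close>.\<close>
theorem graf_addition:
  assumes k: "k \<notin> \<real>\<^sub>\<le>\<^sub>0" and wz: "cmod w < cmod z" and l: "\<bar>l\<bar> \<le> 1"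
  shows "(\<lambda>M. \<Sum>m=-int M..int M. hankel_wave k (m + l) z * bessel_wave k m w) \<longlonglongrightarrow> hankel_wave k l (z - w)"
proof -
  define r0 r1 \<rho> x0 y1 where "r0 = cmod z - cmod w" and "r1 = cmod z + cmod w" and "\<rho> = cmod w / cmod z"
    and "x0 = cmod k * r0 / 2" and "y1 = cmod k * cmod w / 2"
  have k0: "k \<noteq> 0" using k by auto
  have r0: "r0 > 0" using wz by (simp add: r0_def)
  have z0: "cmod z > 0" using wz by (smt (verit) norm_ge_zero)
  have \<rho>: "0 \<le> \<rho>" "\<rho> < 1" using wz z0 by (auto simp: \<rho>_def divide_simps)
  obtain B where B: "B > 0" "\<And>r. r \<in> {r0..r1} \<Longrightarrow> hankel_const (k * of_real r) \<le> B"
    using hankel_const_bounded[of "{k}" r0 r1] k r0 by auto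
  define C where "C = B * exp (y1\<^sup>2) * (1 + y1)\<^sup>2 * (1 + 1 / x0)\<^sup>2"
  define D where "D N = cmod k / 2 * (cmod w * (4 * (C * ((real N + 4)\<^sup>2 * \<rho> ^ N))))" for N
  define h where "h M s = (\<Sum>m=-int M..int M. hankel_wave k (m + l) (z - s *\<^sub>R w) * bessel_wave k m ((1 - s) *\<^sub>R w))" for M s
  have bound: "cmod (h (Suc N) 1 - h (Suc N) 0) \<le> D N * norm (1 - 0 :: real)" for N
  proof (rule differentiable_bound[where S = "{0..1::real}"])
    let ?M = "Suc N"
    define d where "d = (\<lambda>s. k / 2 * (w * (hankel_wave k (int ?M + l) (z - s *\<^sub>R w) * bessel_wave k (int ?M + 1) ((1 - s) *\<^sub>R w)
               - hankel_wave k (- int ?M - 1 + l) (z - s *\<^sub>R w) * bessel_wave k (- int ?M) ((1 - s) *\<^sub>R w))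
        + cnj w * (hankel_wave k (int ?M + 1 + l) (z - s *\<^sub>R w) * bessel_wave k (int ?M) ((1 - s) *\<^sub>R w)
               - hankel_wave k (- int ?M + l) (z - s *\<^sub>R w) * bessel_wave k (- int ?M - 1) ((1 - s) *\<^sub>R w))))"
    fix s :: real assume s: "s \<in> {0..1}"
    have sw: "cmod (s *\<^sub>R w) \<le> cmod w" using s by (simp add: mult_left_le_one_le)
    have ge: "r0 \<le> cmod (z - s *\<^sub>R w)" using norm_triangle_ineq2[of z "s *\<^sub>R w"] sw by (simp add: r0_def)
    have le: "cmod (z - s *\<^sub>R w) \<le> r1" using norm_triangle_ineq4[of z "s *\<^sub>R w"] sw by (simp add: r1_def)
    have nz: "z - s *\<^sub>R w \<noteq> 0" using ge r0 by auto
    show "(h ?M has_derivative (\<lambda>t. t *\<^sub>R d s)) (at s within {0..1})"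
      using graf_homotopy_deriv[OF k nz, where M = ?M and l = l and S = "{0..1}"]
      unfolding h_def[abs_def] d_def has_vector_derivative_def .
    \<comment> \<open>The ratio of the two moduli does not grow along the path:
      \<open>(\<bar>w\<bar> - s \<bar>w\<bar>) / (\<bar>z\<bar> - s \<bar>w\<bar>) \<le> \<bar>w\<bar> / \<bar>z\<bar>\<close> because \<open>\<bar>w\<bar> \<le> \<bar>z\<bar>\<close>.\<close>
    have rat: "cmod ((1 - s) *\<^sub>R w) \<le> \<rho> * cmod (z - s *\<^sub>R w)"
    proof -
      have "cmod z - s * cmod w \<le> cmod (z - s *\<^sub>R w)" using norm_triangle_ineq2[of z "s *\<^sub>R w"] s by simp
      then have "\<rho> * (cmod z - s * cmod w) \<le> \<rho> * cmod (z - s *\<^sub>R w)" using \<rho> by (intro mult_left_mono)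
      moreover have "(1 - s) * cmod w \<le> \<rho> * (cmod z - s * cmod w)"
      proof -
        have "\<rho> * (cmod z - s * cmod w) = cmod w - \<rho> * (s * cmod w)" using z0 by (simp add: \<rho>_def right_diff_distrib)
        moreover have "\<rho> * (s * cmod w) \<le> 1 * (s * cmod w)" using s \<rho> by (intro mult_right_mono) auto
        ultimately show ?thesis by (simp add: left_diff_distrib)
      qed
      ultimately show ?thesis using s by simp
    qed
    have y1': "cmod k * cmod ((1 - s) *\<^sub>R w) / 2 \<le> y1"
      using s unfolding y1_def by (intro divide_right_mono mult_left_mono) (auto simp: mult_left_le_one_le)
    have x0': "0 < x0" "x0 \<le> cmod k * cmod (z - s *\<^sub>R w) / 2"
      using k0 r0 ge by (auto simp: x0_def intro!: divide_right_mono mult_left_mono)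
    have P: "cmod (hankel_wave k n (z - s *\<^sub>R w) * bessel_wave k q ((1 - s) *\<^sub>R w)) \<le> C * ((real N + 4)\<^sup>2 * \<rho> ^ N)"
      if "nat \<bar>n\<bar> \<le> nat \<bar>q\<bar> + 2" "nat \<bar>q\<bar> \<le> nat \<bar>n\<bar> + 2" "N \<le> nat \<bar>n\<bar>" "N \<le> nat \<bar>q\<bar>" "nat \<bar>q\<bar> \<le> N + 2" for n q
      unfolding C_def by (rule norm_wave_product_le[OF k0 nz B(2) x0' rat \<rho>(1) _ y1' that]) (use B ge le \<rho> in auto)
    have P4: "cmod (hankel_wave k (int ?M + l) (z - s *\<^sub>R w) * bessel_wave k (int ?M + 1) ((1 - s) *\<^sub>R w)) \<le> C * ((real N + 4)\<^sup>2 * \<rho> ^ N)"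
      "cmod (hankel_wave k (- int ?M - 1 + l) (z - s *\<^sub>R w) * bessel_wave k (- int ?M) ((1 - s) *\<^sub>R w)) \<le> C * ((real N + 4)\<^sup>2 * \<rho> ^ N)"
      "cmod (hankel_wave k (int ?M + 1 + l) (z - s *\<^sub>R w) * bessel_wave k (int ?M) ((1 - s) *\<^sub>R w)) \<le> C * ((real N + 4)\<^sup>2 * \<rho> ^ N)"
      "cmod (hankel_wave k (- int ?M + l) (z - s *\<^sub>R w) * bessel_wave k (- int ?M - 1) ((1 - s) *\<^sub>R w)) \<le> C * ((real N + 4)\<^sup>2 * \<rho> ^ N)"
      by (rule P; use l in linarith)+
    have tri: "cmod (a * (x * (p - q) + cnj x * (r - t))) \<le> cmod a * (cmod x * (4 * E))"
      if "cmod p \<le> E" "cmod q \<le> E" "cmod r \<le> E" "cmod t \<le> E" for a x p q r t E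
    proof -
      have "cmod (x * (p - q) + cnj x * (r - t)) \<le> cmod x * cmod (p - q) + cmod x * cmod (r - t)"
        by (rule order_trans[OF norm_triangle_ineq]) (simp add: norm_mult)
      also have "\<dots> \<le> cmod x * (E + E) + cmod x * (E + E)"
        using that norm_triangle_ineq4[of p q] norm_triangle_ineq4[of r t]
        by (intro add_mono mult_left_mono) auto
      finally have "cmod (x * (p - q) + cnj x * (r - t)) \<le> cmod x * (4 * E)" by (simp add: algebra_simps)
      then show ?thesis unfolding norm_mult[of a] by (intro mult_left_mono) auto
    qed
    have "cmod (d s) \<le> cmod (k / 2) * (cmod w * (4 * (C * ((real N + 4)\<^sup>2 * \<rho> ^ N))))"
      unfolding d_def by (rule tri[OF P4])
    then have "cmod (d s) \<le> D N" by (simp add: D_def norm_divide)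
    then show "onorm (\<lambda>t. t *\<^sub>R d s) \<le> D N"
      by (intro onorm_le) (metis mult.commute mult_left_mono norm_ge_zero norm_scaleR real_norm_def)
  qed auto
  have h1: "h M 1 = hankel_wave k l (z - w)" for M
  proof -
    have "h M 1 = (\<Sum>m=-int M..int M. if m = 0 then hankel_wave k l (z - w) else 0)"
      unfolding h_def by (intro sum.cong) (auto simp: bessel_wave_0)
    then show ?thesis by simp
  qed
  have "(\<lambda>N. cmod k / 2 * (cmod w * (4 * (C * ((real N + 4)\<^sup>2 * \<rho> ^ N))))) \<longlonglongrightarrow> cmod k / 2 * (cmod w * (4 * (C * 0)))"
    by (intro tendsto_intros square_times_power_tendsto_0 \<rho>)
  then have "D \<longlonglongrightarrow> 0" by (simp add: D_def[abs_def])
  then have "(\<lambda>N. h (Suc N) 1 - h (Suc N) 0) \<longlonglongrightarrow> 0"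
    by (rule Lim_null_comparison[rotated]) (use bound in auto)
  then have "(\<lambda>N. h (Suc N) 1 - (h (Suc N) 1 - h (Suc N) 0)) \<longlonglongrightarrow> hankel_wave k l (z - w) - 0"
    unfolding h1 by (intro tendsto_intros)
  then have "(\<lambda>N. h (Suc N) 0) \<longlonglongrightarrow> hankel_wave k l (z - w)" by simp
  then have "(\<lambda>M. h M 0) \<longlonglongrightarrow> hankel_wave k l (z - w)" by (rule LIMSEQ_imp_Suc)
  then show ?thesis by (simp add: h_def)
qed

text \<open>The two terms of order \<open>\<plusminus> m\<close> together are at most \<open>2 * C * a ^ (m - 1)\<close>, whence a geometric tail;
partial sums are compared with a later partial sum, which then tends to the limit.\<close>
lemma symmetric_tail_bound:
  fixes T :: "int \<Rightarrow> complex"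
  assumes lim: "(\<lambda>M. \<Sum>m=-int M..int M. T m) \<longlonglongrightarrow> L"
    and a: "0 \<le> a" "a < 1" and T: "\<And>m. m \<noteq> 0 \<Longrightarrow> cmod (T m) \<le> C * a ^ (nat \<bar>m\<bar> - 1)"
  shows "cmod (L - (\<Sum>m=-int M..int M. T m)) \<le> 2 * C * a ^ M / (1 - a)"
proof -
  define S where "S M = (\<Sum>m=-int M..int M. T m)" for M
  have C: "C \<ge> 0" using order_trans[OF norm_ge_zero T[of 1]] by simp
  have step: "cmod (S (M + d) - S M) \<le> 2 * C * a ^ M * (1 - a ^ d) / (1 - a)" for d
  proof (induction d)
    case (Suc d)
    have "S (M + Suc d) = S (M + d) + (T (int (Suc (M + d))) + T (- int (Suc (M + d))))"
      unfolding S_def using sum_symmetric_int_Suc[of T "M + d"] by simp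
    then have "cmod (S (M + Suc d) - S M) \<le> cmod (S (M + d) - S M) + (cmod (T (int (Suc (M + d)))) + cmod (T (- int (Suc (M + d)))))"
      by (smt (verit) norm_triangle_ineq add_diff_eq diff_add_eq)
    also have "\<dots> \<le> 2 * C * a ^ M * (1 - a ^ d) / (1 - a) + (C * a ^ (M + d) + C * a ^ (M + d))"
    proof (intro add_mono Suc)
      show "cmod (T (int (Suc (M + d)))) \<le> C * a ^ (M + d)"
        using T[of "int (Suc (M + d))"] by (simp del: of_nat_Suc)
      show "cmod (T (- int (Suc (M + d)))) \<le> C * a ^ (M + d)"
        using T[of "- int (Suc (M + d))"] by (simp del: of_nat_Suc)
    qed
    also have "\<dots> = 2 * C * a ^ M * (1 - a ^ Suc d) / (1 - a)"
      using a by (simp add: field_simps power_add)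
    finally show ?case .
  qed simp
  have "(\<lambda>d. S (M + d)) \<longlonglongrightarrow> L"
    using LIMSEQ_ignore_initial_segment[OF lim, of M] unfolding S_def by (simp add: add.commute)
  then have "(\<lambda>d. cmod (S (M + d) - S M)) \<longlonglongrightarrow> cmod (L - S M)" by (intro tendsto_intros)
  moreover have "cmod (S (M + d) - S M) \<le> 2 * C * a ^ M / (1 - a)" for d
  proof -
    have "2 * C * a ^ M * (1 - a ^ d) / (1 - a) \<le> 2 * C * a ^ M * 1 / (1 - a)"
      using a C by (intro divide_right_mono mult_left_mono) auto
    then show ?thesis using step[of d] by simp
  qed
  ultimately show ?thesis unfolding S_def[symmetric] by (intro LIMSEQ_le_const2) auto
qed

text \<open>Here the orders of the two waves agree, and the factorials \<open>fact (m - 1)\<close> and \<open>1 / fact m\<close> cancel without a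
polynomial loss; this is what gives a clean geometric series. A derivative lowers the order of the
Bessel wave by one, and one factor \<open>\<bar>w\<bar> / \<bar>z\<bar>\<close> is traded for \<open>1 / \<bar>z\<bar> \<le> 1 / r0\<close>.\<close>
lemma graf_terms_bound:
  assumes K: "compact K" "K \<subseteq> - \<real>\<^sub>\<le>\<^sub>0" and r0: "0 < r0"
  shows "\<exists>C>0. \<forall>k\<in>K. \<forall>z w a h. \<forall>m::int. r0 \<le> cmod z \<and> cmod z \<le> r1 \<and> cmod w \<le> a * cmod z \<and> 0 \<le> a \<and> a < 1 \<and> m \<noteq> 0 \<longrightarrow>
     cmod (hankel_wave k m z * bessel_wave k m w) \<le> C * a * a ^ (nat \<bar>m\<bar> - 1) \<and>
     cmod (hankel_wave k m z * bessel_wave_D k m w h) \<le> C * cmod h * a ^ (nat \<bar>m\<bar> - 1)"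
proof -
  obtain B where B: "B > 0" "\<And>k r. k \<in> K \<Longrightarrow> r \<in> {r0..r1} \<Longrightarrow> hankel_const (k * of_real r) \<le> B"
    using hankel_const_bounded[OF K r0, of r1] by blast
  obtain k1 where k1: "\<And>k. k \<in> K \<Longrightarrow> cmod k \<le> k1"
    using compact_imp_bounded[OF K(1)] unfolding bounded_iff by blast
  define Y where "Y = \<bar>k1\<bar> * \<bar>r1\<bar> / 2"
  define C where "C = B * exp (Y\<^sup>2) * (1 + 2 * ((1 + Y\<^sup>2) / r0))"
  have C: "C > 0" unfolding C_def using B r0 by (intro mult_pos_pos add_pos_nonneg) auto
  have C1: "B * exp (Y\<^sup>2) \<le> C" "B * exp (Y\<^sup>2) * (2 * ((1 + Y\<^sup>2) / r0)) \<le> C"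
    unfolding C_def using B r0 by (auto simp: distrib_left)
  show ?thesis
  proof (intro exI[of _ C] conjI ballI allI impI C)
    fix k z w a h and m :: int
    assume kK: "k \<in> K" and "r0 \<le> cmod z \<and> cmod z \<le> r1 \<and> cmod w \<le> a * cmod z \<and> 0 \<le> a \<and> a < 1 \<and> m \<noteq> 0"
    then have zr: "r0 \<le> cmod z" "cmod z \<le> r1" and w: "cmod w \<le> a * cmod z" and a: "0 \<le> a" "a < 1" and m: "m \<noteq> (0::int)" by auto
    have k0: "k \<noteq> 0" and z0: "z \<noteq> 0" using kK K zr r0 by auto
    define n where "n = nat \<bar>m\<bar> - 1"
    have n: "nat \<bar>m\<bar> = Suc n" using m by (simp add: n_def)
    define x where "x = cmod k * cmod z / 2"
    define y where "y = cmod k * cmod w / 2"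
    have x: "x > 0" and y: "y \<ge> 0" using k0 z0 by (auto simp: x_def y_def)
    have yx: "y \<le> a * x" using mult_left_mono[OF w, of "cmod k"] by (simp add: x_def y_def mult_ac)
    have yY: "y \<le> Y"
    proof -
      have "a * cmod z \<le> 1 * cmod z" using a by (intro mult_right_mono) auto
      then have "cmod w \<le> \<bar>r1\<bar>" using w zr by linarith
      moreover have "cmod k \<le> \<bar>k1\<bar>" using k1[OF kK] by linarith
      ultimately show ?thesis unfolding y_def Y_def by (intro divide_right_mono mult_mono) auto
    qed
    have y2: "exp (y\<^sup>2) \<le> exp (Y\<^sup>2)" "y\<^sup>2 \<le> Y\<^sup>2" using y yY by (auto intro: power_mono)
    have V: "cmod (hankel_wave k m z) \<le> B * (fact n / x ^ Suc n)"
      using norm_hankel_wave_le[OF k0 z0 B(2)[OF kK, of "cmod z"], of m] zr x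
      by (simp add: n x_def power_divide)
    have yxn: "(y / x) ^ j \<le> a ^ j" for j using yx x y by (intro power_mono) (auto simp: divide_simps)
    have U: "cmod (bessel_wave k q w) \<le> y ^ nat \<bar>q\<bar> / fact (nat \<bar>q\<bar>) * exp (Y\<^sup>2)" for q
      using norm_bessel_wave_le[of k q w] y2 y unfolding y_def[symmetric]
      by (meson divide_nonneg_nonneg fact_ge_zero mult_left_mono order_trans zero_le_power)
    have "cmod (hankel_wave k m z * bessel_wave k m w) \<le> B * (fact n / x ^ Suc n) * (y ^ Suc n / fact (Suc n) * exp (Y\<^sup>2))"
      unfolding norm_mult using V U[of m] B x y by (intro mult_mono) (auto simp: n)
    also have "\<dots> = B * exp (Y\<^sup>2) * (fact n / fact (Suc n)) * (y / x) ^ Suc n"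
      by (simp only: power_divide times_divide_eq_left times_divide_eq_right mult_ac divide_divide_eq_left)
    also have "\<dots> \<le> B * exp (Y\<^sup>2) * 1 * a ^ Suc n"
      using B x y by (intro mult_mono yxn mult_left_mono) (auto simp: divide_simps)
    also have "\<dots> \<le> C * (a ^ Suc n)" using C1 a by (intro mult_right_mono) auto
    finally show "cmod (hankel_wave k m z * bessel_wave k m w) \<le> C * a * a ^ (nat \<bar>m\<bar> - 1)" by (simp add: n)
    have U2: "cmod (bessel_wave k q w) \<le> y ^ n / fact n * ((1 + Y\<^sup>2) * exp (Y\<^sup>2))"
      if "nat \<bar>q\<bar> = n \<or> nat \<bar>q\<bar> = Suc (Suc n)" for q
    proof -
      have "y ^ nat \<bar>q\<bar> / fact (nat \<bar>q\<bar>) \<le> y ^ n / fact n * (1 + Y\<^sup>2)"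
        using that
      proof
        assume "nat \<bar>q\<bar> = n" then show ?thesis using y by (simp add: mult_le_cancel_left1 divide_right_mono)
      next
        assume q: "nat \<bar>q\<bar> = Suc (Suc n)"
        have f: "1 / fact (Suc (Suc n)) \<le> 1 / (fact n :: real)" by (intro divide_left_mono fact_mono) auto
        have "y ^ nat \<bar>q\<bar> / fact (nat \<bar>q\<bar>) = y ^ n * y\<^sup>2 * (1 / fact (Suc (Suc n)))" unfolding q by (simp add: power2_eq_square)
        also have "\<dots> \<le> y ^ n * (1 + Y\<^sup>2) * (1 / fact n)" using y y2 by (intro mult_mono f mult_left_mono) (auto intro: add_increasing)
        finally show ?thesis by simp
      qed
      then have "y ^ nat \<bar>q\<bar> / fact (nat \<bar>q\<bar>) * exp (Y\<^sup>2) \<le> y ^ n / fact n * (1 + Y\<^sup>2) * exp (Y\<^sup>2)"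
        by (intro mult_right_mono) auto
      then show ?thesis using U[of q] by (simp add: mult.assoc)
    qed
    have "cmod (bessel_wave k (m - 1) w) + cmod (bessel_wave k (m + 1) w) \<le> 2 * (y ^ n / fact n * ((1 + Y\<^sup>2) * exp (Y\<^sup>2)))"
      using U2[of "m - 1"] U2[of "m + 1"] n by (cases "m > 0") (smt (verit) nat_eq_iff2 of_nat_Suc)+
    moreover have "cmod (bessel_wave_D k m w h) \<le> cmod k / 2 * ((cmod (bessel_wave k (m - 1) w) + cmod (bessel_wave k (m + 1) w)) * cmod h)"
      unfolding bessel_wave_D_def norm_mult[of "k / 2"]
      using norm_triangle_ineq4[of "bessel_wave k (m - 1) w * cnj h" "bessel_wave k (m + 1) w * h"]
      by (simp add: norm_mult norm_divide distrib_right mult_left_mono divide_right_mono)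
    ultimately have D: "cmod (bessel_wave_D k m w h) \<le> cmod k / 2 * (2 * (y ^ n / fact n * ((1 + Y\<^sup>2) * exp (Y\<^sup>2))) * cmod h)"
      by (smt (verit) divide_nonneg_nonneg mult_left_mono mult_right_mono norm_ge_zero)
    have "cmod (hankel_wave k m z * bessel_wave_D k m w h) \<le> B * (fact n / x ^ Suc n) * (cmod k / 2 * (2 * (y ^ n / fact n * ((1 + Y\<^sup>2) * exp (Y\<^sup>2))) * cmod h))"
      unfolding norm_mult[of "hankel_wave k m z"] using V D B x by (intro mult_mono) auto
    also have "\<dots> = B * exp (Y\<^sup>2) * (2 * ((1 + Y\<^sup>2) / cmod z)) * cmod h * (y / x) ^ n"
    proof -
      have e: "cmod k / 2 = x / cmod z" using z0 by (simp add: x_def)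
      show ?thesis unfolding e using x z0 by (simp add: power_divide field_simps)
    qed
    also have "\<dots> \<le> B * exp (Y\<^sup>2) * (2 * ((1 + Y\<^sup>2) / r0)) * cmod h * a ^ n"
      using zr r0 B x y z0 by (intro mult_mono yxn mult_left_mono mult_right_mono divide_left_mono mult_nonneg_nonneg) (auto intro!: divide_left_mono)
    also have "\<dots> \<le> C * cmod h * a ^ n" using C1 a by (intro mult_right_mono) auto
    finally have "cmod (hankel_wave k m z * bessel_wave_D k m w h) \<le> C * cmod h * a ^ n" .
    then show "cmod (hankel_wave k m z * bessel_wave_D k m w h) \<le> C * cmod h * a ^ (nat \<bar>m\<bar> - 1)" by (simp add: n)
  qed
qed

section \<open>The waves on the Euclidean plane\<close>

definition plane :: "real ^ 2 \<Rightarrow> complex" where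
  "plane x = Complex (x $ 1) (x $ 2)"

lemma bounded_linear_plane: "bounded_linear plane"
proof -
  have "plane = (\<lambda>x. of_real (x $ 1) + \<i> * of_real (x $ 2))"
    by (auto simp: plane_def complex_eq_iff)
  moreover have "bounded_linear (\<lambda>x :: real ^ 2. of_real (x $ 1) + \<i> * of_real (x $ 2))"
    by (intro bounded_linear_add bounded_linear_compose[OF bounded_linear_of_real bounded_linear_vec_nth]
         bounded_linear_compose[OF bounded_linear_mult_right bounded_linear_compose[OF bounded_linear_of_real bounded_linear_vec_nth]])
  ultimately show ?thesis by simp
qed

lemmas plane_diff = linear_diff[OF bounded_linear.linear[OF bounded_linear_plane]]
  and plane_neg = linear_neg[OF bounded_linear.linear[OF bounded_linear_plane]]

lemma norm_plane [simp]: "cmod (plane x) = norm x"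
  by (simp add: plane_def cmod_def norm_vec_def L2_set_def sum_2)

definition U_wave_D :: "int \<Rightarrow> complex \<Rightarrow> real ^ 2 \<Rightarrow> real ^ 2 \<Rightarrow> complex" where
  "U_wave_D m k y h = bessel_wave_D k m (plane y) (plane h)"

definition green_D :: "complex \<Rightarrow> real ^ 2 \<Rightarrow> real ^ 2 \<Rightarrow> complex" where
  "green_D k x h = \<i> / 4 * hankel_wave_D k 0 (plane x) (plane h)"

lemma polar_angle_plane: "polar_angle x = Arg (plane x)"
  by (simp add: polar_angle_def plane_def)

lemma exp_Arg_power: "z \<noteq> 0 \<Longrightarrow> exp (\<i> * of_int m * of_real (Arg z)) = (z / of_real (cmod z)) powi m"
proof -
  assume z: "z \<noteq> 0"
  have "exp (\<i> * of_int m * of_real (Arg z)) = exp (\<i> * of_real (Arg z)) powi m"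
    by (simp add: exp_power_int mult_ac)
  also have "exp (\<i> * of_real (Arg z)) = z / of_real (cmod z)"
    using cis_Arg[OF z] by (simp add: cis_conv_exp sgn_eq)
  finally show ?thesis .
qed

lemma V_wave_eq: "x \<noteq> 0 \<Longrightarrow> V_wave m k x = hankel_wave k m (plane x)"
  using exp_Arg_power[of "plane x" m] norm_plane[of x]
  by (simp add: V_wave_def hankel_wave_def polar_angle_plane del: norm_plane) (metis norm_eq_zero)

lemma green_eq: "green k x = \<i> / 4 * hankel_wave k 0 (plane x)"
  by (simp add: green_def hankel_wave_def)

text \<open>At the origin both sides are \<open>1\<close> for order \<open>0\<close> and \<open>0\<close> otherwise, so the identity holds without
exception and transports smoothness to \<open>U_wave\<close>.\<close>
lemma U_wave_eq: "U_wave m k y = bessel_wave k m (plane y)"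
proof -
  define w where "w = plane y"
  have nw: "norm y = cmod w" by (simp add: w_def)
  have t: "(k * of_real (cmod w) / 2)\<^sup>2 = (k / 2)\<^sup>2 * (w * cnj w)"
    using complex_norm_square[of w] by (simp add: power_divide power_mult_distrib)
  have w: "of_real (cmod w) * exp (\<i> * of_real (Arg w)) = w"
    using rcis_cmod_Arg[of w] by (simp add: rcis_def cis_conv_exp)
  have cw: "of_real (cmod w) * exp (- \<i> * of_real (Arg w)) = cnj w"
    using arg_cong[OF w, of cnj] by (simp add: exp_cnj)
  have J: "bessel_J_nat n (k * of_real (cmod w)) * e ^ n = (k / 2 * (of_real (cmod w) * e)) ^ n * bessel_phi n ((k / 2)\<^sup>2 * (w * cnj w))" for n e
    unfolding bessel_J_nat_eq t by (simp add: power_mult_distrib power_divide)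
  show ?thesis
  proof (cases "m \<ge> 0")
    case True
    have "exp (- \<i> * of_int m * of_real (Arg w)) = exp (- \<i> * of_real (Arg w)) ^ nat m"
      using True by (simp flip: exp_of_nat_mult add: mult_ac)
    then show ?thesis using J[of "nat m" "exp (- \<i> * of_real (Arg w))"] True unfolding cw
      by (simp add: U_wave_def bessel_J_def bessel_wave_def bessel_mono_def polar_angle_plane w_def mult.commute)
  next
    case False
    have "exp (- \<i> * of_int m * of_real (Arg w)) = exp (\<i> * of_real (Arg w)) ^ nat (- m)"
      using False by (simp flip: exp_of_nat_mult add: mult_ac)
    then show ?thesis using J[of "nat (- m)" "exp (\<i> * of_real (Arg w))"] False unfolding w
      by (simp add: U_wave_def bessel_J_def bessel_wave_def bessel_mono_def polar_angle_plane w_def mult_ac)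
  qed
qed

lemma U_wave_deriv: "(U_wave m k has_derivative U_wave_D m k y) (at y)"
proof -
  have "((\<lambda>y. bessel_wave k m (plane y)) has_derivative (\<lambda>h. bessel_wave_D k m (plane y) (plane h))) (at y)"
    by (rule has_derivative_compose[OF bounded_linear.has_derivative[OF bounded_linear_plane, OF has_derivative_ident] bessel_wave_deriv])
  then show ?thesis by (simp only: U_wave_eq[abs_def] U_wave_D_def[abs_def])
qed

lemma green_deriv:
  assumes "k \<notin> \<real>\<^sub>\<le>\<^sub>0" "x \<noteq> 0"
  shows "(green k has_derivative green_D k x) (at x)"
proof -
  have "plane x \<noteq> 0" using assms(2) by (metis norm_eq_zero norm_plane)
  from has_derivative_compose[OF bounded_linear.has_derivative[OF bounded_linear_plane, OF has_derivative_ident] hankel_wave_deriv[OF assms(1) this]]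
  have "((\<lambda>y. \<i> / 4 * hankel_wave k 0 (plane y)) has_derivative (\<lambda>h. \<i> / 4 * hankel_wave_D k 0 (plane x) (plane h))) (at x)"
    by (intro has_derivative_mult_right)
  then show ?thesis by (simp only: green_eq[abs_def] green_D_def[abs_def])
qed

text \<open>The error of the truncated expansion of the Green function and, in \<open>graf_error_D\<close>, its derivative in
\<open>y\<close> in the direction \<open>h\<close>.\<close>
definition graf_error :: "complex \<Rightarrow> nat \<Rightarrow> real ^ 2 \<Rightarrow> real ^ 2 \<Rightarrow> complex" where
  "graf_error k M x y = green k (x - y) - \<i> / 4 * (\<Sum>m=-int M..int M. V_wave m k x * U_wave m k y)"

definition graf_error_D :: "complex \<Rightarrow> nat \<Rightarrow> real ^ 2 \<Rightarrow> real ^ 2 \<Rightarrow> real ^ 2 \<Rightarrow> complex" where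
  "graf_error_D k M x y h = green_D k (x - y) (- h) - \<i> / 4 * (\<Sum>m=-int M..int M. V_wave m k x * U_wave_D m k y h)"

lemma wave_product_tendsto_0:
  assumes k: "k \<notin> \<real>\<^sub>\<le>\<^sub>0" and wz: "cmod w < cmod z"
    and n: "\<And>M. nat \<bar>n M\<bar> \<le> nat \<bar>q M\<bar> + 2" "\<And>M. nat \<bar>q M\<bar> \<le> nat \<bar>n M\<bar> + 2" "\<And>M. M \<le> nat \<bar>n M\<bar>"
      "\<And>M. M \<le> nat \<bar>q M\<bar>" "\<And>M. nat \<bar>q M\<bar> \<le> M + 2"
  shows "(\<lambda>M. hankel_wave k (n M) z * bessel_wave k (q M) w) \<longlonglongrightarrow> 0"
proof -
  define \<rho> x0 y1 where "\<rho> = cmod w / cmod z" and "x0 = cmod k * cmod z / 2" and "y1 = cmod k * cmod w / 2"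
  define B where "B = \<bar>hankel_const (k * of_real (cmod z))\<bar>"
  have k0: "k \<noteq> 0" using k by auto
  have z0: "cmod z > 0" using wz by (smt (verit) norm_ge_zero)
  have z: "z \<noteq> 0" using z0 by auto
  have x0: "0 < x0" using k0 z by (simp add: x0_def)
  have \<rho>: "0 \<le> \<rho>" "\<rho> < 1" "cmod w \<le> \<rho> * cmod z" using wz z0 by (auto simp: \<rho>_def divide_simps)
  have le: "cmod (hankel_wave k (n M) z * bessel_wave k (q M) w)
     \<le> B * exp (y1\<^sup>2) * (1 + y1)\<^sup>2 * (1 + 1 / x0)\<^sup>2 * ((real M + 4)\<^sup>2 * \<rho> ^ M)" for M
    by (rule norm_wave_product_le[OF k0 z _ x0 _ \<rho>(3,1) _ _ n]) (use \<rho> in \<open>auto simp: B_def x0_def y1_def\<close>)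
  have "(\<lambda>M. B * exp (y1\<^sup>2) * (1 + y1)\<^sup>2 * (1 + 1 / x0)\<^sup>2 * ((real M + 4)\<^sup>2 * \<rho> ^ M)) \<longlonglongrightarrow> 
     B * exp (y1\<^sup>2) * (1 + y1)\<^sup>2 * (1 + 1 / x0)\<^sup>2 * 0"
    by (intro tendsto_intros square_times_power_tendsto_0 \<rho>)
  then have lim: "(\<lambda>M. B * exp (y1\<^sup>2) * (1 + y1)\<^sup>2 * (1 + 1 / x0)\<^sup>2 * ((real M + 4)\<^sup>2 * \<rho> ^ M)) \<longlonglongrightarrow> 0"
    by (simp only: mult_zero_right)
  show ?thesis by (rule Lim_null_comparison[OF always_eventually lim]) (use le in blast)
qed

text \<open>Differentiating the Bessel waves gives the sums of \<open>V m * U (m \<minusplus> 1)\<close>. An index shift turns them, up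
to two terms at the ends that vanish in the limit, into the sums of \<open>V (m \<plusminus> 1) * U m\<close>, and these are
covered by \<open>graf_addition\<close> with \<open>l = \<plusminus> 1\<close>. Term by term differentiation of the limit is thus avoided.\<close>
lemma graf_addition_deriv:
  assumes k: "k \<notin> \<real>\<^sub>\<le>\<^sub>0" and wz: "cmod w < cmod z"
  shows "(\<lambda>M. \<Sum>m=-int M..int M. hankel_wave k m z * bessel_wave_D k m w h) \<longlonglongrightarrow> hankel_wave_D k 0 (z - w) (- h)"
proof -
  define V U where "V = (\<lambda>m. hankel_wave k m z)" and "U = (\<lambda>m. bessel_wave k m w)"
  have end0: "(\<lambda>M. V (int M) * U (int M + 1)) \<longlonglongrightarrow> 0" "(\<lambda>M. V (int M + 1) * U (int M)) \<longlonglongrightarrow> 0"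
    "(\<lambda>M. V (- int M) * U (- int M - 1)) \<longlonglongrightarrow> 0" "(\<lambda>M. V (- int M - 1) * U (- int M)) \<longlonglongrightarrow> 0"
    unfolding V_def U_def by (rule wave_product_tendsto_0[OF k wz]; linarith)+
  have "(\<lambda>M. (\<Sum>m=-int M..int M. V (m + 1) * U m) - (V (int M + 1) * U (int M) - V (- int M) * U (- int M - 1)))
      \<longlonglongrightarrow> hankel_wave k 1 (z - w) - (0 - 0)"
    using graf_addition[OF k wz, of 1] by (intro tendsto_diff end0) (simp_all add: V_def U_def)
  moreover have "(\<Sum>m=-int M..int M. V (m + 1) * U m) - (V (int M + 1) * U (int M) - V (- int M) * U (- int M - 1))
     = (\<Sum>m=-int M..int M. V m * U (m - 1))" for M
    using sum_telescope_int[of "\<lambda>m. V m * U (m - 1)" M] by (simp add: sum_subtractf algebra_simps)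
  ultimately have 1: "(\<lambda>M. \<Sum>m=-int M..int M. V m * U (m - 1)) \<longlonglongrightarrow> hankel_wave k 1 (z - w)" by simp
  have "(\<lambda>M. (\<Sum>m=-int M..int M. V (m - 1) * U m) + (V (int M) * U (int M + 1) - V (- int M - 1) * U (- int M)))
      \<longlonglongrightarrow> hankel_wave k (- 1) (z - w) + (0 - 0)"
    using graf_addition[OF k wz, of "- 1"] by (intro tendsto_add tendsto_diff end0) (simp_all add: V_def U_def)
  moreover have "(\<Sum>m=-int M..int M. V (m - 1) * U m) + (V (int M) * U (int M + 1) - V (- int M - 1) * U (- int M))
     = (\<Sum>m=-int M..int M. V m * U (m + 1))" for M
    using sum_telescope_int[of "\<lambda>m. V (m - 1) * U m" M] by (simp add: sum_subtractf algebra_simps)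
  ultimately have 2: "(\<lambda>M. \<Sum>m=-int M..int M. V m * U (m + 1)) \<longlonglongrightarrow> hankel_wave k (- 1) (z - w)" by simp
  have "(\<lambda>M. k / 2 * ((\<Sum>m=-int M..int M. V m * U (m - 1)) * cnj h - (\<Sum>m=-int M..int M. V m * U (m + 1)) * h))
     \<longlonglongrightarrow> k / 2 * (hankel_wave k 1 (z - w) * cnj h - hankel_wave k (- 1) (z - w) * h)"
    by (intro tendsto_intros 1 2)
  moreover have "k / 2 * ((\<Sum>m=-int M..int M. V m * U (m - 1)) * cnj h - (\<Sum>m=-int M..int M. V m * U (m + 1)) * h)
     = (\<Sum>m=-int M..int M. V m * bessel_wave_D k m w h)" for M
    unfolding sum_distrib_right sum_subtractf[symmetric] sum_distrib_left
    by (intro sum.cong) (auto simp: bessel_wave_D_def U_def algebra_simps)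
  moreover have "k / 2 * (hankel_wave k 1 (z - w) * cnj h - hankel_wave k (- 1) (z - w) * h) = hankel_wave_D k 0 (z - w) (- h)"
    by (simp add: hankel_wave_D_def algebra_simps)
  ultimately show ?thesis unfolding V_def by (simp only:)
qed

text \<open>The factor \<open>\<bar>\<i> / 4\<bar>\<close> absorbs the \<open>2\<close> of \<open>symmetric_tail_bound\<close>. The tail of the series itself gains the
extra power of \<open>a\<close> from \<open>graf_terms_bound\<close>, the tail of the derivatives does not.\<close>
lemma graf_error_bound:
  assumes K: "compact K" "K \<subseteq> - \<real>\<^sub>\<le>\<^sub>0" and r0: "0 < r0"
  shows "\<exists>C>0. \<forall>k\<in>K. \<forall>x y a. r0 \<le> norm x \<and> norm x \<le> r1 \<and> norm y \<le> a * norm x \<and> 0 \<le> a \<and> a < 1 \<longrightarrow>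
     (\<forall>M. cmod (graf_error k M x y) \<le> C * (a ^ (M + 1) / (1 - a))) \<and>
     (\<forall>M h. cmod (graf_error_D k M x y h) \<le> C * norm h * (a ^ M / (1 - a))) \<and>
     (\<forall>m. m \<noteq> 0 \<longrightarrow> cmod (V_wave m k x * U_wave m k y) \<le> C * a ^ (nat \<bar>m\<bar> - 1)) \<and>
     (\<forall>m h. m \<noteq> 0 \<longrightarrow> cmod (V_wave m k x * U_wave_D m k y h) \<le> C * norm h * a ^ (nat \<bar>m\<bar> - 1))"
proof -
  obtain C where C: "C > 0" and Cb: "\<And>k z w a h m. k \<in> K \<Longrightarrow> r0 \<le> cmod z \<Longrightarrow> cmod z \<le> r1 \<Longrightarrow> cmod w \<le> a * cmod z \<Longrightarrow> 0 \<le> a \<Longrightarrow> a < 1 \<Longrightarrow> m \<noteq> (0::int) \<Longrightarrow>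
     cmod (hankel_wave k m z * bessel_wave k m w) \<le> C * a * a ^ (nat \<bar>m\<bar> - 1) \<and>
     cmod (hankel_wave k m z * bessel_wave_D k m w h) \<le> C * cmod h * a ^ (nat \<bar>m\<bar> - 1)"
    using graf_terms_bound[OF K r0, of r1] by metis
  show ?thesis
  proof (intro exI[of _ C] conjI ballI allI impI C)
    fix k a and x y :: "real ^ 2" assume k: "k \<in> K" and "r0 \<le> norm x \<and> norm x \<le> r1 \<and> norm y \<le> a * norm x \<and> 0 \<le> a \<and> a < 1"
    then have x: "r0 \<le> norm x" "norm x \<le> r1" "norm y \<le> a * norm x" and a: "0 \<le> a" "a < 1" by auto
    have x0: "x \<noteq> 0" using x r0 by auto
    have k': "k \<notin> \<real>\<^sub>\<le>\<^sub>0" using k K by auto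
    have lt: "cmod (plane y) < cmod (plane x)"
    proof -
      have "a * norm x < 1 * norm x" using a x0 by (intro mult_strict_right_mono) auto
      then show ?thesis using x by simp
    qed
    note b = Cb[OF k, of "plane x" "plane y" a, unfolded norm_plane, OF x a]
    note e = V_wave_eq[OF x0] U_wave_eq U_wave_D_def
    have scale: "cmod (\<i> / 4 * w) \<le> B" if "cmod w \<le> 2 * B" "B \<ge> 0" for w B
      using that by (simp add: norm_mult norm_divide)
    {
      fix M
      have "graf_error k M x y = \<i> / 4 * (hankel_wave k 0 (plane x - plane y) - (\<Sum>m=-int M..int M. hankel_wave k m (plane x) * bessel_wave k m (plane y)))"
        by (simp add: graf_error_def green_eq e plane_diff algebra_simps)
      moreover have "cmod (hankel_wave k 0 (plane x - plane y) - (\<Sum>m=-int M..int M. hankel_wave k m (plane x) * bessel_wave k m (plane y)))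
          \<le> 2 * (C * a) * a ^ M / (1 - a)"
        using graf_addition[OF k' lt, of 0] b by (intro symmetric_tail_bound a) auto
      ultimately show "cmod (graf_error k M x y) \<le> C * (a ^ (M + 1) / (1 - a))"
        using C a by (simp only:) (rule scale, auto simp: mult_ac)
    }
    {
      fix M h
      have "graf_error_D k M x y h = \<i> / 4 * (hankel_wave_D k 0 (plane x - plane y) (- plane h) - (\<Sum>m=-int M..int M. hankel_wave k m (plane x) * bessel_wave_D k m (plane y) (plane h)))"
        by (simp add: graf_error_D_def green_D_def e plane_diff plane_neg algebra_simps)
      moreover have "cmod (hankel_wave_D k 0 (plane x - plane y) (- plane h) - (\<Sum>m=-int M..int M. hankel_wave k m (plane x) * bessel_wave_D k m (plane y) (plane h)))
          \<le> 2 * (C * norm h) * a ^ M / (1 - a)"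
        using graf_addition_deriv[OF k' lt, of "plane h"] b[of _ "plane h"] by (intro symmetric_tail_bound a) auto
      ultimately show "cmod (graf_error_D k M x y h) \<le> C * norm h * (a ^ M / (1 - a))"
        using C a by (simp only:) (rule scale, auto simp: mult_ac)
    }
    fix m :: int
    assume m: "m \<noteq> 0"
    have "C * a * a ^ (nat \<bar>m\<bar> - 1) \<le> C * 1 * a ^ (nat \<bar>m\<bar> - 1)"
      using a C by (intro mult_right_mono mult_left_mono) auto
    then show "cmod (V_wave m k x * U_wave m k y) \<le> C * a ^ (nat \<bar>m\<bar> - 1)"
      using b[OF m] unfolding e by (metis mult.right_neutral order_trans)
    show "cmod (V_wave m k x * U_wave_D m k y h) \<le> C * norm h * a ^ (nat \<bar>m\<bar> - 1)" for h
      using b[OF m, of "plane h"] unfolding e by simp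
  qed
qed

section \<open>Arc length\<close>

lemma space_arc_length [simp]: "space arc_length = UNIV"
  by (simp add: arc_length_def space_measure_of_conv)

lemma sets_arc_length [simp, measurable_cong]: "sets arc_length = sets borel"
  by (simp add: arc_length_def sets_measure_of_conv sets.sigma_sets_eq[of borel, simplified])

text \<open>A measure built by \<open>measure_of\<close> takes on every set either the prescribed value or \<open>0\<close>, so the Hausdorff outer
measure is an upper bound. Upper bounds are what integrability of bounded functions requires.\<close>
lemma emeasure_arc_length_le: "emeasure arc_length A \<le> hausdorff1_outer A"
  unfolding arc_length_def emeasure_measure_of_conv by simp

lemma hausdorff1_outer_le:
  assumes "\<And>\<delta>::real. \<delta> > 0 \<Longrightarrow> \<exists>C :: nat \<Rightarrow> 'a set. A \<subseteq> (\<Union>i. C i) \<and> (\<forall>i. bounded (C i) \<and> diameter (C i) \<le> \<delta>)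
     \<and> (\<Sum>i. ennreal (diameter (C i))) \<le> B"
  shows "hausdorff1_outer (A :: 'a :: metric_space set) \<le> B"
  unfolding hausdorff1_outer_def
proof (rule SUP_least)
  fix \<delta> :: real assume "\<delta> \<in> {0<..}"
  then obtain C :: "nat \<Rightarrow> 'a set" where "A \<subseteq> (\<Union>i. C i)" "\<forall>i. bounded (C i) \<and> diameter (C i) \<le> \<delta>"
     "(\<Sum>i. ennreal (diameter (C i))) \<le> B" using assms[of \<delta>] by auto
  then show "(INF C\<in>{C :: nat \<Rightarrow> 'a set. A \<subseteq> (\<Union>i. C i) \<and> (\<forall>i. bounded (C i) \<and> diameter (C i) \<le> \<delta>)}.
        \<Sum>i. ennreal (diameter (C i))) \<le> B"
    by (intro INF_lower2[of C]) auto
qed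

lemma arc_length_singleton: "emeasure arc_length {p} = 0"
proof -
  have "hausdorff1_outer {p} \<le> 0"
    by (intro hausdorff1_outer_le exI[of _ "\<lambda>_. {p}"]) auto
  then show ?thesis using emeasure_arc_length_le[of "{p}"] by simp
qed

lemma finite_null_arc_length: "finite A \<Longrightarrow> A \<in> null_sets arc_length"
proof (induction A rule: finite_induct)
  case (insert p A)
  have "{p} \<in> null_sets arc_length" by (simp add: null_sets_def arc_length_singleton)
  then have "{p} \<union> A \<in> null_sets arc_length" using insert by (intro null_sets.Un)
  then show ?case by simp
qed simp

text \<open>Cut the interval into \<open>n\<close> equal pieces; the images have diameter at most \<open>L * l / n\<close>, which is below the
prescribed scale for large \<open>n\<close>, and the diameters add up to at most \<open>L * l\<close>.\<close>
lemma hausdorff1_outer_lipschitz_image: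
  fixes f :: "real \<Rightarrow> 'a :: real_normed_vector"
  assumes lip: "L-lipschitz_on UNIV f" and sub: "A \<subseteq> f ` {a..a + l}" and l: "l \<ge> 0"
  shows "hausdorff1_outer A \<le> ennreal (L * l)"
proof (rule hausdorff1_outer_le)
  fix \<delta> :: real assume \<delta>: "\<delta> > 0"
  have L: "L \<ge> 0" using lip by (rule lipschitz_on_nonneg)
  obtain n where "max 1 (L * l / \<delta>) < real n" using reals_Archimedean2 by blast
  then have n: "L * l / \<delta> < real n" "n > 0" by (simp, linarith)
  define h where "h = l / real n"
  have h: "h \<ge> 0" "real n * h = l" "L * h \<le> \<delta>" using n l \<delta> by (auto simp: h_def field_simps)
  define C where "C i = (if i < n then f ` {a + real i * h..a + real (Suc i) * h} else {})" for i
  have bd: "bounded (C i)" for i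
  proof -
    have "continuous_on UNIV f" using lip lipschitz_on_continuous_on by blast
    then have "compact (f ` {a + real i * h..a + real (Suc i) * h})"
      by (intro compact_continuous_image) (auto intro: continuous_on_subset)
    then show ?thesis by (simp add: C_def compact_imp_bounded)
  qed
  have di: "diameter (C i) \<le> L * h" for i
  proof (rule diameter_le)
    show "C i \<noteq> {} \<or> 0 \<le> L * h" using L h by simp
    fix x y assume "x \<in> C i" "y \<in> C i"
    then obtain s t where st: "s \<in> {a + real i * h..a + real (Suc i) * h}" "t \<in> {a + real i * h..a + real (Suc i) * h}" "x = f s" "y = f t"
      by (auto simp: C_def split: if_splits)
    then have "\<bar>s - t\<bar> \<le> h" by (auto simp: algebra_simps)
    then have "L * dist s t \<le> L * h" using L by (intro mult_left_mono) (auto simp: dist_real_def)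
    then show "norm (x - y) \<le> L * h" using lipschitz_onD[OF lip, of s t] st by (simp add: dist_norm)
  qed
  have cover: "A \<subseteq> (\<Union>i. C i)"
  proof
    fix x assume "x \<in> A"
    then obtain s where "s \<in> {a..a + l}" "x = f s" using sub by blast
    then have s: "a \<le> s" "s \<le> a + l" "x = f s" by auto
    show "x \<in> (\<Union>i. C i)"
    proof (cases "s < a + l")
      case True
      then have hp: "h > 0" using s l n by (auto simp: h_def)
      define i where "i = nat \<lfloor>(s - a) / h\<rfloor>"
      have i: "real i \<le> (s - a) / h" "(s - a) / h < real i + 1"
        using s hp unfolding i_def by (auto simp: floor_correct)
      have "(s - a) / h < real n" using True hp h(2) by (simp add: field_simps)
      then have "i < n" using i by linarith
      moreover have "s \<in> {a + real i * h..a + real (Suc i) * h}" using i hp by (simp add: field_simps)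
      ultimately show ?thesis using s unfolding C_def by (intro UN_I[of i]) auto
    next
      case False
      then have "s = a + l" using s by simp
      moreover have "a + real (Suc (n - 1)) * h = a + l" using n h by simp
      moreover have "real (n - 1) * h \<le> real n * h" using h by (intro mult_right_mono) auto
      ultimately show ?thesis using s n h(2) unfolding C_def by (intro UN_I[of "n - 1"]) auto
    qed
  qed
  have "(\<Sum>i. ennreal (diameter (C i))) = (\<Sum>i<n. ennreal (diameter (C i)))"
    by (intro suminf_finite) (auto simp: C_def diameter_empty)
  also have "\<dots> \<le> (\<Sum>i<n. ennreal (L * h))" using di by (intro sum_mono ennreal_leI)
  also have "\<dots> = ennreal (L * l)" using L h by (simp add: ennreal_of_nat_eq_real_of_nat flip: ennreal_mult h(2))
  finally have "(\<Sum>i. ennreal (diameter (C i))) \<le> ennreal (L * l)" .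
  then show "\<exists>C :: nat \<Rightarrow> 'a set. A \<subseteq> (\<Union>i. C i) \<and> (\<forall>i. bounded (C i) \<and> diameter (C i) \<le> \<delta>)
     \<and> (\<Sum>i. ennreal (diameter (C i))) \<le> ennreal (L * l)"
    using cover bd di h by (intro exI[of _ C]) (auto intro: order_trans)
qed

lemma orthonormal_expansion_plane:
  fixes e1 e2 z :: "real ^ 2"
  assumes "norm e1 = 1" "norm e2 = 1" "e1 \<bullet> e2 = 0"
  shows "z = (z \<bullet> e1) *\<^sub>R e1 + (z \<bullet> e2) *\<^sub>R e2"
proof -
  define a b c d where "a = e1 $ 1" and "b = e1 $ 2" and "c = e2 $ 1" and "d = e2 $ 2"
  have ab: "a * a + b * b = 1" using assms(1) by (simp add: norm_eq_1 inner_vec_def sum_2 a_def b_def)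
  have cd: "c * c + d * d = 1" using assms(2) by (simp add: norm_eq_1 inner_vec_def sum_2 c_def d_def)
  have o: "a * c + b * d = 0" using assms(3) by (simp add: inner_vec_def sum_2 a_def b_def c_def d_def)
  have 1: "a * a + c * c = 1" "b * b + d * d = 1" "a * b + c * d = 0" using ab cd o by algebra+
  have "(z $ 1 * a + z $ 2 * b) * a + (z $ 1 * c + z $ 2 * d) * c = z $ 1 * (a * a + c * c) + z $ 2 * (a * b + c * d)"
    "(z $ 1 * a + z $ 2 * b) * b + (z $ 1 * c + z $ 2 * d) * d = z $ 2 * (b * b + d * d) + z $ 1 * (a * b + c * d)"
    by (simp_all add: algebra_simps)
  then show ?thesis unfolding 1
    by (simp add: vec_eq_iff forall_2 inner_vec_def sum_2 a_def b_def c_def d_def)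
qed

text \<open>Near a boundary point the boundary lies on the graph of \<open>h\<close>: both open sides of the graph are disjoint
from it, one being contained in \<open>S\<close> and the other in the complement. The graph map
\<open>s \<mapsto> s e1 + h(s) e2\<close> has Lipschitz constant \<open>1 + L\<close>.\<close>
lemma lipschitz_boundary_local_length:
  assumes "lipschitz_boundary S" "p \<in> frontier S"
  shows "\<exists>r>0. emeasure arc_length (frontier S \<inter> ball p r) < \<infinity>"
proof -
  obtain e1 e2 :: "real ^ 2" and h L r where e: "norm e1 = 1" "norm e2 = 1" "e1 \<bullet> e2 = 0"
    and lip: "L-lipschitz_on UNIV h" and r: "r > 0"
    and sub: "\<And>z. z \<in> ball p r \<Longrightarrow> z \<in> S \<longleftrightarrow> z \<bullet> e2 < h (z \<bullet> e1)"
    using assms(1)[unfolded lipschitz_boundary_def, rule_format, OF assms(2)] by (elim exE conjE) (rule that, auto)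
  have ch: "continuous_on UNIV h" using lip lipschitz_on_continuous_on by blast
  have cont: "continuous_on UNIV (\<lambda>z. h (z \<bullet> e1))"
    by (intro continuous_on_compose2[OF ch] continuous_intros) auto
  have graph: "z \<bullet> e2 = h (z \<bullet> e1)" if z: "z \<in> frontier S" "z \<in> ball p r" for z
  proof (rule ccontr)
    assume ne: "z \<bullet> e2 \<noteq> h (z \<bullet> e1)"
    have op: "open (ball p r \<inter> {z. z \<bullet> e2 < h (z \<bullet> e1)})" "open (ball p r \<inter> {z. h (z \<bullet> e1) < z \<bullet> e2})"
      by (intro open_Int open_ball open_Collect_less cont continuous_intros)+
    show False
    proof (cases "z \<bullet> e2 < h (z \<bullet> e1)")
      case True
      have "ball p r \<inter> {z. z \<bullet> e2 < h (z \<bullet> e1)} \<subseteq> S" using sub by auto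
      then have "z \<in> interior S" using True z by (intro interiorI[OF op(1)]) auto
      then show False using z by (simp add: frontier_def)
    next
      case False
      have "(ball p r \<inter> {z. h (z \<bullet> e1) < z \<bullet> e2}) \<inter> S = {}" using sub by fastforce
      then have "(ball p r \<inter> {z. h (z \<bullet> e1) < z \<bullet> e2}) \<inter> closure S = {}"
        using op(2) by (simp add: open_Int_closure_eq_empty)
      then show False using False ne z by (auto simp: frontier_def)
    qed
  qed
  define f where "f s = s *\<^sub>R e1 + h s *\<^sub>R e2" for s
  have "(1 + L)-lipschitz_on UNIV f"
  proof (rule lipschitz_onI)
    show "0 \<le> 1 + L" using lipschitz_on_nonneg[OF lip] by simp
    fix s t :: real
    have "dist (f s) (f t) = norm ((s - t) *\<^sub>R e1 + (h s - h t) *\<^sub>R e2)" by (simp add: f_def dist_norm algebra_simps)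
    also have "\<dots> \<le> \<bar>s - t\<bar> + \<bar>h s - h t\<bar>" using norm_triangle_ineq[of "(s - t) *\<^sub>R e1" "(h s - h t) *\<^sub>R e2"] e by simp
    also have "\<dots> \<le> (1 + L) * dist s t" using lipschitz_onD[OF lip, of s t] by (simp add: dist_real_def algebra_simps)
    finally show "dist (f s) (f t) \<le> (1 + L) * dist s t" .
  qed
  moreover have "frontier S \<inter> ball p r \<subseteq> f ` {p \<bullet> e1 - r..(p \<bullet> e1 - r) + 2 * r}"
  proof
    fix z assume z: "z \<in> frontier S \<inter> ball p r"
    have "z = f (z \<bullet> e1)" using orthonormal_expansion_plane[OF e, of z] graph[of z] z by (simp add: f_def)
    moreover have "\<bar>z \<bullet> e1 - p \<bullet> e1\<bar> \<le> r"
      using Cauchy_Schwarz_ineq2[of "z - p" e1] z e by (simp add: inner_diff_left dist_norm norm_minus_commute)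
    ultimately show "z \<in> f ` {p \<bullet> e1 - r..(p \<bullet> e1 - r) + 2 * r}" by (intro image_eqI[of _ _ "z \<bullet> e1"]) (auto simp: abs_le_iff)
  qed
  ultimately have "hausdorff1_outer (frontier S \<inter> ball p r) \<le> ennreal ((1 + L) * (2 * r))"
    using r by (intro hausdorff1_outer_lipschitz_image[where a = "p \<bullet> e1 - r"])  simp_all
  then have "emeasure arc_length (frontier S \<inter> ball p r) < \<infinity>"
    using emeasure_arc_length_le by (metis ennreal_less_top infinity_ennreal_def order_le_less_trans)
  then show ?thesis using r by blast
qed

lemma lipschitz_boundary_finite_length:
  assumes "lipschitz_boundary S" "bounded S"
  shows "emeasure arc_length (frontier S) < \<infinity>"
proof -
  obtain r where r: "\<And>p. p \<in> frontier S \<Longrightarrow> r p > 0 \<and> emeasure arc_length (frontier S \<inter> ball p (r p)) < \<infinity>"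
    using lipschitz_boundary_local_length[OF assms(1)] by metis
  have "compact (frontier S)" using assms(2) by (rule compact_frontier_bounded)
  moreover have "frontier S \<subseteq> (\<Union>p\<in>frontier S. ball p (r p))" using r by force
  ultimately obtain F where F: "F \<subseteq> frontier S" "finite F" "frontier S \<subseteq> (\<Union>p\<in>F. ball p (r p))"
    by (elim compactE_image[of "frontier S" "frontier S" "\<lambda>p. ball p (r p)"]) auto
  have "frontier S = (\<Union>p\<in>F. frontier S \<inter> ball p (r p))" using F by blast
  then have "emeasure arc_length (frontier S) \<le> (\<Sum>p\<in>F. emeasure arc_length (frontier S \<inter> ball p (r p)))"
    using emeasure_subadditive_finite[of F "\<lambda>p. frontier S \<inter> ball p (r p)" arc_length] F(2)
    by (metis (no_types, lifting) borel_closed borel_open frontier_closed image_subsetI open_ball sets.Int sets_arc_length)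
  also have "\<dots> < \<infinity>" using F r by (simp add: subset_iff)
  finally show ?thesis .
qed

section \<open>The outward normal and normal derivatives\<close>

text \<open>If \<open>n\<close> and \<open>n'\<close> differ, the direction \<open>n' - n\<close> makes an obtuse angle with \<open>n\<close> and an acute angle with
\<open>n'\<close>. Points of the boundary shifted slightly in this direction would lie both inside and outside.\<close>
lemma outward_normal_unique:
  assumes "is_outward_normal S y n" "is_outward_normal S y n'"
  shows "n = n'"
proof (rule ccontr)
  assume ne: "n \<noteq> n'"
  have n: "norm n = 1" "norm n' = 1" using assms by (auto simp: is_outward_normal_def)
  define d where "d = n' - n"
  \<comment> \<open>Half of the cosine of the angle between \<open>d\<close> and \<open>n'\<close>, so that \<open>d\<close> lies strictly inside both cones.\<close>
  define e where "e = (1 - n \<bullet> n') / (2 * norm d)"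
  have d0: "norm d > 0" using ne by (simp add: d_def)
  have "(norm d)\<^sup>2 = 2 - 2 * (n \<bullet> n')"
    unfolding power2_norm_eq_inner d_def using n by (simp add: inner_diff inner_commute norm_eq_1)
  then have lt: "1 - n \<bullet> n' > 0" using d0 by (smt (verit) zero_less_power)
  then have e: "e > 0" using d0 by (simp add: e_def)
  have dn: "d \<bullet> n = - (1 - n \<bullet> n')" "d \<bullet> n' = 1 - n \<bullet> n'"
    using n by (simp_all add: d_def inner_diff inner_commute norm_eq_1)
  obtain d1 where d1: "d1 > 0" "\<And>z. z \<in> ball y d1 \<Longrightarrow> (z - y) \<bullet> n < - e * norm (z - y) \<Longrightarrow> z \<in> S"
    using assms(1) e unfolding is_outward_normal_def by blast
  obtain d2 where d2: "d2 > 0" "\<And>z. z \<in> ball y d2 \<Longrightarrow> (z - y) \<bullet> n' > e * norm (z - y) \<Longrightarrow> z \<notin> S"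
    using assms(2) e unfolding is_outward_normal_def by blast
  define s where "s = min d1 d2 / (2 * norm d)"
  have s: "s > 0" "s * norm d < d1" "s * norm d < d2" using d0 d1(1) d2(1) by (auto simp: s_def min_def field_simps)
  have en: "e * norm d < 1 - n \<bullet> n'" using d0 lt by (simp add: e_def)
  let ?z = "y + s *\<^sub>R d"
  have sm: "e * (s * norm d) < s * (1 - n \<bullet> n')" using mult_strict_left_mono[OF en s(1)] by (simp add: mult_ac)
  have a: "(s *\<^sub>R d) \<bullet> n = - (s * (1 - n \<bullet> n'))" "(s *\<^sub>R d) \<bullet> n' = s * (1 - n \<bullet> n')"
    unfolding inner_scaleR_left dn by (simp_all add: algebra_simps)
  have "?z \<in> S" using s sm a(1) by (intro d1(2)) (auto simp: dist_norm simp del: inner_scaleR_left)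
  moreover have "?z \<notin> S" using s sm a(2) by (intro d2(2)) (auto simp: dist_norm simp del: inner_scaleR_left)
  ultimately show False by blast
qed

lemma outward_normal_eqI: "is_outward_normal S y n \<Longrightarrow> outward_normal S y = n"
  unfolding outward_normal_def using outward_normal_unique by (metis the_equality)

lemma norm_outward_normal_le: "norm (outward_normal S y) \<le> 1"
proof (cases "\<exists>n. is_outward_normal S y n")
  case True
  then obtain n where "is_outward_normal S y n" by blast
  then show ?thesis using outward_normal_eqI[of S y n] by (simp add: is_outward_normal_def)
qed (simp add: outward_normal_def)

text \<open>Compactness of the unit circle moves the choice of the normal inside the quantifiers over the
approximation scales, so that only projections of closed sets along a compact factor remain.\<close>
lemma borel_normal_in_closed:
  fixes S F :: "(real ^ 2) set"
  assumes F: "closed F"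
  shows "{y. \<exists>n\<in>F. is_outward_normal S y n} \<in> sets borel"
proof -
  define G where "G = F \<inter> sphere 0 1"
  have G: "compact G" unfolding G_def using F by (simp add: closed_Int_compact)
  define Q where "Q e d y n \<longleftrightarrow> (\<forall>z. d \<le> dist y z \<or>
        ((- e * norm (z - y) \<le> (z - y) \<bullet> n \<or> z \<in> S) \<and> ((z - y) \<bullet> n \<le> e * norm (z - y) \<or> z \<notin> S)))" for e d :: real and y n
  define P where "P e d = {y. \<exists>n. n \<in> G \<and> Q e d y n}" for e d
  \<comment> \<open>\<open>Q\<close> is a conjunction over \<open>z\<close> of closed conditions on \<open>(n, y)\<close>; that \<open>z\<close> belongs to \<open>S\<close> is a constant.\<close>
  have clQ: "closed {(n, y). Q e d y n}" for e d
  proof -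
    have c: "closed {p :: (real ^ 2) \<times> (real ^ 2). z \<in> S}" "closed {p :: (real ^ 2) \<times> (real ^ 2). z \<notin> S}" for z
      by (cases "z \<in> S"; simp)+
    have "closed {p :: (real ^ 2) \<times> (real ^ 2). d \<le> dist (snd p) z}"
      "closed {p :: (real ^ 2) \<times> (real ^ 2). - e * norm (z - snd p) \<le> (z - snd p) \<bullet> fst p}"
      "closed {p :: (real ^ 2) \<times> (real ^ 2). (z - snd p) \<bullet> fst p \<le> e * norm (z - snd p)}"
      for z by (rule closed_Collect_le; intro continuous_intros)+
    with c have "closed (\<Inter>z. {p :: (real ^ 2) \<times> (real ^ 2). d \<le> dist (snd p) z} \<union>
       (({p. - e * norm (z - snd p) \<le> (z - snd p) \<bullet> fst p} \<union> {p. z \<in> S}) \<inter>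
        ({p. (z - snd p) \<bullet> fst p \<le> e * norm (z - snd p)} \<union> {p. z \<notin> S})))"
      by (intro closed_INT closed_Un closed_Int ballI)
    moreover have "(\<Inter>z. {p :: (real ^ 2) \<times> (real ^ 2). d \<le> dist (snd p) z} \<union>
       (({p. - e * norm (z - snd p) \<le> (z - snd p) \<bullet> fst p} \<union> {p. z \<in> S}) \<inter>
        ({p. (z - snd p) \<bullet> fst p \<le> e * norm (z - snd p)} \<union> {p. z \<notin> S}))) = {(n, y). Q e d y n}"
      unfolding Q_def by (intro set_eqI) (simp add: case_prod_beta, blast)
    ultimately show ?thesis by (simp only:)
  qed
  have "closed {y. \<exists>n. n \<in> G \<and> (n, y) \<in> {(n, y). Q e d y n}}" for e d
    by (rule closed_compact_projection[OF G clQ])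
  then have clP: "closed (P e d)" for e d by (simp add: P_def)
  have mono: "Q e' d' y n" if "Q e d y n" "e \<le> e'" "d' \<le> d" for e d e' d' y n
    unfolding Q_def
  proof (intro allI)
    fix z
    have ee: "e * norm (z - y) \<le> e' * norm (z - y)" using that by (intro mult_right_mono) auto
    have 1: "(z - y) \<bullet> n < - e * norm (z - y)" if "(z - y) \<bullet> n < - e' * norm (z - y)" using that ee by linarith
    have 2: "(z - y) \<bullet> n > e * norm (z - y)" if "(z - y) \<bullet> n > e' * norm (z - y)" using that ee by linarith
    have 3: "dist y z < d" if "dist y z < d'" using that \<open>d' \<le> d\<close> by linarith
    show "d' \<le> dist y z \<or> ((- e' * norm (z - y) \<le> (z - y) \<bullet> n \<or> z \<in> S) \<and> ((z - y) \<bullet> n \<le> e' * norm (z - y) \<or> z \<notin> S))"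
      using \<open>Q e d y n\<close>[unfolded Q_def not_less[symmetric], rule_format, of z] 1 2 3
      unfolding not_less[symmetric] by blast
  qed
  have iff: "is_outward_normal S y n \<longleftrightarrow> y \<in> frontier S \<and> norm n = 1 \<and> (\<forall>e>0. \<exists>d>0. Q e d y n)" for y n
    unfolding is_outward_normal_def Q_def Ball_def mem_ball not_less[symmetric] by blast
  have "{y. \<exists>n\<in>F. is_outward_normal S y n} = frontier S \<inter> (\<Inter>m. \<Union>i. P (1 / real (Suc m)) (1 / real (Suc i)))"
  proof (intro set_eqI iffI)
    fix y assume "y \<in> {y. \<exists>n\<in>F. is_outward_normal S y n}"
    then obtain n where n: "n \<in> F" "y \<in> frontier S" "norm n = 1" "\<forall>e>0. \<exists>d>0. Q e d y n" unfolding iff by blast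
    have "\<exists>i. y \<in> P (1 / real (Suc m)) (1 / real (Suc i))" for m
    proof -
      have "1 / real (Suc m) > 0" by simp
      then obtain d where d: "d > 0" "Q (1 / real (Suc m)) d y n" using n(4) by blast
      obtain i where "1 / real (Suc i) < d" using nat_approx_posE[OF d(1)] by metis
      then have "Q (1 / real (Suc m)) (1 / real (Suc i)) y n" by (intro mono[OF d(2)]) auto
      then show ?thesis using n unfolding P_def G_def by (intro exI[of _ i]) auto
    qed
    then show "y \<in> frontier S \<inter> (\<Inter>m. \<Union>i. P (1 / real (Suc m)) (1 / real (Suc i)))" using n by auto
  next
    fix y assume y: "y \<in> frontier S \<inter> (\<Inter>m. \<Union>i. P (1 / real (Suc m)) (1 / real (Suc i)))"
    then have "\<forall>m. \<exists>i n. n \<in> G \<and> Q (1 / real (Suc m)) (1 / real (Suc i)) y n" unfolding P_def by auto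
    then obtain i N where N: "\<And>m. N m \<in> G" "\<And>m. Q (1 / real (Suc m)) (1 / real (Suc (i m))) y (N m)" by metis
    \<comment> \<open>The directions that work at the scales \<open>1 / Suc m\<close> accumulate at one that works at all scales.\<close>
    obtain n \<sigma> where n: "n \<in> G" "strict_mono (\<sigma> :: nat \<Rightarrow> nat)" "(N \<circ> \<sigma>) \<longlonglongrightarrow> n"
      using G N(1) unfolding compact_def by metis
    have "\<exists>d>0. Q e d y n" if e: "e > 0" for e
    proof -
      have "\<forall>\<^sub>F m in sequentially. dist (N (\<sigma> m)) n < e / 2"
        using tendstoD[OF n(3), of "e / 2"] e by (simp add: o_def)
      moreover have "\<forall>\<^sub>F m in sequentially. 1 / real (Suc m) < e / 2"
        using order_tendstoD(2)[OF LIMSEQ_inverse_real_of_nat, of "e / 2"] e by (simp add: inverse_eq_divide)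
      ultimately have "\<forall>\<^sub>F m in sequentially. dist (N (\<sigma> m)) n < e / 2 \<and> 1 / real (Suc m) < e / 2"
        by (rule eventually_conj)
      then obtain m where m: "dist (N (\<sigma> m)) n < e / 2" "1 / real (Suc m) < e / 2"
        using eventually_happens' sequentially_bot by blast
      define e' where "e' = 1 / real (Suc (\<sigma> m))"
      have e': "e' \<le> e / 2"
      proof -
        have "m \<le> \<sigma> m" using n(2) by (rule seq_suble)
        then have "e' \<le> 1 / real (Suc m)" by (simp add: e'_def frac_le)
        then show ?thesis using m by simp
      qed
      have q: "Q e' (1 / real (Suc (i (\<sigma> m)))) y (N (\<sigma> m))" using N(2) by (simp add: e'_def)
      have diff: "\<bar>(z - y) \<bullet> N (\<sigma> m) - (z - y) \<bullet> n\<bar> \<le> e / 2 * norm (z - y)" for z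
      proof -
        have "\<bar>(z - y) \<bullet> (N (\<sigma> m) - n)\<bar> \<le> norm (z - y) * norm (N (\<sigma> m) - n)" by (rule Cauchy_Schwarz_ineq2)
        also have "\<dots> \<le> norm (z - y) * (e / 2)" using m(1) by (intro mult_left_mono) (auto simp: dist_norm)
        finally show ?thesis by (simp add: inner_diff_right mult.commute)
      qed
      have ee: "e' * norm (z - y) \<le> e / 2 * norm (z - y)" for z using e' by (intro mult_right_mono) auto
      have "Q e (1 / real (Suc (i (\<sigma> m)))) y n"
        unfolding Q_def
      proof (intro allI)
        fix z
        have *: "e * norm (z - y) = e / 2 * norm (z - y) + e / 2 * norm (z - y)" by (simp add: algebra_simps)
        have 1: "(z - y) \<bullet> N (\<sigma> m) < - e' * norm (z - y)" if "(z - y) \<bullet> n < - e * norm (z - y)"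
          using that diff[of z] ee[of z] * by linarith
        have 2: "(z - y) \<bullet> N (\<sigma> m) > e' * norm (z - y)" if "(z - y) \<bullet> n > e * norm (z - y)"
          using that diff[of z] ee[of z] * by linarith
        show "1 / real (Suc (i (\<sigma> m))) \<le> dist y z \<or>
          ((- e * norm (z - y) \<le> (z - y) \<bullet> n \<or> z \<in> S) \<and> ((z - y) \<bullet> n \<le> e * norm (z - y) \<or> z \<notin> S))"
          using q[unfolded Q_def not_less[symmetric], rule_format, of z] 1 2
          unfolding not_less[symmetric] by blast
      qed
      then show ?thesis by (intro exI[of _ "1 / real (Suc (i (\<sigma> m)))"]) auto
    qed
    then show "y \<in> {y. \<exists>n\<in>F. is_outward_normal S y n}"
      using y n(1) unfolding iff G_def by auto
  qed
  moreover have "frontier S \<inter> (\<Inter>m. \<Union>i. P (1 / real (Suc m)) (1 / real (Suc i))) \<in> sets borel"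
    by (intro sets.Int sets.countable_INT'' sets.countable_UN' borel_closed frontier_closed clP) (auto intro: borel_closed clP)
  ultimately show ?thesis by simp
qed

text \<open>By uniqueness the preimage of a closed set is the set of points with a normal in it, joined by the
points without a normal if the set contains the default value \<open>0\<close>.\<close>
lemma borel_measurable_outward_normal [measurable]: "outward_normal S \<in> borel_measurable borel"
proof (rule borel_measurableI)
  fix U :: "(real ^ 2) set" assume U: "open U"
  define E where "E F = {y. \<exists>n\<in>F. is_outward_normal S y n}" for F
  have E: "E F \<in> sets borel" if "closed F" for F unfolding E_def by (rule borel_normal_in_closed[OF that])
  have "outward_normal S -` U = - (E (- U) \<union> (if 0 \<in> - U then - E UNIV else {}))"
  proof (intro set_eqI)
    fix y
    show "y \<in> outward_normal S -` U \<longleftrightarrow> y \<in> - (E (- U) \<union> (if 0 \<in> - U then - E UNIV else {}))"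
    proof (cases "\<exists>n. is_outward_normal S y n")
      case True
      then obtain n where n: "is_outward_normal S y n" by blast
      then have iff: "is_outward_normal S y m \<longleftrightarrow> m = n" for m using outward_normal_unique[OF n] by blast
      then show ?thesis using outward_normal_eqI[OF n] by (simp add: E_def)
    next
      case False
      then have "\<not> is_outward_normal S y m" "outward_normal S y = 0" for m by (auto simp: outward_normal_def)
      then show ?thesis by (simp add: E_def)
    qed
  qed
  moreover have "- (E (- U) \<union> (if 0 \<in> - U then - E UNIV else {})) \<in> sets borel"
    using E[of "- U"] E[of UNIV] U by (auto simp: Compl_eq_Diff_UNIV[symmetric] borel_comp closed_Compl)
  ultimately show "outward_normal S -` U \<inter> space borel \<in> sets borel" by simp
qed

lemma normal_deriv_eq:
  assumes "(f has_derivative f') (at y)"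
  shows "normal_deriv S f y = f' (outward_normal S y)"
proof -
  let ?n = "outward_normal S y"
  have "((\<lambda>t. y + t *\<^sub>R ?n) has_derivative (\<lambda>t. t *\<^sub>R ?n)) (at 0)"
    by (auto intro!: derivative_eq_intros)
  moreover have "(f has_derivative f') (at (y + 0 *\<^sub>R ?n))" using assms by simp
  ultimately have "((\<lambda>t. f (y + t *\<^sub>R ?n)) has_derivative (\<lambda>t. f' (t *\<^sub>R ?n))) (at 0)"
    by (rule has_derivative_compose)
  then have "((\<lambda>t. f (y + t *\<^sub>R ?n)) has_vector_derivative f' ?n) (at 0)"
    using has_derivative_linear[OF assms] by (simp add: has_vector_derivative_def linear_scale)
  then show ?thesis unfolding normal_deriv_def by (rule vector_derivative_at)
qed

section \<open>Smooth radial functions with compact support\<close>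

text \<open>The classical flat function \<open>exp (- 1 / t)\<close> times powers of \<open>1 / t\<close>: a family that is closed under
differentiation up to linear combinations.\<close>
definition flat_exp :: "nat \<Rightarrow> real \<Rightarrow> real" where
  "flat_exp n t = (if t > 0 then (1 / t) ^ n * exp (- (1 / t)) else 0)"

lemma flat_exp_at_right: "(flat_exp n \<longlongrightarrow> 0) (at_right 0)"
proof -
  have "((\<lambda>t::real. inverse t ^ n / exp (inverse t)) \<longlongrightarrow> 0) (at_right 0)"
    by (rule filterlim_compose[OF tendsto_power_div_exp_0 filterlim_inverse_at_top_right])
  moreover have "\<forall>\<^sub>F t in at_right 0. inverse t ^ n / exp (inverse t) = flat_exp n t"
    unfolding eventually_at_right_field by (intro exI[of _ 1]) (auto simp: flat_exp_def exp_minus divide_inverse)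
  ultimately show ?thesis by (rule Lim_transform_eventually)
qed

lemma flat_exp_deriv: "(flat_exp n has_real_derivative flat_exp (n + 2) t - real n * flat_exp (n + 1) t) (at t)"
proof (cases t "0 :: real" rule: linorder_cases)
  case less
  have "((\<lambda>t. 0) has_real_derivative 0) (at t)" by simp
  then have "(flat_exp n has_real_derivative 0) (at t)"
    by (rule has_field_derivative_transform_within[where d = "- t"]) (use less in \<open>auto simp: flat_exp_def dist_real_def\<close>)
  then show ?thesis using less by (simp add: flat_exp_def)
next
  case equal
  have "((\<lambda>h. (flat_exp n (0 + h) - flat_exp n 0) / h) \<longlongrightarrow> 0) (at 0)"
  proof (rule filterlim_split_at)
    have "\<forall>\<^sub>F h in at_left 0. 0 = (flat_exp n (0 + h) - flat_exp n 0) / h"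
      unfolding eventually_at_left_field by (intro exI[of _ "-1"]) (auto simp: flat_exp_def)
    then show "((\<lambda>h. (flat_exp n (0 + h) - flat_exp n 0) / h) \<longlongrightarrow> 0) (at_left 0)"
      by (rule Lim_transform_eventually[OF tendsto_const])
    have "\<forall>\<^sub>F h in at_right 0. flat_exp (Suc n) h = (flat_exp n (0 + h) - flat_exp n 0) / h"
      unfolding eventually_at_right_field by (intro exI[of _ 1]) (auto simp: flat_exp_def)
    then show "((\<lambda>h. (flat_exp n (0 + h) - flat_exp n 0) / h) \<longlongrightarrow> 0) (at_right 0)"
      by (rule Lim_transform_eventually[OF flat_exp_at_right])
  qed
  then show ?thesis using equal by (simp add: DERIV_def flat_exp_def)
next
  case greater
  have i: "((\<lambda>t. 1 / t) has_real_derivative - ((1 / t)\<^sup>2)) (at t)"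
    using greater by (auto intro!: derivative_eq_intros simp: power2_eq_square)
  have D: "((\<lambda>t. (1 / t) ^ n * exp (- (1 / t))) has_real_derivative
      (1 / t) ^ n * (exp (- (1 / t)) * - (- ((1 / t)\<^sup>2))) + (of_nat n * ((1 / t) ^ (n - 1) * - ((1 / t)\<^sup>2))) * exp (- (1 / t))) (at t)"
    by (intro DERIV_mult' DERIV_power[where n = n, simplified] DERIV_fun_exp DERIV_minus i)
       (use DERIV_power[OF i, of n] in \<open>simp add: mult_ac\<close>)
  have e1: "of_nat n * ((1 / t) ^ (n - 1) * - ((1 / t)\<^sup>2)) = - (real n * (1 / t) ^ (n + 1))"
    by (cases n) (simp_all add: power2_eq_square power_add)
  have e2: "(1 / t) ^ n * (exp (- (1 / t)) * - (- ((1 / t)\<^sup>2))) = (1 / t) ^ (n + 2) * exp (- (1 / t))"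
    by (simp add: power2_eq_square)
  have "((\<lambda>t. (1 / t) ^ n * exp (- (1 / t))) has_real_derivative
      flat_exp (n + 2) t - real n * flat_exp (n + 1) t) (at t)"
    by (rule DERIV_cong[OF D], unfold e1 e2) (use greater in \<open>simp add: flat_exp_def mult.assoc\<close>)
  then show ?thesis
    by (rule has_field_derivative_transform_within[where d = t]) (use greater in \<open>auto simp: flat_exp_def dist_real_def\<close>)
qed

lemma continuous_flat_exp: "continuous_on S (flat_exp n)"
  using flat_exp_deriv DERIV_isCont by (blast intro: continuous_at_imp_continuous_on)

lemmas continuous_on_flat_exp [continuous_intros] = continuous_on_compose2[OF continuous_flat_exp[of UNIV] _ subset_UNIV]

text \<open>A cutoff at radius \<open>d\<close>, as a function of the squared distance \<open>q\<close>. Since it depends on \<open>q\<^sup>2\<close>, its derivative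
has a factor \<open>q\<close>, which compensates the logarithmic singularity of the kernels at \<open>q = 0\<close>. The index
\<open>n\<close> again labels a family closed under differentiation.\<close>
definition cutoff :: "real \<Rightarrow> nat \<Rightarrow> real \<Rightarrow> real" where
  "cutoff d n q = flat_exp n (1 - q\<^sup>2 / d ^ 4)"

lemma cutoff_eq_0: "d > 0 \<Longrightarrow> q \<ge> d\<^sup>2 \<Longrightarrow> cutoff d n q = 0"
proof -
  assume d: "d > 0" and q: "q \<ge> d\<^sup>2"
  have "(d\<^sup>2)\<^sup>2 \<le> q\<^sup>2" using q by (intro power_mono) auto
  then have "d ^ 4 \<le> q\<^sup>2" by (simp flip: power_mult)
  then show ?thesis using d by (simp add: cutoff_def flat_exp_def)
qed

lemma cutoff_deriv:
  "(cutoff d n has_real_derivative - (2 * q / d ^ 4) * (cutoff d (n + 2) q - real n * cutoff d (n + 1) q)) (at q)"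
proof -
  have "((\<lambda>q. 1 - q\<^sup>2 / d ^ 4) has_real_derivative - (2 * q / d ^ 4)) (at q)"
    using DERIV_diff[OF DERIV_const DERIV_cdivide[OF DERIV_pow[of 2]], of 1] by simp
  from DERIV_chain'[OF this flat_exp_deriv] show ?thesis
    unfolding cutoff_def[abs_def] by (simp add: mult.commute)
qed

lemma continuous_on_cutoff [continuous_intros]: "continuous_on S f \<Longrightarrow> continuous_on S (\<lambda>x. cutoff d n (f x))"
  unfolding cutoff_def divide_inverse by (intro continuous_intros)

abbreviation sqdist :: "real ^ 2 \<Rightarrow> real ^ 2 \<Rightarrow> real" where
  "sqdist x y \<equiv> (y - x) \<bullet> (y - x)"

lemma sqdist_deriv: "(sqdist x has_derivative (\<lambda>h. 2 * ((y - x) \<bullet> h))) (at y)"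
  by (auto intro!: derivative_eq_intros simp: inner_commute)

text \<open>The generated algebra contains all partial derivatives of its elements, which gives smoothness
without computing any derivative of higher order.\<close>
inductive_set radial_algebra :: "real ^ 2 \<Rightarrow> real \<Rightarrow> real \<Rightarrow> (real ^ 2 \<Rightarrow> complex) set"
  for x :: "real ^ 2" and d \<epsilon> :: real where
  const: "(\<lambda>y. c) \<in> radial_algebra x d \<epsilon>"
| coord: "(\<lambda>y. of_real (y $ i)) \<in> radial_algebra x d \<epsilon>"
| log: "(\<lambda>y. of_real (ln (sqdist x y + \<epsilon>\<^sup>2))) \<in> radial_algebra x d \<epsilon>"
| inv: "(\<lambda>y. of_real (inverse (sqdist x y + \<epsilon>\<^sup>2))) \<in> radial_algebra x d \<epsilon>"
| cut: "(\<lambda>y. of_real (cutoff d n (sqdist x y))) \<in> radial_algebra x d \<epsilon>"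
| add: "f \<in> radial_algebra x d \<epsilon> \<Longrightarrow> g \<in> radial_algebra x d \<epsilon> \<Longrightarrow> (\<lambda>y. f y + g y) \<in> radial_algebra x d \<epsilon>"
| mult: "f \<in> radial_algebra x d \<epsilon> \<Longrightarrow> g \<in> radial_algebra x d \<epsilon> \<Longrightarrow> (\<lambda>y. f y * g y) \<in> radial_algebra x d \<epsilon>"

lemma sqdist_in_radial_algebra: "(\<lambda>y. of_real (sqdist x y)) \<in> radial_algebra x d \<epsilon>"
proof -
  have "(\<lambda>y. (of_real (y $ 1) + of_real (- x $ 1)) * (of_real (y $ 1) + of_real (- x $ 1)) +
     (of_real (y $ 2) + of_real (- x $ 2)) * (of_real (y $ 2) + of_real (- x $ 2)) :: complex) \<in> radial_algebra x d \<epsilon>"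
    by (intro radial_algebra.intros)
  moreover have "(of_real (y $ 1) + of_real (- x $ 1)) * (of_real (y $ 1) + of_real (- x $ 1)) +
     (of_real (y $ 2) + of_real (- x $ 2)) * (of_real (y $ 2) + of_real (- x $ 2)) = complex_of_real (sqdist x y)" for y
    by (simp add: inner_vec_def sum_2)
  ultimately show ?thesis by simp
qed

lemma radial_deriv_in_algebra:
  assumes g: "\<And>y. (g has_real_derivative g' y) (at (sqdist x y))"
    and g': "(\<lambda>y. of_real (g' y)) \<in> radial_algebra x d \<epsilon>"
  shows "\<exists>D. (\<forall>y. ((\<lambda>y. complex_of_real (g (sqdist x y))) has_derivative D y) (at y)) \<and>
             (\<forall>i. (\<lambda>y. D y (axis i 1)) \<in> radial_algebra x d \<epsilon>)"
proof (intro exI conjI allI)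
  fix y
  have "((\<lambda>y. g (sqdist x y)) has_derivative (\<lambda>h. g' y * (2 * ((y - x) \<bullet> h)))) (at y)"
    using has_derivative_compose[OF sqdist_deriv[of x y] g[of y, unfolded has_field_derivative_def]] .
  then show "((\<lambda>y. complex_of_real (g (sqdist x y))) has_derivative (\<lambda>h. of_real (g' y * (2 * ((y - x) \<bullet> h))))) (at y)"
    by (rule has_derivative_of_real)
next
  fix i :: 2
  have "(\<lambda>y. of_real (g' y) * (2 * (of_real (y $ i) + of_real (- x $ i)))) \<in> radial_algebra x d \<epsilon>"
    by (intro radial_algebra.intros g')
  then show "(\<lambda>y. of_real (g' y * (2 * ((y - x) \<bullet> axis i 1)))) \<in> radial_algebra x d \<epsilon>"
    by (simp add: inner_axis)
qed

lemma radial_algebra_deriv: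
  assumes f: "f \<in> radial_algebra x d \<epsilon>" and \<epsilon>: "\<epsilon> > 0"
  shows "\<exists>D. (\<forall>y. (f has_derivative D y) (at y)) \<and> (\<forall>i. (\<lambda>y. D y (axis i 1)) \<in> radial_algebra x d \<epsilon>)"
  using f
proof induction
  case (const c)
  show ?case by (intro exI[of _ "\<lambda>y h. 0"]) (auto intro: radial_algebra.const)
next
  case (coord i)
  have "((\<lambda>y. complex_of_real (y $ i)) has_derivative (\<lambda>h. of_real (h $ i))) (at y)" for y
    by (intro has_derivative_of_real bounded_linear_imp_has_derivative bounded_linear_vec_nth)
  then show ?case by (intro exI[of _ "\<lambda>y h. of_real (h $ i)"]) (auto intro: radial_algebra.const)
next
  case log
  have p: "sqdist x y + \<epsilon>\<^sup>2 > 0" for y using \<epsilon> by (simp add: add_nonneg_pos)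
  show ?case
  proof (rule radial_deriv_in_algebra[where g = "\<lambda>q. ln (q + \<epsilon>\<^sup>2)" and g' = "\<lambda>y. inverse (sqdist x y + \<epsilon>\<^sup>2)"])
    show "((\<lambda>q. ln (q + \<epsilon>\<^sup>2)) has_real_derivative inverse (sqdist x y + \<epsilon>\<^sup>2)) (at (sqdist x y))" for y
      using p by (auto intro!: derivative_eq_intros simp: divide_inverse)
  qed (rule radial_algebra.inv)
next
  case inv
  have p: "sqdist x y + \<epsilon>\<^sup>2 \<noteq> 0" for y using \<epsilon> add_nonneg_pos[of "sqdist x y" "\<epsilon>\<^sup>2"] by (simp add: less_imp_neq[symmetric])
  have "(\<lambda>y. (- 1) * (of_real (inverse (sqdist x y + \<epsilon>\<^sup>2)) * of_real (inverse (sqdist x y + \<epsilon>\<^sup>2))) :: complex) \<in> radial_algebra x d \<epsilon>"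
    by (intro radial_algebra.intros)
  then have "(\<lambda>y. complex_of_real (- (inverse (sqdist x y + \<epsilon>\<^sup>2) * inverse (sqdist x y + \<epsilon>\<^sup>2)))) \<in> radial_algebra x d \<epsilon>"
    by (simp only: of_real_minus of_real_mult mult_minus1)
  moreover have "((\<lambda>q. inverse (q + \<epsilon>\<^sup>2)) has_real_derivative - (inverse (sqdist x y + \<epsilon>\<^sup>2) * inverse (sqdist x y + \<epsilon>\<^sup>2))) (at (sqdist x y))" for y
    using p[of y] by (auto intro!: derivative_eq_intros)
  ultimately show ?case by (rule radial_deriv_in_algebra[rotated])
next
  case (cut n)
  have "(\<lambda>y. of_real (- 2 / d ^ 4) * of_real (sqdist x y) *
       (of_real (cutoff d (n + 2) (sqdist x y)) + of_real (- real n) * of_real (cutoff d (n + 1) (sqdist x y))) :: complex)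
     \<in> radial_algebra x d \<epsilon>"
    by (intro radial_algebra.intros sqdist_in_radial_algebra)
  then show ?case
    by (intro radial_deriv_in_algebra[OF cutoff_deriv]) simp
next
  case (add f g)
  then obtain D E where D: "\<And>y. (f has_derivative D y) (at y)" "\<And>i. (\<lambda>y. D y (axis i 1)) \<in> radial_algebra x d \<epsilon>"
    and E: "\<And>y. (g has_derivative E y) (at y)" "\<And>i. (\<lambda>y. E y (axis i 1)) \<in> radial_algebra x d \<epsilon>" by blast
  show ?case
    by (intro exI[of _ "\<lambda>y h. D y h + E y h"] conjI allI has_derivative_add D E radial_algebra.add)
next
  case (mult f g)
  then obtain D E where D: "\<And>y. (f has_derivative D y) (at y)" "\<And>i. (\<lambda>y. D y (axis i 1)) \<in> radial_algebra x d \<epsilon>"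
    and E: "\<And>y. (g has_derivative E y) (at y)" "\<And>i. (\<lambda>y. E y (axis i 1)) \<in> radial_algebra x d \<epsilon>" by blast
  show ?case
    by (intro exI[of _ "\<lambda>y h. f y * E y h + D y h * g y"] conjI allI has_derivative_mult D E radial_algebra.add radial_algebra.mult mult.hyps)
qed

lemma partial_deriv_eq: "(f has_derivative D) (at y) \<Longrightarrow> partial_deriv i f y = D (axis i 1)"
  unfolding partial_deriv_def using frechet_derivative_at by metis

lemma radial_algebra_smooth:
  assumes f: "f \<in> radial_algebra x d \<epsilon>" and \<epsilon>: "\<epsilon> > 0"
  shows "smooth f"
proof -
  have "foldr partial_deriv is f \<in> radial_algebra x d \<epsilon>" for "is"
  proof (induction "is")
    case (Cons i "is")
    obtain D where D: "\<And>y. (foldr partial_deriv is f has_derivative D y) (at y)" "\<And>i. (\<lambda>y. D y (axis i 1)) \<in> radial_algebra x d \<epsilon>"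
      using radial_algebra_deriv[OF Cons \<epsilon>] by blast
    have "partial_deriv i (foldr partial_deriv is f) = (\<lambda>y. D y (axis i 1))"
      using partial_deriv_eq[OF D(1)] by blast
    then show ?case using D(2) by simp
  qed (use f in simp)
  then show ?thesis unfolding smooth_def differentiable_def using radial_algebra_deriv[OF _ \<epsilon>] by blast
qed

text \<open>In the variable \<open>q = \<bar>y - x\<bar>\<^sup>2\<close> the planar Laplacian is \<open>4 h' + 4 q h''\<close>.\<close>
lemma laplacian_radial:
  fixes h h1 h2 :: "real \<Rightarrow> complex"
  assumes 1: "\<And>q. q \<ge> 0 \<Longrightarrow> (h has_vector_derivative h1 q) (at q)"
    and 2: "\<And>q. q \<ge> 0 \<Longrightarrow> (h1 has_vector_derivative h2 q) (at q)"
  shows "laplacian (\<lambda>y. h (sqdist x y)) y = 4 * h1 (sqdist x y) + 4 * of_real (sqdist x y) * h2 (sqdist x y)"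
proof -
  have d: "((\<lambda>y. g (sqdist x y)) has_derivative (\<lambda>v. of_real (2 * ((y - x) \<bullet> v)) * g' (sqdist x y))) (at y)"
    if "\<And>q. q \<ge> 0 \<Longrightarrow> (g has_vector_derivative g' q) (at q)" for g g' :: "real \<Rightarrow> complex" and y
    using has_derivative_compose[OF sqdist_deriv[of x y] that[of "sqdist x y", unfolded has_vector_derivative_def]]
    by (simp add: scaleR_conv_of_real)
  have p1: "partial_deriv i (\<lambda>y. h (sqdist x y)) = (\<lambda>y. of_real (2 * (y $ i - x $ i)) * h1 (sqdist x y))" for i
    by (rule ext) (simp add: partial_deriv_eq[OF d[OF 1]] inner_axis)
  have p2: "partial_deriv i (\<lambda>y. of_real (2 * (y $ i - x $ i)) * h1 (sqdist x y)) y
     = of_real (2 * (y $ i - x $ i)) * (of_real (2 * (y $ i - x $ i)) * h2 (sqdist x y)) + 2 * h1 (sqdist x y)" for i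
  proof -
    have "((\<lambda>y. complex_of_real (2 * (y $ i - x $ i))) has_derivative (\<lambda>v. of_real (2 * v $ i))) (at y)"
      by (rule has_derivative_of_real)
         (auto intro!: derivative_eq_intros bounded_linear_imp_has_derivative bounded_linear_vec_nth)
    from partial_deriv_eq[OF has_derivative_mult[OF this d[OF 2]], of i] show ?thesis
      by (simp add: inner_axis)
  qed
  show ?thesis unfolding laplacian_def p1 p2 by (simp add: sum_2 inner_vec_def algebra_simps)
qed

section \<open>A regularised parametrix of the Helmholtz operator\<close>

text \<open>With \<open>t = q + \<epsilon>\<^sup>2\<close>, the function \<open>ln t / 2\<close> is a regularised multiple of the fundamental solution of the
Laplacian: its Laplacian is \<open>2 * \<epsilon>\<^sup>2 / t\<^sup>2\<close>. The term \<open>k\<^sup>2 * ln t / 2\<close> that it produces in the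
Helmholtz operator would be unbounded as \<open>\<epsilon> \<longlonglongrightarrow> 0\<close>; it is cancelled by the Laplacian of
\<open>- k\<^sup>2 / 8 * t * ln t\<close>, at the price of a harmless multiple of \<open>t * ln t\<close>.\<close>
definition log_kernel :: "complex \<Rightarrow> real \<Rightarrow> real \<Rightarrow> real \<Rightarrow> complex" where
  "log_kernel k d \<epsilon> q = of_real (cutoff d 0 q) *
     (of_real (ln (q + \<epsilon>\<^sup>2) / 2) - k\<^sup>2 / 8 * of_real ((q + \<epsilon>\<^sup>2) * ln (q + \<epsilon>\<^sup>2)))"

text \<open>What the Helmholtz operator leaves of \<open>log_kernel\<close> besides the approximate identity. The arguments
\<open>e\<close>, \<open>u\<close>, \<open>w\<close> stand for \<open>\<epsilon>\<^sup>2 / t\<close>, \<open>q / t\<close> and \<open>t * ln t\<close>. These are bounded uniformly in \<open>\<epsilon>\<close>, have limits as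
\<open>\<epsilon> \<longlonglongrightarrow> 0\<close>, and the remainder is a polynomial in them.\<close>
definition remainder :: "complex \<Rightarrow> real \<Rightarrow> real \<Rightarrow> real \<Rightarrow> real \<Rightarrow> real \<Rightarrow> complex" where
  "remainder k d q e u w =
     of_real (cutoff d 0 q) * (- k\<^sup>2 + k\<^sup>2 / 2 * of_real e - k ^ 4 / 8 * of_real w)
     - of_real (16 / d ^ 4 * cutoff d 2 q) * (of_real (q / 2 * u) - k\<^sup>2 / 8 * of_real (q * (u * w + q)))
     + of_real (- 16 / d ^ 4 * cutoff d 2 q + 16 * q\<^sup>2 / d ^ 8 * (cutoff d 4 q - 2 * cutoff d 3 q))
        * (of_real (u * w / 2) - k\<^sup>2 / 8 * of_real (q * w))"

lemma log_kernel_smooth: "\<epsilon> > 0 \<Longrightarrow> smooth (\<lambda>y. log_kernel k d \<epsilon> (sqdist x y))"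
proof -
  assume \<epsilon>: "\<epsilon> > 0"
  have "(\<lambda>y. of_real (cutoff d 0 (sqdist x y)) *
     ((1 / 2) * of_real (ln (sqdist x y + \<epsilon>\<^sup>2)) + (- (k\<^sup>2 / 8)) * ((of_real (sqdist x y) + of_real (\<epsilon>\<^sup>2)) * of_real (ln (sqdist x y + \<epsilon>\<^sup>2)))))
     \<in> radial_algebra x d \<epsilon>"
    by (intro radial_algebra.intros sqdist_in_radial_algebra)
  moreover have "of_real (cutoff d 0 (sqdist x y)) *
     ((1 / 2) * of_real (ln (sqdist x y + \<epsilon>\<^sup>2)) + (- (k\<^sup>2 / 8)) * ((of_real (sqdist x y) + of_real (\<epsilon>\<^sup>2)) * of_real (ln (sqdist x y + \<epsilon>\<^sup>2))))
     = log_kernel k d \<epsilon> (sqdist x y)" for y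
    by (simp add: log_kernel_def)
  ultimately show ?thesis using radial_algebra_smooth[OF _ \<epsilon>] by (simp only:)
qed

lemma log_kernel_eq_0: "d > 0 \<Longrightarrow> q \<ge> d\<^sup>2 \<Longrightarrow> log_kernel k d \<epsilon> q = 0"
  by (simp add: log_kernel_def cutoff_eq_0)

lemma remainder_eq_0: "d > 0 \<Longrightarrow> q \<ge> d\<^sup>2 \<Longrightarrow> remainder k d q e u w = 0"
  by (simp add: remainder_def cutoff_eq_0)

text \<open>The product rule in the variable \<open>q\<close>, with the first two derivatives \<open>\<beta>1\<close>, \<open>\<beta>2\<close> of the cutoff and
\<open>F1\<close>, \<open>F2\<close> of the regularised parametrix \<open>F\<close>; the rest is a rational identity in \<open>q\<close>, \<open>t\<close> and
\<open>ln t\<close>.\<close>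
lemma helmholtz_log_kernel:
  fixes x y :: "real ^ 2"
  assumes \<epsilon>: "\<epsilon> > 0" and d: "d > 0"
  defines "q \<equiv> sqdist x y" and "t \<equiv> sqdist x y + \<epsilon>\<^sup>2"
  shows "laplacian (\<lambda>y. log_kernel k d \<epsilon> (sqdist x y)) y + k\<^sup>2 * log_kernel k d \<epsilon> (sqdist x y)
    = of_real (cutoff d 0 q * (2 * \<epsilon>\<^sup>2 / t\<^sup>2)) + remainder k d q (\<epsilon>\<^sup>2 / t) (q / t) (t * ln t)"
proof -
  define \<beta>1 where "\<beta>1 q = - (2 * q / d ^ 4) * cutoff d 2 q" for q
  define \<beta>2 where "\<beta>2 q = - (2 / d ^ 4) * cutoff d 2 q + 4 * q\<^sup>2 / d ^ 8 * (cutoff d 4 q - 2 * cutoff d 3 q)" for q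
  define F where "F q = of_real (ln (q + \<epsilon>\<^sup>2) / 2) - k\<^sup>2 / 8 * of_real ((q + \<epsilon>\<^sup>2) * ln (q + \<epsilon>\<^sup>2))" for q
  define F1 where "F1 q = of_real (1 / (2 * (q + \<epsilon>\<^sup>2))) - k\<^sup>2 / 8 * of_real (ln (q + \<epsilon>\<^sup>2) + 1)" for q
  define F2 where "F2 q = of_real (- 1 / (2 * (q + \<epsilon>\<^sup>2)\<^sup>2)) - k\<^sup>2 / 8 * of_real (1 / (q + \<epsilon>\<^sup>2))" for q
  have pos: "q + \<epsilon>\<^sup>2 > 0" if "q \<ge> 0" for q using that \<epsilon> by (simp add: add_nonneg_pos)
  have b1: "(cutoff d 0 has_real_derivative \<beta>1 q) (at q)" for q
    using cutoff_deriv[of d 0 q] by (simp add: \<beta>1_def numeral_2_eq_2)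
  have b2: "(\<beta>1 has_real_derivative \<beta>2 q) (at q)" for q
  proof -
    have c2: "(cutoff d 2 has_real_derivative - (2 * q / d ^ 4) * (cutoff d 4 q - 2 * cutoff d 3 q)) (at q)"
      using cutoff_deriv[of d 2 q] by simp
    have "((\<lambda>q. - (2 * q / d ^ 4)) has_real_derivative - (2 / d ^ 4)) (at q)"
      by (rule DERIV_minus, rule DERIV_cdivide, rule DERIV_cmult_Id)
    from DERIV_mult'[OF this c2] show ?thesis unfolding \<beta>1_def[abs_def]
      by (rule DERIV_cong) (use d in \<open>simp add: \<beta>2_def power2_eq_square field_simps flip: power_add\<close>)
  qed
  have f1: "(F has_vector_derivative F1 q) (at q)" if "q \<ge> 0" for q
  proof -
    have l: "((\<lambda>q. ln (q + \<epsilon>\<^sup>2)) has_real_derivative 1 / (q + \<epsilon>\<^sup>2)) (at q)"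
      using pos[OF that] by (auto intro!: derivative_eq_intros)
    have l2: "((\<lambda>q. ln (q + \<epsilon>\<^sup>2) / 2) has_real_derivative 1 / (2 * (q + \<epsilon>\<^sup>2))) (at q)"
      using DERIV_cdivide[OF l, of 2] by (simp add: mult.commute)
    have tl: "((\<lambda>q. (q + \<epsilon>\<^sup>2) * ln (q + \<epsilon>\<^sup>2)) has_real_derivative ln (q + \<epsilon>\<^sup>2) + 1) (at q)"
      using pos[OF that] by (auto intro!: derivative_eq_intros)
    show ?thesis unfolding F_def[abs_def] F1_def
      by (intro has_vector_derivative_diff has_vector_derivative_mult_right has_vector_derivative_of_real)
         (use l2 tl in \<open>simp_all add: has_real_derivative_iff_has_vector_derivative\<close>)
  qed
  have f2: "(F1 has_vector_derivative F2 q) (at q)" if "q \<ge> 0" for q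
  proof -
    have l: "((\<lambda>q. ln (q + \<epsilon>\<^sup>2) + 1) has_real_derivative 1 / (q + \<epsilon>\<^sup>2)) (at q)"
      using pos[OF that] by (auto intro!: derivative_eq_intros)
    have i: "((\<lambda>q. 1 / (2 * (q + \<epsilon>\<^sup>2))) has_real_derivative - 1 / (2 * (q + \<epsilon>\<^sup>2)\<^sup>2)) (at q)"
    proof -
      have f: "((\<lambda>q. q + \<epsilon>\<^sup>2) has_real_derivative 1) (at q)" by (auto intro!: derivative_eq_intros)
      have nz: "q + \<epsilon>\<^sup>2 \<noteq> 0" using pos[OF that] by linarith
      have 1: "(\<lambda>q. 1 / (2 * (q + \<epsilon>\<^sup>2))) = (\<lambda>q. 1 / 2 * inverse (q + \<epsilon>\<^sup>2))"
        by (rule ext) (simp add: inverse_eq_divide)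
      have 2: "- 1 / (2 * (q + \<epsilon>\<^sup>2)\<^sup>2) = 1 / 2 * (- (inverse (q + \<epsilon>\<^sup>2) * 1 * inverse (q + \<epsilon>\<^sup>2)))"
        by (simp add: inverse_eq_divide power2_eq_square[of "q + \<epsilon>\<^sup>2"])
      show ?thesis unfolding 1 2 by (intro DERIV_cmult DERIV_inverse'[OF f nz])
    qed
    show ?thesis unfolding F1_def[abs_def] F2_def
      by (intro has_vector_derivative_diff has_vector_derivative_mult_right has_vector_derivative_of_real)
         (use l i in \<open>simp_all add: has_real_derivative_iff_has_vector_derivative\<close>)
  qed
  have cb1: "((\<lambda>q. complex_of_real (cutoff d 0 q)) has_vector_derivative of_real (\<beta>1 q)) (at q)" for q
    using b1 by (intro has_vector_derivative_of_real) (simp add: has_real_derivative_iff_has_vector_derivative)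
  have cb2: "((\<lambda>q. complex_of_real (\<beta>1 q)) has_vector_derivative of_real (\<beta>2 q)) (at q)" for q
    using b2 by (intro has_vector_derivative_of_real) (simp add: has_real_derivative_iff_has_vector_derivative)
  define h1 where "h1 q = of_real (cutoff d 0 q) * F1 q + of_real (\<beta>1 q) * F q" for q
  define h2 where "h2 q = (of_real (cutoff d 0 q) * F2 q + of_real (\<beta>1 q) * F1 q) + (of_real (\<beta>1 q) * F1 q + of_real (\<beta>2 q) * F q)" for q
  have h: "log_kernel k d \<epsilon> = (\<lambda>q. of_real (cutoff d 0 q) * F q)" by (simp add: log_kernel_def F_def fun_eq_iff)
  have L: "laplacian (\<lambda>y. log_kernel k d \<epsilon> (sqdist x y)) y = 4 * h1 q + 4 * of_real q * h2 q"
    unfolding q_def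
  proof (rule laplacian_radial)
    show "(log_kernel k d \<epsilon> has_vector_derivative h1 q) (at q)" if "q \<ge> 0" for q
      unfolding h h1_def by (intro has_vector_derivative_mult cb1 f1 that)
    show "(h1 has_vector_derivative h2 q) (at q)" if "q \<ge> 0" for q
      unfolding h1_def[abs_def] h2_def by (intro has_vector_derivative_add has_vector_derivative_mult cb1 cb2 f1 f2 that)
  qed
  have t: "t > 0" "t = q + \<epsilon>\<^sup>2" using pos[of q] by (auto simp: t_def q_def)
  define T where "T = complex_of_real t"
  define Q where "Q = complex_of_real q"
  define l where "l = complex_of_real (ln t)"
  define b0 b2' b3 where "b0 = complex_of_real (cutoff d 0 q)" and "b2' = complex_of_real (cutoff d 2 q)"
    and "b3 = complex_of_real (cutoff d 4 q - 2 * cutoff d 3 q)"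
  define r where "r = complex_of_real (1 / d ^ 4)"
  have T0: "T \<noteq> 0" using t(1) by (simp add: T_def)
  have ee: "complex_of_real (\<epsilon>\<^sup>2) = T - Q" using t by (simp add: T_def Q_def)
  have Fs: "F q = l / 2 - k\<^sup>2 / 8 * (T * l)" "F1 q = 1 / (2 * T) - k\<^sup>2 / 8 * (l + 1)" "F2 q = - 1 / (2 * T\<^sup>2) - k\<^sup>2 / 8 * (1 / T)"
    unfolding F_def F1_def F2_def t(2)[symmetric] T_def l_def by simp_all
  have B1: "of_real (\<beta>1 q) = - (2 * Q * r) * b2'" by (simp add: \<beta>1_def Q_def r_def b2'_def)
  have r2: "r * r = complex_of_real (1 / d ^ 8)" unfolding r_def by (simp flip: power_add)
  have B2: "of_real (\<beta>2 q) = - (2 * r) * b2' + 4 * Q\<^sup>2 * (r * r) * b3"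
    unfolding r2 by (simp add: \<beta>2_def Q_def b2'_def b3_def) (simp add: r_def)
  have R: "remainder k d q (\<epsilon>\<^sup>2 / t) (q / t) (t * ln t) =
     b0 * (- k\<^sup>2 + k\<^sup>2 / 2 * ((T - Q) / T) - k ^ 4 / 8 * (T * l))
     - (16 * r * b2') * (Q / 2 * (Q / T) - k\<^sup>2 / 8 * (Q * (Q / T * (T * l) + Q)))
     + (- 16 * r * b2' + 16 * Q\<^sup>2 * (r * r) * b3) * (Q / T * (T * l) / 2 - k\<^sup>2 / 8 * (Q * (T * l)))"
    unfolding r2 ee[symmetric] by (simp add: remainder_def b0_def b2'_def b3_def Q_def T_def l_def) (simp add: r_def)
  have D: "complex_of_real (cutoff d 0 q * (2 * \<epsilon>\<^sup>2 / t\<^sup>2)) = b0 * (2 * (T - Q) / T\<^sup>2)"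
    unfolding ee[symmetric] by (simp add: b0_def T_def)
  have alg: "4 * (b0 * (1 / (2 * T) - k\<^sup>2 / 8 * (l + 1)) + - (2 * Q * r) * b2' * (l / 2 - k\<^sup>2 / 8 * (T * l)))
     + 4 * Q * ((b0 * (- 1 / (2 * T\<^sup>2) - k\<^sup>2 / 8 * (1 / T)) + - (2 * Q * r) * b2' * (1 / (2 * T) - k\<^sup>2 / 8 * (l + 1)))
       + (- (2 * Q * r) * b2' * (1 / (2 * T) - k\<^sup>2 / 8 * (l + 1)) + (- (2 * r) * b2' + 4 * Q\<^sup>2 * (r * r) * b3) * (l / 2 - k\<^sup>2 / 8 * (T * l))))
     + k\<^sup>2 * (b0 * (l / 2 - k\<^sup>2 / 8 * (T * l))) =
     b0 * (2 * (T - Q) / T\<^sup>2) + (b0 * (- k\<^sup>2 + k\<^sup>2 / 2 * ((T - Q) / T) - k ^ 4 / 8 * (T * l))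
     - (16 * r * b2') * (Q / 2 * (Q / T) - k\<^sup>2 / 8 * (Q * (Q / T * (T * l) + Q)))
     + (- 16 * r * b2' + 16 * Q\<^sup>2 * (r * r) * b3) * (Q / T * (T * l) / 2 - k\<^sup>2 / 8 * (Q * (T * l))))"
    using T0 by (simp add: field_simps power2_eq_square power4_eq_xxxx)
  have hq: "log_kernel k d \<epsilon> q = of_real (cutoff d 0 q) * F q" by (simp add: h)
  show ?thesis
    unfolding L D R q_def[symmetric] hq h1_def h2_def Fs B1 B2 b0_def[symmetric] Q_def[symmetric] by (rule alg)
qed

section \<open>The kernels in the limit of vanishing regularisation\<close>

definition approx_kernel :: "real \<Rightarrow> real \<Rightarrow> real ^ 2 \<Rightarrow> real" where
  "approx_kernel d \<epsilon> z = cutoff d 0 (z \<bullet> z) * (2 * \<epsilon>\<^sup>2 / (z \<bullet> z + \<epsilon>\<^sup>2)\<^sup>2)"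

definition approx_remainder :: "complex \<Rightarrow> real \<Rightarrow> real \<Rightarrow> real ^ 2 \<Rightarrow> complex" where
  "approx_remainder k d \<epsilon> z = remainder k d (z \<bullet> z) (\<epsilon>\<^sup>2 / (z \<bullet> z + \<epsilon>\<^sup>2)) (z \<bullet> z / (z \<bullet> z + \<epsilon>\<^sup>2))
     ((z \<bullet> z + \<epsilon>\<^sup>2) * ln (z \<bullet> z + \<epsilon>\<^sup>2))"

text \<open>The limit of \<open>approx_remainder\<close> for \<open>\<epsilon> \<longlonglongrightarrow> 0\<close> away from the origin, where \<open>e\<close> tends to \<open>0\<close> and
\<open>u\<close> to \<open>1\<close>.\<close>
definition limit_remainder :: "complex \<Rightarrow> real \<Rightarrow> real ^ 2 \<Rightarrow> complex" where
  "limit_remainder k d z = remainder k d (z \<bullet> z) 0 1 (z \<bullet> z * ln (z \<bullet> z))"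

lemma borel_measurable_cutoff [measurable]: "cutoff d n \<in> borel_measurable borel"
  by (intro borel_measurable_continuous_onI continuous_intros)

lemma borel_measurable_kernels [measurable]:
  "approx_kernel d \<epsilon> \<in> borel_measurable borel" "approx_remainder k d \<epsilon> \<in> borel_measurable borel"
  "limit_remainder k d \<in> borel_measurable borel"
  unfolding approx_kernel_def[abs_def] approx_remainder_def[abs_def] limit_remainder_def[abs_def] remainder_def
  by measurable

lemma abs_mult_ln_le: "0 \<le> (t :: real) \<Longrightarrow> \<bar>t * ln t\<bar> \<le> 1 + t\<^sup>2"
proof (cases "t = 0")
  case False
  assume "0 \<le> t"
  with False have t: "t > 0" by simp
  have "ln t \<le> t" using ln_le_minus_one[OF t] by simp
  moreover have "- ln t \<le> 1 / t" using ln_le_minus_one[of "1 / t"] t by (simp add: ln_div)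
  ultimately have "t * ln t \<le> t * t" "t * (- ln t) \<le> t * (1 / t)" using t by (intro mult_left_mono; simp)+
  moreover have "t * (- ln t) = - (t * ln t)" "t * (1 / t) = 1" "0 \<le> t * t" using t by auto
  ultimately show ?thesis unfolding abs_le_iff power2_eq_square by linarith
qed simp

text \<open>A continuous function on a compact set of parameters; beyond \<open>q = d\<^sup>2\<close> it vanishes.\<close>
lemma remainder_bounded:
  assumes d: "d > 0"
  shows "\<exists>C\<ge>0. \<forall>q e u w. 0 \<le> q \<and> 0 \<le> e \<and> e \<le> 1 \<and> 0 \<le> u \<and> u \<le> 1 \<and> \<bar>w\<bar> \<le> W \<longrightarrow> cmod (remainder k d q e u w) \<le> C"
proof -
  let ?f = "\<lambda>(q, e, u, w). remainder k d q e u w"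
  let ?S = "{0..d\<^sup>2} \<times> {0..1} \<times> {0..1} \<times> {- W..W}"
  have "continuous_on ?S ?f"
    unfolding remainder_def case_prod_beta divide_inverse by (intro continuous_intros)
  then have "bounded (?f ` ?S)"
    by (intro compact_imp_bounded compact_continuous_image compact_Times) auto
  then obtain B where B: "\<And>v. v \<in> ?f ` ?S \<Longrightarrow> norm v \<le> B" unfolding bounded_iff by blast
  have "cmod (remainder k d q e u w) \<le> \<bar>B\<bar>"
    if "0 \<le> q" "0 \<le> e" "e \<le> 1" "0 \<le> u" "u \<le> 1" "\<bar>w\<bar> \<le> W" for q e u w
  proof (cases "q \<le> d\<^sup>2")
    case True
    then have "(q, e, u, w) \<in> ?S" using that by (auto simp: abs_le_iff)
    then have "norm (?f (q, e, u, w)) \<le> B" by (intro B imageI)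
    then show ?thesis by simp
  next
    case False
    then show ?thesis using remainder_eq_0[OF d, of q] by simp
  qed
  then show ?thesis by (intro exI[of _ "\<bar>B\<bar>"]) auto
qed

lemma approx_remainder_bounded:
  assumes d: "d > 0"
  shows "\<exists>C\<ge>0. (\<forall>\<epsilon> z. 0 < \<epsilon> \<and> \<epsilon> \<le> 1 \<longrightarrow> cmod (approx_remainder k d \<epsilon> z) \<le> C) \<and> (\<forall>z. cmod (limit_remainder k d z) \<le> C)"
proof -
  define W where "W = 1 + (d\<^sup>2 + 1)\<^sup>2"
  obtain C where C: "C \<ge> 0" "\<And>q e u w. 0 \<le> q \<Longrightarrow> 0 \<le> e \<Longrightarrow> e \<le> 1 \<Longrightarrow> 0 \<le> u \<Longrightarrow> u \<le> 1 \<Longrightarrow> \<bar>w\<bar> \<le> W \<Longrightarrow> cmod (remainder k d q e u w) \<le> C"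
    using remainder_bounded[OF d, of W k] by blast
  have w: "\<bar>t * ln t\<bar> \<le> W" if "0 \<le> t" "t \<le> d\<^sup>2 + 1" for t
  proof -
    have "t\<^sup>2 \<le> (d\<^sup>2 + 1)\<^sup>2" using that by (intro power_mono) auto
    then show ?thesis using abs_mult_ln_le[OF that(1)] by (simp add: W_def)
  qed
  have "cmod (approx_remainder k d \<epsilon> z) \<le> C" if \<epsilon>: "0 < \<epsilon>" "\<epsilon> \<le> 1" for \<epsilon> z
  proof (cases "z \<bullet> z \<le> d\<^sup>2")
    case True
    have e: "\<epsilon>\<^sup>2 > 0" "\<epsilon>\<^sup>2 \<le> 1" using \<epsilon> by (auto simp: power_le_one)
    show ?thesis unfolding approx_remainder_def
      by (intro C(2) w) (use True e in \<open>auto simp: divide_simps add_nonneg_pos intro: add_nonneg_nonneg\<close>)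
  next
    case False
    then show ?thesis using remainder_eq_0[OF d, of "z \<bullet> z"] C(1) by (simp add: approx_remainder_def)
  qed
  moreover have "cmod (limit_remainder k d z) \<le> C" for z
  proof (cases "z \<bullet> z \<le> d\<^sup>2")
    case True
    then show ?thesis unfolding limit_remainder_def by (intro C(2) w) auto
  next
    case False
    then show ?thesis using remainder_eq_0[OF d, of "z \<bullet> z"] C(1) by (simp add: limit_remainder_def)
  qed
  ultimately show ?thesis using C(1) by blast
qed

definition eps :: "nat \<Rightarrow> real" where "eps n = 1 / real (Suc n)"

lemma eps_pos: "0 < eps n" "eps n \<le> 1" by (simp_all add: eps_def)

lemma eps_tendsto: "eps \<longlonglongrightarrow> 0"
  using LIMSEQ_inverse_real_of_nat unfolding eps_def[abs_def] inverse_eq_divide .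

lemma approx_remainder_tendsto:
  assumes z: "z \<noteq> 0"
  shows "(\<lambda>n. approx_remainder k d (eps n) z) \<longlonglongrightarrow> limit_remainder k d z"
proof -
  have p: "z \<bullet> z > 0" using z by simp
  have t: "(\<lambda>n. z \<bullet> z + (eps n)\<^sup>2) \<longlonglongrightarrow> z \<bullet> z"
    using tendsto_add[OF tendsto_const tendsto_power[OF eps_tendsto, of 2]] by simp
  have 1: "(\<lambda>n. (eps n)\<^sup>2 / (z \<bullet> z + (eps n)\<^sup>2)) \<longlonglongrightarrow> 0"
    using tendsto_divide[OF tendsto_power[OF eps_tendsto, of 2] t] p by simp
  have 2: "(\<lambda>n. z \<bullet> z / (z \<bullet> z + (eps n)\<^sup>2)) \<longlonglongrightarrow> 1"
    using tendsto_divide[OF tendsto_const t, of "z \<bullet> z"] p by simp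
  have 3: "(\<lambda>n. (z \<bullet> z + (eps n)\<^sup>2) * ln (z \<bullet> z + (eps n)\<^sup>2)) \<longlonglongrightarrow> z \<bullet> z * ln (z \<bullet> z)"
    using p by (intro tendsto_mult t tendsto_ln) auto
  have "continuous_on UNIV (\<lambda>p. remainder k d (z \<bullet> z) (fst p) (fst (snd p)) (snd (snd p)))"
    unfolding remainder_def divide_inverse by (intro continuous_intros)
  then have "isCont (\<lambda>p. remainder k d (z \<bullet> z) (fst p) (fst (snd p)) (snd (snd p))) (0, 1, z \<bullet> z * ln (z \<bullet> z))"
    by (simp add: continuous_on_eq_continuous_at)
  from isCont_tendsto_compose[OF this tendsto_Pair[OF 1 tendsto_Pair[OF 2 3]]] show ?thesis
    unfolding approx_remainder_def limit_remainder_def by simp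
qed

lemma cutoff_0_bounds: "0 \<le> cutoff d 0 q" "cutoff d 0 q \<le> 1"
proof -
  have "0 \<le> flat_exp 0 t \<and> flat_exp 0 t \<le> 1" for t by (simp add: flat_exp_def)
  then show "0 \<le> cutoff d 0 q" "cutoff d 0 q \<le> 1" by (simp_all add: cutoff_def)
qed

text \<open>The profile of the approximate identity: \<open>2 * \<epsilon>\<^sup>2 / (\<bar>z\<bar>\<^sup>2 + \<epsilon>\<^sup>2)\<^sup>2\<close> is its rescaling by \<open>\<epsilon>\<close>, and has the same
integral for all \<open>\<epsilon>\<close>.\<close>
definition plane_bump :: "real ^ 2 \<Rightarrow> real" where
  "plane_bump z = 2 / (z \<bullet> z + 1)\<^sup>2"

lemma integrable_inverse_one_plus_square: "integrable lborel (\<lambda>x :: real. inverse (1 + x\<^sup>2))"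
proof -
  have "set_integrable lborel (einterval (-\<infinity>) \<infinity>) (\<lambda>x :: real. inverse (1 + x\<^sup>2))"
  proof (rule interval_integral_FTC_nonneg(1)[where F = arctan and A = "- (pi / 2)" and B = "pi / 2"])
    show "(arctan has_real_derivative inverse (1 + x\<^sup>2)) (at x)" for x by (rule DERIV_arctan)
    show "isCont (\<lambda>x. inverse (1 + x\<^sup>2)) x" for x :: real
      by (intro continuous_intros) (simp add: add_nonneg_eq_0_iff)
    show "((arctan \<circ> real_of_ereal) \<longlongrightarrow> - (pi / 2)) (at_right (-\<infinity>))"
      using tendsto_arctan_at_bot by (simp add: ereal_tendsto_simps)
    show "((arctan \<circ> real_of_ereal) \<longlongrightarrow> pi / 2) (at_left \<infinity>)"
      using tendsto_arctan_at_top by (simp add: ereal_tendsto_simps)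
  qed auto
  then show ?thesis by (simp add: set_integrable_def)
qed

text \<open>Since \<open>(1 + r\<^sup>2)\<^sup>2 \<ge> (1 + x\<^sup>2) * (1 + y\<^sup>2)\<close>, the profile is dominated by a product of two integrable
functions of one variable.\<close>
lemma integrable_plane_bump: "integrable lborel plane_bump"
proof -
  interpret p: product_sigma_finite "\<lambda>_ :: real ^ 2. lborel :: real measure" by standard
  have "integrable (\<Pi>\<^sub>M b\<in>(Basis :: (real ^ 2) set). (lborel :: real measure)) (\<lambda>f. \<Prod>b\<in>Basis. inverse (1 + (f b)\<^sup>2))"
    by (rule p.product_integrable_prod) (auto intro: integrable_inverse_one_plus_square)
  moreover have "(\<Sum>b\<in>Basis. f b *\<^sub>R b) \<bullet> b' = f b'" if "b' \<in> Basis" for f and b' :: "real ^ 2"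
    using that by simp
  ultimately have "integrable lborel (\<lambda>z :: real ^ 2. \<Prod>b\<in>Basis. inverse (1 + (z \<bullet> b)\<^sup>2))"
    by (subst lborel_eq, subst integrable_distr_eq) (auto cong: prod.cong)
  then have i: "integrable lborel (\<lambda>z :: real ^ 2. 2 * (\<Prod>b\<in>Basis. inverse (1 + (z \<bullet> b)\<^sup>2)))" by simp
  have B: "(Basis :: (real ^ 2) set) = {axis 1 1, axis 2 1}"
    by (auto simp: Basis_vec_def UNIV_2)
  have ne: "axis 1 1 \<noteq> (axis 2 1 :: real ^ 2)" by (simp add: axis_eq_axis)
  show ?thesis
  proof (rule Bochner_Integration.integrable_bound[OF i])
    show "plane_bump \<in> borel_measurable lborel" unfolding plane_bump_def[abs_def] by simp
    have "plane_bump z \<le> 2 * (inverse (1 + (z $ 1)\<^sup>2) * inverse (1 + (z $ 2)\<^sup>2))" for z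
    proof -
      have "(1 + (z $ 1)\<^sup>2) * (1 + (z $ 2)\<^sup>2) \<le> (z \<bullet> z + 1) * (z \<bullet> z + 1)"
        by (intro mult_mono) (auto simp: inner_vec_def sum_2 power2_eq_square)
      moreover have "(1 + (z $ 1)\<^sup>2) * (1 + (z $ 2)\<^sup>2) > 0" by (intro mult_pos_pos) (auto simp: add_pos_nonneg)
      ultimately have "inverse ((z \<bullet> z + 1) * (z \<bullet> z + 1)) \<le> inverse ((1 + (z $ 1)\<^sup>2) * (1 + (z $ 2)\<^sup>2))"
        by (rule le_imp_inverse_le)
      then show ?thesis by (simp add: plane_bump_def divide_inverse power2_eq_square)
    qed
    moreover have "plane_bump z \<ge> 0" for z by (simp add: plane_bump_def)
    ultimately show "AE z in lborel. norm (plane_bump z) \<le> norm (2 * (\<Prod>b\<in>Basis. inverse (1 + (z \<bullet> b)\<^sup>2)))"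
      unfolding B using ne by (intro AE_I2) (auto simp: inner_axis abs_mult intro: order_trans)
  qed
qed

lemma integral_plane_bump_pos: "integral\<^sup>L lborel plane_bump > 0"
proof -
  have nn: "plane_bump z > 0" for z
  proof -
    have "z \<bullet> z + 1 > 0" by (intro add_nonneg_pos) auto
    then show ?thesis by (simp add: plane_bump_def)
  qed
  have "integral\<^sup>L lborel plane_bump \<noteq> 0"
  proof
    assume "integral\<^sup>L lborel plane_bump = 0"
    then have "AE z in lborel. plane_bump z = 0"
      using integral_nonneg_eq_0_iff_AE[OF integrable_plane_bump] nn by (simp add: less_imp_le)
    then have "AE z in (lborel :: (real ^ 2) measure). False" by eventually_elim (use nn in \<open>metis less_irrefl\<close>)
    then show False by (simp add: eventually_False ae_filter_eq_bot_iff)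
  qed
  moreover have "integral\<^sup>L lborel plane_bump \<ge> 0" using nn by (intro Bochner_Integration.integral_nonneg) (simp add: less_imp_le)
  ultimately show ?thesis by simp
qed

lemma approx_kernel_scale:
  assumes \<epsilon>: "\<epsilon> > 0"
  shows "\<epsilon>\<^sup>2 * approx_kernel d \<epsilon> (\<epsilon> *\<^sub>R z) = cutoff d 0 (\<epsilon>\<^sup>2 * (z \<bullet> z)) * plane_bump z"
proof -
  have 1: "(\<epsilon> *\<^sub>R z) \<bullet> (\<epsilon> *\<^sub>R z) = \<epsilon>\<^sup>2 * (z \<bullet> z)" by (simp add: power2_eq_square)
  have 2: "\<epsilon>\<^sup>2 * (z \<bullet> z) + \<epsilon>\<^sup>2 = \<epsilon>\<^sup>2 * (z \<bullet> z + 1)" by (simp add: algebra_simps)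
  have 3: "\<epsilon>\<^sup>2 * (2 * \<epsilon>\<^sup>2 / (\<epsilon>\<^sup>2 * (z \<bullet> z + 1))\<^sup>2) = 2 / (z \<bullet> z + 1)\<^sup>2"
    using \<epsilon> by (simp add: power2_eq_square)
  show ?thesis unfolding approx_kernel_def plane_bump_def 1 2 3[symmetric] by (rule mult.left_commute)
qed

lemma integral_scale_shift:
  fixes f :: "real ^ 2 \<Rightarrow> real"
  assumes [measurable]: "f \<in> borel_measurable borel" and \<epsilon>: "\<epsilon> > 0"
  shows "(\<integral>x. f x \<partial>lborel) = (\<integral>z. \<epsilon>\<^sup>2 * f (y - \<epsilon> *\<^sub>R z) \<partial>lborel)"
proof -
  have "(\<integral>x. f x \<partial>lborel) = (\<integral>x. f x \<partial>density (distr lborel borel (\<lambda>x. y + (- \<epsilon>) *\<^sub>R x)) (\<lambda>_. ennreal (\<bar>- \<epsilon>\<bar> ^ DIM(real ^ 2))))"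
    using \<epsilon> by (subst lborel_affine[of "- \<epsilon>" y]) auto
  also have "\<dots> = (\<integral>x. \<epsilon>\<^sup>2 * f x \<partial>distr lborel borel (\<lambda>x. y + (- \<epsilon>) *\<^sub>R x))"
    using \<epsilon> by (subst integral_density) auto
  also have "\<dots> = (\<integral>z. \<epsilon>\<^sup>2 * f (y + (- \<epsilon>) *\<^sub>R z) \<partial>lborel)"
    by (subst integral_distr) auto
  finally show ?thesis by simp
qed

text \<open>The mass of the approximate identity in the limit; it is not normalised, positivity is enough to divide by
it.\<close>
definition bump_mass :: "real \<Rightarrow> real" where
  "bump_mass d = cutoff d 0 0 * integral\<^sup>L lborel plane_bump"

lemma bump_mass_pos: "d > 0 \<Longrightarrow> bump_mass d > 0"
  using integral_plane_bump_pos by (simp add: bump_mass_def cutoff_def flat_exp_def)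

lemma approx_kernel_integral:
  fixes A :: "(real ^ 2) set"
  assumes [measurable]: "A \<in> sets borel"
  shows "(\<integral>x. indicator A x * approx_kernel d (eps n) (y - x) \<partial>lborel) =
         (\<integral>z. indicator A (y - eps n *\<^sub>R z) * (cutoff d 0 ((eps n)\<^sup>2 * (z \<bullet> z)) * plane_bump z) \<partial>lborel)"
proof -
  have "(\<integral>x. indicator A x * approx_kernel d (eps n) (y - x) \<partial>lborel) =
     (\<integral>z. (eps n)\<^sup>2 * (indicator A (y - eps n *\<^sub>R z) * approx_kernel d (eps n) (y - (y - eps n *\<^sub>R z))) \<partial>lborel)"
    by (rule integral_scale_shift[OF _ eps_pos(1)]) measurable
  also have "\<dots> = (\<integral>z. indicator A (y - eps n *\<^sub>R z) * ((eps n)\<^sup>2 * approx_kernel d (eps n) (eps n *\<^sub>R z)) \<partial>lborel)"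
    by (simp add: mult_ac)
  finally show ?thesis unfolding approx_kernel_scale[OF eps_pos(1)] .
qed

lemma approx_kernel_integral_bound:
  fixes A :: "(real ^ 2) set"
  assumes [measurable]: "A \<in> sets borel"
  shows "\<bar>\<integral>x. indicator A x * approx_kernel d (eps n) (y - x) \<partial>lborel\<bar> \<le> integral\<^sup>L lborel plane_bump"
proof -
  have pb: "plane_bump z \<ge> 0" for z by (simp add: plane_bump_def)
  have "\<bar>\<integral>z. indicator A (y - eps n *\<^sub>R z) * (cutoff d 0 ((eps n)\<^sup>2 * (z \<bullet> z)) * plane_bump z) \<partial>lborel\<bar> \<le>
     (\<integral>z. plane_bump z \<partial>lborel)"
  proof (rule integral_abs_bound_integral[OF _ integrable_plane_bump])
    have [measurable]: "plane_bump \<in> borel_measurable borel" unfolding plane_bump_def[abs_def] by simp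
    have le: "\<bar>indicator A (y - eps n *\<^sub>R z) * (cutoff d 0 ((eps n)\<^sup>2 * (z \<bullet> z)) * plane_bump z)\<bar> \<le> plane_bump z" for z
    proof -
      have "\<bar>cutoff d 0 ((eps n)\<^sup>2 * (z \<bullet> z)) * plane_bump z\<bar> \<le> 1 * plane_bump z"
        unfolding abs_mult using cutoff_0_bounds[of d "(eps n)\<^sup>2 * (z \<bullet> z)"] pb[of z] by (intro mult_mono) auto
      then show ?thesis using pb[of z] by (auto simp: indicator_def)
    qed
    then show "\<bar>indicator A (y - eps n *\<^sub>R z) * (cutoff d 0 ((eps n)\<^sup>2 * (z \<bullet> z)) * plane_bump z)\<bar> \<le> plane_bump z" for z .
    show "integrable lborel (\<lambda>z. indicator A (y - eps n *\<^sub>R z) * (cutoff d 0 ((eps n)\<^sup>2 * (z \<bullet> z)) * plane_bump z))"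
      by (rule Bochner_Integration.integrable_bound[OF integrable_plane_bump]) (use le pb in \<open>auto intro!: AE_I2\<close>)
  qed
  then show ?thesis unfolding approx_kernel_integral[OF assms] by simp
qed

text \<open>After rescaling, the integrand is dominated by the profile and converges pointwise: \<open>y - \<epsilon> z\<close> is
eventually on the same side of the boundary of \<open>A\<close> as \<open>y\<close>.\<close>
lemma approx_kernel_integral_tendsto:
  fixes A :: "(real ^ 2) set"
  assumes [measurable]: "A \<in> sets borel" and y: "y \<notin> frontier A"
  shows "(\<lambda>n. \<integral>x. indicator A x * approx_kernel d (eps n) (y - x) \<partial>lborel) \<longlonglongrightarrow> indicator A y * bump_mass d"
proof -
  have pb: "plane_bump z \<ge> 0" for z by (simp add: plane_bump_def)
  have [measurable]: "plane_bump \<in> borel_measurable borel" unfolding plane_bump_def[abs_def] by simp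
  have "(\<lambda>n. \<integral>z. indicator A (y - eps n *\<^sub>R z) * (cutoff d 0 ((eps n)\<^sup>2 * (z \<bullet> z)) * plane_bump z) \<partial>lborel)
     \<longlonglongrightarrow> (\<integral>z. indicator A y * (cutoff d 0 0 * plane_bump z) \<partial>lborel)"
  proof (rule integral_dominated_convergence[where w = plane_bump])
    show "AE z in lborel. norm (indicator A (y - eps n *\<^sub>R z) * (cutoff d 0 ((eps n)\<^sup>2 * (z \<bullet> z)) * plane_bump z)) \<le> plane_bump z" for n
    proof (rule AE_I2)
      fix z :: "real ^ 2"
      have "\<bar>cutoff d 0 ((eps n)\<^sup>2 * (z \<bullet> z)) * plane_bump z\<bar> \<le> 1 * plane_bump z"
        unfolding abs_mult using cutoff_0_bounds[of d "(eps n)\<^sup>2 * (z \<bullet> z)"] pb[of z] by (intro mult_mono) auto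
      then show "norm (indicator A (y - eps n *\<^sub>R z) * (cutoff d 0 ((eps n)\<^sup>2 * (z \<bullet> z)) * plane_bump z)) \<le> plane_bump z"
        using pb[of z] by (auto simp: indicator_def)
    qed
    show "AE z in lborel. (\<lambda>n. indicator A (y - eps n *\<^sub>R z) * (cutoff d 0 ((eps n)\<^sup>2 * (z \<bullet> z)) * plane_bump z))
       \<longlonglongrightarrow> indicator A y * (cutoff d 0 0 * plane_bump z)"
    proof (rule AE_I2)
      fix z :: "real ^ 2"
      have "(\<lambda>n. (eps n)\<^sup>2 * (z \<bullet> z)) \<longlonglongrightarrow> 0\<^sup>2 * (z \<bullet> z)" by (intro tendsto_intros eps_tendsto)
      then have "(\<lambda>n. (eps n)\<^sup>2 * (z \<bullet> z)) \<longlonglongrightarrow> 0" by simp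
      moreover have "isCont (cutoff d 0) 0" using cutoff_deriv DERIV_isCont by blast
      ultimately have c: "(\<lambda>n. cutoff d 0 ((eps n)\<^sup>2 * (z \<bullet> z))) \<longlonglongrightarrow> cutoff d 0 0"
        using isCont_tendsto_compose by blast
      have l: "(\<lambda>n. y - eps n *\<^sub>R z) \<longlonglongrightarrow> y"
        using tendsto_diff[OF tendsto_const tendsto_scaleR[OF eps_tendsto tendsto_const], of y z] by simp
      have "\<forall>\<^sub>F n in sequentially. indicator A y = (indicator A (y - eps n *\<^sub>R z) :: real)"
      proof (cases "y \<in> A")
        case True
        then have "y \<in> interior A" using y closure_subset by (auto simp: frontier_def)
        then have "\<forall>\<^sub>F n in sequentially. y - eps n *\<^sub>R z \<in> interior A" using l by (intro topological_tendstoD) auto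
        then show ?thesis by eventually_elim (use True interior_subset in \<open>auto simp: indicator_def\<close>)
      next
        case False
        then have "y \<in> - closure A" using y interior_subset by (auto simp: frontier_def)
        then have "\<forall>\<^sub>F n in sequentially. y - eps n *\<^sub>R z \<in> - closure A" using l by (intro topological_tendstoD) auto
        then show ?thesis by eventually_elim (use False closure_subset in \<open>auto simp: indicator_def\<close>)
      qed
      then have "(\<lambda>n. indicator A (y - eps n *\<^sub>R z)) \<longlonglongrightarrow> (indicator A y :: real)"
        by (rule Lim_transform_eventually[OF tendsto_const])
      then show "(\<lambda>n. indicator A (y - eps n *\<^sub>R z) * (cutoff d 0 ((eps n)\<^sup>2 * (z \<bullet> z)) * plane_bump z))
       \<longlonglongrightarrow> indicator A y * (cutoff d 0 0 * plane_bump z)"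
        by (intro tendsto_intros c)
    qed
    show "(\<lambda>z. indicator A (y - eps n *\<^sub>R z) * (cutoff d 0 ((eps n)\<^sup>2 * (z \<bullet> z)) * plane_bump z)) \<in> borel_measurable lborel" for n
      by measurable
    show "(\<lambda>z. indicator A y * (cutoff d 0 0 * plane_bump z)) \<in> borel_measurable lborel" by measurable
  qed (rule integrable_plane_bump)
  moreover have "(\<integral>z. indicator A y * (cutoff d 0 0 * plane_bump z) \<partial>lborel) = indicator A y * bump_mass d"
    by (simp add: bump_mass_def)
  ultimately show ?thesis unfolding approx_kernel_integral[OF assms(1)] by (simp only:)
qed

section \<open>Weyl's lemma for the Helmholtz equation\<close>

lemma integrable_mult_bounded:
  fixes U g :: "real ^ 2 \<Rightarrow> complex"
  assumes U: "integrable lborel U" and g[measurable]: "g \<in> borel_measurable borel" and b: "\<And>y. cmod (g y) \<le> C"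
  shows "integrable lborel (\<lambda>y. U y * g y)" and "cmod (\<integral>y. U y * g y \<partial>lborel) \<le> C * (\<integral>y. cmod (U y) \<partial>lborel)"
proof -
  have [measurable]: "U \<in> borel_measurable lborel" using U by simp
  have i: "integrable lborel (\<lambda>y. C * cmod (U y))" using U by simp
  have le: "cmod (U y * g y) \<le> C * cmod (U y)" for y
    using mult_left_mono[OF b[of y], of "cmod (U y)"] by (simp add: norm_mult mult.commute)
  show 1: "integrable lborel (\<lambda>y. U y * g y)"
    by (rule Bochner_Integration.integrable_bound[OF i]) (use le in \<open>auto intro!: AE_I2 order_trans[OF le]\<close>)
  have "cmod (\<integral>y. U y * g y \<partial>lborel) \<le> (\<integral>y. C * cmod (U y) \<partial>lborel)"
    by (rule Bochner_Integration.integral_norm_bound_integral[OF 1 i le])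
  then show "cmod (\<integral>y. U y * g y \<partial>lborel) \<le> C * (\<integral>y. cmod (U y) \<partial>lborel)" by simp
qed

lemma convolution_measurable [measurable]:
  fixes U g :: "real ^ 2 \<Rightarrow> complex"
  assumes [measurable]: "U \<in> borel_measurable borel" "g \<in> borel_measurable borel"
  shows "(\<lambda>x. \<integral>y. U y * g (y - x) \<partial>lborel) \<in> borel_measurable borel"
proof -
  have "(\<lambda>x. \<integral>y. U y * g (y - x) \<partial>lborel) \<in> borel_measurable lborel"
    by (rule lborel.borel_measurable_lebesgue_integral) measurable
  then show ?thesis by simp
qed

lemma Fubini_bounded_kernel:
  fixes U :: "real ^ 2 \<Rightarrow> complex" and g :: "real ^ 2 \<Rightarrow> real"
  assumes U: "integrable lborel U" and g[measurable]: "g \<in> borel_measurable borel" and b: "\<And>z. \<bar>g z\<bar> \<le> C"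
    and A[measurable]: "A \<in> sets borel" and Af: "emeasure lborel A < \<infinity>"
  shows "(\<integral>x. indicator A x *\<^sub>R (\<integral>y. U y * of_real (g (y - x)) \<partial>lborel) \<partial>lborel)
       = (\<integral>y. U y * of_real (\<integral>x. indicator A x * g (y - x) \<partial>lborel) \<partial>lborel)"
proof -
  have [measurable]: "U \<in> borel_measurable borel" using U by simp
  define f where "f = (\<lambda>x y. indicator A x *\<^sub>R (U y * complex_of_real (g (y - x))))"
  have C: "C \<ge> 0" using b[of 0] by linarith
  have iA: "integrable lborel (indicator A :: _ \<Rightarrow> real)" using Af by (simp add: integrable_indicator_iff)
  have int1: "integrable lborel (\<lambda>y. U y * complex_of_real (g (y - x)))" for x
    by (rule integrable_mult_bounded[OF U, where C = C]) (use b in auto)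
  have "integrable (lborel \<Otimes>\<^sub>M lborel) (case_prod f)"
  proof (rule lborel_pair.Fubini_integrable)
    show "case_prod f \<in> borel_measurable (lborel \<Otimes>\<^sub>M lborel)" unfolding f_def by measurable
    show "AE x in lborel. integrable lborel (\<lambda>y. case_prod f (x, y))"
      unfolding f_def using int1 by simp
    show "integrable lborel (\<lambda>x. \<integral>y. norm (case_prod f (x, y)) \<partial>lborel)"
    proof (rule Bochner_Integration.integrable_bound[where f = "\<lambda>x. indicator A x * (C * (\<integral>y. cmod (U y) \<partial>lborel))" and g = "\<lambda>x. \<integral>y. norm (case_prod f (x, y)) \<partial>lborel"])
      show "integrable lborel (\<lambda>x. indicator A x * (C * (\<integral>y. cmod (U y) \<partial>lborel)))" using iA by simp
      show "(\<lambda>x. \<integral>y. norm (case_prod f (x, y)) \<partial>lborel) \<in> borel_measurable lborel"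
        unfolding f_def by (rule lborel.borel_measurable_lebesgue_integral) measurable
      show "AE x in lborel. norm (\<integral>y. norm (case_prod f (x, y)) \<partial>lborel) \<le> norm (indicator A x * (C * (\<integral>y. cmod (U y) \<partial>lborel)))"
      proof (rule AE_I2)
        fix x :: "real ^ 2"
        have "(\<integral>y. norm (case_prod f (x, y)) \<partial>lborel) \<le> (\<integral>y. indicator A x * (C * cmod (U y)) \<partial>lborel)"
        proof (rule integral_mono)
          show "integrable lborel (\<lambda>y. norm (case_prod f (x, y)))" unfolding f_def using int1 by simp
          show "integrable lborel (\<lambda>y. indicator A x * (C * cmod (U y)))" using U by simp
          show "norm (case_prod f (x, y)) \<le> indicator A x * (C * cmod (U y))" for y
            using mult_right_mono[OF b[of "y - x"], of "cmod (U y)"] by (simp add: f_def norm_mult indicator_def mult.commute)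
        qed
        moreover have "(\<integral>y. norm (case_prod f (x, y)) \<partial>lborel) \<ge> 0" by (rule Bochner_Integration.integral_nonneg) simp
        ultimately show "norm (\<integral>y. norm (case_prod f (x, y)) \<partial>lborel) \<le> norm (indicator A x * (C * (\<integral>y. cmod (U y) \<partial>lborel)))"
          by simp
      qed
    qed
  qed
  from lborel_pair.Fubini_integral[OF this]
  have "(\<integral>x. (\<integral>y. f x y \<partial>lborel) \<partial>lborel) = (\<integral>y. (\<integral>x. f x y \<partial>lborel) \<partial>lborel)" by simp
  moreover have "(\<integral>y. f x y \<partial>lborel) = indicator A x *\<^sub>R (\<integral>y. U y * of_real (g (y - x)) \<partial>lborel)" for x
    unfolding f_def by simp
  moreover have "(\<integral>x. f x y \<partial>lborel) = U y * of_real (\<integral>x. indicator A x * g (y - x) \<partial>lborel)" for y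
  proof -
    have "f x y = U y * of_real (indicator A x * g (y - x))" for x
      by (simp add: f_def scaleR_conv_of_real)
    then show ?thesis by (simp only: integral_mult_right_zero integral_complex_of_real)
  qed
  ultimately show ?thesis by simp
qed

text \<open>The hypothesis \<open>eq\<close> says that \<open>U\<close> convolved with the approximate identity equals minus \<open>U\<close> convolved with the
remainder. Integrating over \<open>A\<close> first makes the limit elementary: by Fubini's theorem the approximate
identity acts on the indicator of \<open>A\<close>, where it converges pointwise off the boundary, rather than on \<open>U\<close>,
which is merely integrable.\<close>
lemma box_identity:
  fixes U :: "real ^ 2 \<Rightarrow> complex"
  assumes U: "integrable lborel U" and d: "d > 0"
    and A[measurable]: "A \<in> sets borel" and Af: "emeasure lborel A < \<infinity>" and fr: "AE y in lborel. y \<notin> frontier A"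
    and eq: "\<And>x n. x \<in> A \<Longrightarrow> (\<integral>y. U y * (of_real (approx_kernel d (eps n) (y - x)) + approx_remainder k d (eps n) (y - x)) \<partial>lborel) = 0"
  shows "(\<integral>x. indicator A x *\<^sub>R (of_real (bump_mass d) * U x + (\<integral>y. U y * limit_remainder k d (y - x) \<partial>lborel)) \<partial>lborel) = 0"
proof -
  have [measurable]: "U \<in> borel_measurable borel" using U by simp
  have iA: "integrable lborel (indicator A :: _ \<Rightarrow> real)" using Af by (simp add: integrable_indicator_iff)
  obtain C where C: "C \<ge> 0" "\<And>\<epsilon> z. 0 < \<epsilon> \<Longrightarrow> \<epsilon> \<le> 1 \<Longrightarrow> cmod (approx_remainder k d \<epsilon> z) \<le> C" "\<And>z. cmod (limit_remainder k d z) \<le> C"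
    using approx_remainder_bounded[OF d, of k] by blast
  define L where "L = (\<integral>y. cmod (U y) \<partial>lborel)"
  define R where "R n x = (\<integral>y. U y * approx_remainder k d (eps n) (y - x) \<partial>lborel)" for n x
  define S where "S x = (\<integral>y. U y * limit_remainder k d (y - x) \<partial>lborel)" for x
  define G where "G n x = (\<integral>y. U y * of_real (approx_kernel d (eps n) (y - x)) \<partial>lborel)" for n x
  have [measurable]: "R n \<in> borel_measurable borel" "S \<in> borel_measurable borel" "G n \<in> borel_measurable borel" for n
    unfolding R_def[abs_def] S_def[abs_def] G_def[abs_def] by (rule convolution_measurable; measurable)+
  have iR: "integrable lborel (\<lambda>y. U y * approx_remainder k d (eps n) (y - x))" and bR: "cmod (R n x) \<le> C * L" for n x
    unfolding R_def L_def by (rule integrable_mult_bounded[OF U, where C = C]; use C eps_pos in simp)+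
  have bS: "cmod (S x) \<le> C * L" for x
    unfolding S_def L_def by (rule integrable_mult_bounded[OF U, where C = C]; use C in simp)
  have Gb: "\<bar>approx_kernel d (eps n) z\<bar> \<le> 2 / (eps n)\<^sup>2" for n z
  proof -
    let ?e = "(eps n)\<^sup>2"
    have e: "?e > 0" using eps_pos(1)[of n] by simp
    have "?e * ?e \<le> (z \<bullet> z + ?e) * (z \<bullet> z + ?e)" using e by (intro mult_mono) auto
    then have "2 * ?e / (z \<bullet> z + ?e)\<^sup>2 \<le> 2 * ?e / (?e * ?e)"
      using e by (intro divide_left_mono) (auto simp: power2_eq_square[of "z \<bullet> z + ?e"] intro!: mult_pos_pos add_nonneg_pos)
    moreover have "2 * e / (e * e) = 2 / e" if "e > 0" for e :: real using that by simp
    ultimately have le: "2 * ?e / (z \<bullet> z + ?e)\<^sup>2 \<le> 2 / ?e" using e by metis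
    have "\<bar>approx_kernel d (eps n) z\<bar> = cutoff d 0 (z \<bullet> z) * (2 * ?e / (z \<bullet> z + ?e)\<^sup>2)"
      unfolding approx_kernel_def using cutoff_0_bounds[of d "z \<bullet> z"] e by (intro abs_of_nonneg mult_nonneg_nonneg) auto
    also have "\<dots> \<le> 1 * (2 / ?e)" using cutoff_0_bounds[of d "z \<bullet> z"] e le by (intro mult_mono) auto
    finally show ?thesis by simp
  qed
  have iG: "integrable lborel (\<lambda>y. U y * of_real (approx_kernel d (eps n) (y - x)))" for n x
    by (rule integrable_mult_bounded[OF U, where C = "2 / (eps n)\<^sup>2"]) (use Gb in auto)
  have GR: "G n x = - R n x" if "x \<in> A" for n x
  proof -
    have "G n x + R n x = (\<integral>y. U y * of_real (approx_kernel d (eps n) (y - x)) + U y * approx_remainder k d (eps n) (y - x) \<partial>lborel)"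
      unfolding G_def R_def by (rule Bochner_Integration.integral_add[OF iG iR, symmetric])
    also have "\<dots> = 0" using eq[OF that, of n] by (simp add: distrib_left)
    finally show ?thesis by (simp add: eq_neg_iff_add_eq_0)
  qed
  have RS: "(\<lambda>n. R n x) \<longlonglongrightarrow> S x" for x
    unfolding R_def S_def
  proof (rule integral_dominated_convergence[where w = "\<lambda>y. C * cmod (U y)"])
    show "integrable lborel (\<lambda>y. C * cmod (U y))" using U by simp
    show "AE y in lborel. (\<lambda>n. U y * approx_remainder k d (eps n) (y - x)) \<longlonglongrightarrow> U y * limit_remainder k d (y - x)"
      using AE_lborel_singleton[of x]
    proof eventually_elim
      case (elim y)
      then show ?case by (intro tendsto_mult tendsto_const approx_remainder_tendsto) simp
    qed
    show "AE y in lborel. norm (U y * approx_remainder k d (eps n) (y - x)) \<le> C * cmod (U y)" for n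
    proof (rule AE_I2)
      show "norm (U y * approx_remainder k d (eps n) (y - x)) \<le> C * cmod (U y)" for y
        using mult_right_mono[OF C(2)[OF eps_pos, of n "y - x"], of "cmod (U y)"] by (simp add: norm_mult mult.commute)
    qed
  qed measurable
  have 1: "(\<lambda>n. \<integral>x. indicator A x *\<^sub>R R n x \<partial>lborel) \<longlonglongrightarrow> (\<integral>x. indicator A x *\<^sub>R S x \<partial>lborel)"
  proof (rule integral_dominated_convergence[where w = "\<lambda>x. indicator A x * (C * L)"])
    show "integrable lborel (\<lambda>x. indicator A x * (C * L))" using iA by simp
    show "AE x in lborel. (\<lambda>n. indicator A x *\<^sub>R R n x) \<longlonglongrightarrow> indicator A x *\<^sub>R S x"
      by (intro AE_I2 tendsto_scaleR tendsto_const RS)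
    show "AE x in lborel. norm (indicator A x *\<^sub>R R n x) \<le> indicator A x * (C * L)" for n
      using bR by (intro AE_I2) (simp add: indicator_def)
  qed measurable
  have 2: "(\<lambda>n. \<integral>x. indicator A x *\<^sub>R G n x \<partial>lborel) \<longlonglongrightarrow> (\<integral>y. U y * of_real (indicator A y * bump_mass d) \<partial>lborel)"
  proof -
    have "(\<integral>x. indicator A x *\<^sub>R G n x \<partial>lborel) = (\<integral>y. U y * of_real (\<integral>x. indicator A x * approx_kernel d (eps n) (y - x) \<partial>lborel) \<partial>lborel)" for n
      unfolding G_def by (rule Fubini_bounded_kernel[OF U _ Gb A Af]) measurable
    moreover have "(\<lambda>n. \<integral>y. U y * of_real (\<integral>x. indicator A x * approx_kernel d (eps n) (y - x) \<partial>lborel) \<partial>lborel)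
       \<longlonglongrightarrow> (\<integral>y. U y * of_real (indicator A y * bump_mass d) \<partial>lborel)"
    proof (rule integral_dominated_convergence[where w = "\<lambda>y. integral\<^sup>L lborel plane_bump * cmod (U y)"])
      show "integrable lborel (\<lambda>y. integral\<^sup>L lborel plane_bump * cmod (U y))" using U by simp
      show "AE y in lborel. (\<lambda>n. U y * of_real (\<integral>x. indicator A x * approx_kernel d (eps n) (y - x) \<partial>lborel))
         \<longlonglongrightarrow> U y * of_real (indicator A y * bump_mass d)"
        using fr
      proof eventually_elim
        case (elim y)
        then show ?case by (intro tendsto_mult tendsto_const tendsto_of_real approx_kernel_integral_tendsto A)
      qed
      show "AE y in lborel. norm (U y * of_real (\<integral>x. indicator A x * approx_kernel d (eps n) (y - x) \<partial>lborel))
         \<le> integral\<^sup>L lborel plane_bump * cmod (U y)" for n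
      proof (rule AE_I2)
        show "norm (U y * of_real (\<integral>x. indicator A x * approx_kernel d (eps n) (y - x) \<partial>lborel))
          \<le> integral\<^sup>L lborel plane_bump * cmod (U y)" for y
          using mult_right_mono[OF approx_kernel_integral_bound[OF A, of d n y], of "cmod (U y)"] by (simp add: norm_mult mult.commute)
      qed
      show "(\<lambda>y. U y * of_real (\<integral>x. indicator A x * approx_kernel d (eps n) (y - x) \<partial>lborel)) \<in> borel_measurable lborel" for n
      proof -
        have "(\<lambda>y. \<integral>x. indicator A x * approx_kernel d (eps n) (y - x) \<partial>lborel) \<in> borel_measurable lborel"
          by (rule lborel.borel_measurable_lebesgue_integral) measurable
        then show ?thesis by measurable
      qed
    qed measurable
    ultimately show ?thesis by simp
  qed
  have "(\<integral>x. indicator A x *\<^sub>R G n x \<partial>lborel) = - (\<integral>x. indicator A x *\<^sub>R R n x \<partial>lborel)" for n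
  proof -
    have "indicator A x *\<^sub>R G n x = - (indicator A x *\<^sub>R R n x)" for x
      using GR[of x n] by (auto simp: indicator_def)
    then show ?thesis by simp
  qed
  then have "(\<lambda>n. - (\<integral>x. indicator A x *\<^sub>R R n x \<partial>lborel)) \<longlonglongrightarrow> (\<integral>y. U y * of_real (indicator A y * bump_mass d) \<partial>lborel)"
    using 2 by simp
  from LIMSEQ_unique[OF this tendsto_minus[OF 1]]
  have 3: "(\<integral>y. U y * of_real (indicator A y * bump_mass d) \<partial>lborel) + (\<integral>x. indicator A x *\<^sub>R S x \<partial>lborel) = 0" by simp
  have i1: "integrable lborel (\<lambda>y. U y * of_real (indicator A y * bump_mass d))"
    by (rule integrable_mult_bounded[OF U, where C = "\<bar>bump_mass d\<bar>"]) (auto simp: indicator_def norm_mult)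
  have i2: "integrable lborel (\<lambda>x. indicator A x *\<^sub>R S x)"
  proof (rule Bochner_Integration.integrable_bound[where f = "\<lambda>x. indicator A x * (C * L)" and g = "\<lambda>x. indicator A x *\<^sub>R S x"])
    show "integrable lborel (\<lambda>x. indicator A x * (C * L))" using iA by simp
    show "AE x in lborel. norm (indicator A x *\<^sub>R S x) \<le> norm (indicator A x * (C * L))"
    proof (rule AE_I2)
      show "norm (indicator A x *\<^sub>R S x) \<le> norm (indicator A x * (C * L))" for x
        using bS[of x] by (auto simp: indicator_def)
    qed
  qed measurable
  have "indicator A x *\<^sub>R (of_real (bump_mass d) * U x + S x) = U x * of_real (indicator A x * bump_mass d) + indicator A x *\<^sub>R S x" for x
    by (simp add: indicator_def mult.commute)
  then show ?thesis using 3 Bochner_Integration.integral_add[OF i1 i2] unfolding S_def[symmetric] by simp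
qed

text \<open>Boxes form a generator of the Borel sets that is stable under intersection, and the sets on which the
integral of \<open>f\<close> vanishes are closed under complements and disjoint unions, thanks to \<open>tot\<close> for the complements.\<close>
lemma AE_zero_of_box_integrals:
  fixes f :: "real ^ 2 \<Rightarrow> complex"
  assumes f: "integrable lborel f" and tot: "integral\<^sup>L lborel f = 0"
    and box: "\<And>a b. (\<integral>x. indicator (box a b) x *\<^sub>R f x \<partial>lborel) = 0"
  shows "AE x in lborel. f x = 0"
proof (rule sigma_finite_measure.density_zero[OF sigma_finite_lborel f])
  fix A :: "(real ^ 2) set" assume "A \<in> sets lborel"
  then have A: "A \<in> sigma_sets UNIV (range (\<lambda>(a, b). box a b))"
    by (simp add: borel_eq_box)
  have si: "set_integrable lborel B f" if "B \<in> sets borel" for B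
    using f that unfolding set_integrable_def by (simp add: integrable_mult_indicator)
  have sb: "B \<in> sets borel" if "B \<in> sigma_sets UNIV (range (\<lambda>(a, b). box a b :: (real ^ 2) set))" for B
    using that by (simp add: borel_eq_box)
  have st: "Int_stable (range (\<lambda>(a, b). box a b :: (real ^ 2) set))"
  proof (rule Int_stableI)
    fix a b :: "(real ^ 2) set" assume "a \<in> range (\<lambda>(a, b). box a b)" "b \<in> range (\<lambda>(a, b). box a b)"
    then obtain p q r s where "a = box p q" "b = box r s" by auto
    then show "a \<inter> b \<in> range (\<lambda>(a, b). box a b)" by (auto simp: box_Int_box)
  qed
  show "set_lebesgue_integral lborel A f = 0"
    using st subset_UNIV[of "range (\<lambda>(a, b). box a b :: (real ^ 2) set)", folded Pow_UNIV] A
  proof (induction A rule: sigma_sets_induct_disjoint)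
    case (basic B)
    then obtain a b where "B = box a b" by auto
    then show ?case using box[of a b] by (simp add: set_lebesgue_integral_def)
  next
    case empty then show ?case by (simp add: set_lebesgue_integral_def)
  next
    case (compl B)
    have "set_lebesgue_integral lborel (UNIV - B) f = integral\<^sup>L lborel f - set_lebesgue_integral lborel B f"
    proof -
      have "indicator (UNIV - B) x *\<^sub>R f x = f x - indicator B x *\<^sub>R f x" for x by (simp add: indicator_def)
      then show ?thesis using si[OF sb[OF compl(1)]] f unfolding set_lebesgue_integral_def set_integrable_def by simp
    qed
    then show ?case using compl tot by simp
  next
    case (union B)
    have Bm: "B i \<in> sets borel" for i using union(2) sb by blast
    then have "(\<Union>i. B i) \<in> sets borel" by blast
    then have "set_lebesgue_integral lborel (\<Union>i. B i) f = (\<Sum>i. set_lebesgue_integral lborel (B i) f)"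
      using union by (intro lebesgue_integral_countable_add si) (auto simp: disjoint_family_on_def Bm)
    then show ?case using union by simp
  qed
qed

definition C1_on :: "(real ^ 2) set \<Rightarrow> (real ^ 2 \<Rightarrow> complex) \<Rightarrow> bool" where
  "C1_on S f \<longleftrightarrow> (\<exists>D. (\<forall>z\<in>S. (f has_derivative D z) (at z)) \<and> (\<forall>h. continuous_on S (\<lambda>z. D z h)))"

lemma C1_on_continuous: "C1_on S f \<Longrightarrow> continuous_on S f"
  unfolding C1_on_def by (blast intro: continuous_at_imp_continuous_on has_derivative_continuous)

lemma C1_on_subset: "C1_on S f \<Longrightarrow> T \<subseteq> S \<Longrightarrow> C1_on T f"
  unfolding C1_on_def by (meson continuous_on_subset subsetD)

lemma C1_on_const: "C1_on S (\<lambda>z. c)"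
  unfolding C1_on_def by (intro exI[of _ "\<lambda>z h. 0"]) auto

lemma C1_on_add:
  assumes "C1_on S f" "C1_on S g" shows "C1_on S (\<lambda>z. f z + g z)"
proof -
  obtain D E where D: "\<And>z. z \<in> S \<Longrightarrow> (f has_derivative D z) (at z)" "\<And>h. continuous_on S (\<lambda>z. D z h)"
    and E: "\<And>z. z \<in> S \<Longrightarrow> (g has_derivative E z) (at z)" "\<And>h. continuous_on S (\<lambda>z. E z h)"
    using assms unfolding C1_on_def by blast
  show ?thesis unfolding C1_on_def
    by (intro exI[of _ "\<lambda>z h. D z h + E z h"] conjI ballI allI has_derivative_add continuous_on_add D E)
qed

lemma C1_on_mult:
  assumes "C1_on S f" "C1_on S g" shows "C1_on S (\<lambda>z. f z * g z)"
proof -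
  obtain D E where D: "\<And>z. z \<in> S \<Longrightarrow> (f has_derivative D z) (at z)" "\<And>h. continuous_on S (\<lambda>z. D z h)"
    and E: "\<And>z. z \<in> S \<Longrightarrow> (g has_derivative E z) (at z)" "\<And>h. continuous_on S (\<lambda>z. E z h)"
    using assms unfolding C1_on_def by blast
  show ?thesis unfolding C1_on_def
    by (intro exI[of _ "\<lambda>z h. f z * E z h + D z h * g z"] conjI ballI allI has_derivative_mult continuous_on_add continuous_on_mult
        C1_on_continuous assms D E)
qed

lemma C1_on_radial:
  assumes g: "\<And>q. (g has_real_derivative g' q) (at q)" and g': "continuous_on UNIV g'"
  shows "C1_on S (\<lambda>z. complex_of_real (g (z \<bullet> z)))"
  unfolding C1_on_def
proof (intro exI conjI ballI allI)
  fix z :: "real ^ 2"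
  have "((\<lambda>z. z \<bullet> z) has_derivative (\<lambda>h. 2 * (z \<bullet> h))) (at z)"
    using sqdist_deriv[of 0 z] by simp
  from has_derivative_of_real[OF has_derivative_compose[OF this g[unfolded has_field_derivative_def]]]
  show "((\<lambda>z. complex_of_real (g (z \<bullet> z))) has_derivative (\<lambda>h. of_real (g' (z \<bullet> z) * (2 * (z \<bullet> h))))) (at z)" .
next
  fix h :: "real ^ 2"
  show "continuous_on S (\<lambda>z. complex_of_real (g' (z \<bullet> z) * (2 * (z \<bullet> h))))"
    by (intro continuous_intros continuous_on_compose2[OF g']) auto
qed

lemma abs_mult_ln_le_sqrt: "0 \<le> r \<Longrightarrow> \<bar>r * ln r\<bar> \<le> 2 * sqrt r * (1 + r)"
proof -
  assume r: "0 \<le> r"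
  define s where "s = sqrt r"
  have s: "0 \<le> s" "r = s * s" using r by (auto simp: s_def)
  have "r * ln r = 2 * s * (s * ln s)"
  proof (cases "s = 0")
    case False
    then have "ln r = 2 * ln s" using s by (simp add: ln_mult)
    then show ?thesis by (simp add: s)
  qed (simp add: s)
  then have "\<bar>r * ln r\<bar> = \<bar>2 * s\<bar> * \<bar>s * ln s\<bar>" by (simp only: abs_mult)
  then have "\<bar>r * ln r\<bar> = 2 * s * \<bar>s * ln s\<bar>" using s(1) by simp
  also have "\<dots> \<le> 2 * s * (1 + s\<^sup>2)" using s by (intro mult_left_mono abs_mult_ln_le) auto
  finally have le: "\<bar>r * ln r\<bar> \<le> 2 * s * (1 + s\<^sup>2)" .
  have "s\<^sup>2 = r" using s(2) by (simp only: power2_eq_square)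
  with le show ?thesis by (simp only: s_def)
qed

text \<open>The logarithmic singularity of the gradient \<open>2 (ln \<bar>z\<bar>\<^sup>2 + 1) z\<close> is beaten by the factor \<open>z\<close>, since
\<open>r * ln r\<close> is \<open>O(sqrt r)\<close> near \<open>0\<close>.\<close>
lemma C1_on_sq_ln: "C1_on S (\<lambda>z. complex_of_real (z \<bullet> z * ln (z \<bullet> z)))"
proof -
  define D where "D = (\<lambda>(z :: real ^ 2) h. complex_of_real ((ln (z \<bullet> z) + 1) * (2 * (z \<bullet> h))))"
  have small: "(\<lambda>z :: real ^ 2. 4 * sqrt (norm z) * (1 + norm z)) \<midarrow>0\<rightarrow> 0"
  proof -
    have "(\<lambda>z :: real ^ 2. 4 * sqrt (norm z) * (1 + norm z)) \<midarrow>0\<rightarrow> 4 * sqrt (norm (0 :: real ^ 2)) * (1 + norm (0 :: real ^ 2))"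
      by (intro tendsto_intros)
    then show ?thesis by simp
  qed
  have ln2: "\<bar>norm z * ln (z \<bullet> z)\<bar> \<le> 4 * sqrt (norm z) * (1 + norm z)" for z :: "real ^ 2"
  proof (cases "z = 0")
    case False
    then have "ln (z \<bullet> z) = 2 * ln (norm z)" by (simp add: dot_square_norm ln_realpow)
    then show ?thesis using abs_mult_ln_le_sqrt[of "norm z"] by (simp add: abs_mult)
  qed simp
  have der: "((\<lambda>z. complex_of_real (z \<bullet> z * ln (z \<bullet> z))) has_derivative D z) (at z)" for z
  proof (cases "z = 0")
    case False
    have g: "((\<lambda>q. q * ln q) has_real_derivative ln (z \<bullet> z) + 1) (at (z \<bullet> z))"
      using False by (auto intro!: derivative_eq_intros)
    have "((\<lambda>z. z \<bullet> z) has_derivative (\<lambda>h. 2 * (z \<bullet> h))) (at z)"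
      using sqdist_deriv[of 0 z] by simp
    from has_derivative_of_real[OF has_derivative_compose[OF this g[unfolded has_field_derivative_def]]]
    show ?thesis unfolding D_def .
  next
    case True
    have "((\<lambda>h :: real ^ 2. norm (complex_of_real (h \<bullet> h * ln (h \<bullet> h))) / norm h) \<longlongrightarrow> 0) (at 0)"
    proof (rule Lim_null_comparison[OF _ small], rule always_eventually, rule allI)
      fix h :: "real ^ 2"
      have "norm (complex_of_real (h \<bullet> h * ln (h \<bullet> h))) / norm h = \<bar>norm h * ln (h \<bullet> h)\<bar>"
        by (simp add: dot_square_norm abs_mult power2_eq_square norm_mult)
      then show "norm (norm (complex_of_real (h \<bullet> h * ln (h \<bullet> h))) / norm h) \<le> 4 * sqrt (norm h) * (1 + norm h)"
        using ln2[of h] by simp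
    qed
    moreover have "bounded_linear (D 0)" by (simp add: D_def)
    ultimately show ?thesis using True by (simp add: has_derivative_at D_def)
  qed
  have cont: "continuous_on UNIV (\<lambda>z. D z h)" for h
  proof (rule continuous_at_imp_continuous_on, rule ballI)
    fix z :: "real ^ 2"
    show "isCont (\<lambda>z. D z h) z"
    proof (cases "z = 0")
      case False
      then show ?thesis unfolding D_def by (intro continuous_intros) auto
    next
      case True
      have "(\<lambda>z. D z h) \<midarrow>0\<rightarrow> 0"
      proof (rule Lim_null_comparison)
        show "\<forall>\<^sub>F z in at 0. norm (D z h) \<le> 2 * norm h * (4 * sqrt (norm z) * (1 + norm z) + norm z)"
        proof (rule always_eventually, rule allI)
          fix z :: "real ^ 2"
          have "norm (D z h) = 2 * \<bar>ln (z \<bullet> z) + 1\<bar> * \<bar>z \<bullet> h\<bar>" unfolding D_def norm_of_real abs_mult by simp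
          also have "\<dots> \<le> 2 * \<bar>ln (z \<bullet> z) + 1\<bar> * (norm z * norm h)" by (intro mult_left_mono Cauchy_Schwarz_ineq2) auto
          also have "\<dots> = 2 * norm h * \<bar>norm z * ln (z \<bullet> z) + norm z\<bar>"
          proof -
            have "\<bar>norm z * ln (z \<bullet> z) + norm z\<bar> = norm z * \<bar>ln (z \<bullet> z) + 1\<bar>"
              using abs_mult[of "norm z" "ln (z \<bullet> z) + 1"] by (simp add: distrib_left)
            then show ?thesis by simp
          qed
          also have "\<dots> \<le> 2 * norm h * (4 * sqrt (norm z) * (1 + norm z) + norm z)"
          proof (rule mult_left_mono)
            have "\<bar>norm z * ln (z \<bullet> z) + norm z\<bar> \<le> \<bar>norm z * ln (z \<bullet> z)\<bar> + norm z"
              by (rule order_trans[OF abs_triangle_ineq]) simp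
            then show "\<bar>norm z * ln (z \<bullet> z) + norm z\<bar> \<le> 4 * sqrt (norm z) * (1 + norm z) + norm z"
              using ln2[of z] by linarith
          qed simp
          finally show "norm (D z h) \<le> 2 * norm h * (4 * sqrt (norm z) * (1 + norm z) + norm z)" .
        qed
        have "(\<lambda>z :: real ^ 2. 2 * norm h * (4 * sqrt (norm z) * (1 + norm z) + norm z)) \<midarrow>0\<rightarrow> 2 * norm h * (0 + norm (0 :: real ^ 2))"
          by (intro tendsto_mult tendsto_const tendsto_add small tendsto_norm tendsto_ident_at)
        then show "(\<lambda>z :: real ^ 2. 2 * norm h * (4 * sqrt (norm z) * (1 + norm z) + norm z)) \<midarrow>0\<rightarrow> 0" by simp
      qed
      moreover have "D 0 h = 0" by (simp add: D_def)
      ultimately show ?thesis using True by (simp add: isCont_def)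
    qed
  qed
  show ?thesis unfolding C1_on_def
    using der continuous_on_subset[OF cont subset_UNIV] by (intro exI[of _ D] conjI ballI allI)
qed

text \<open>With \<open>e = 0\<close> and \<open>u = 1\<close> only products of cutoffs, of \<open>\<bar>z\<bar>\<^sup>2\<close> and of \<open>\<bar>z\<bar>\<^sup>2 * ln \<bar>z\<bar>\<^sup>2\<close> are left.\<close>
lemma C1_on_limit_remainder: "C1_on S (limit_remainder k d)"
proof -
  have c: "C1_on S (\<lambda>z. complex_of_real (cutoff d n (z \<bullet> z)))" for n
    by (rule C1_on_radial[OF cutoff_deriv]) (auto simp: divide_inverse intro!: continuous_intros)
  have q: "C1_on S (\<lambda>z. complex_of_real (z \<bullet> z))"
    by (rule C1_on_radial[where g = "\<lambda>q. q" and g' = "\<lambda>q. 1"]) auto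
  define C0 C2 C3 C4 Q W where "C0 = (\<lambda>z :: real ^ 2. complex_of_real (cutoff d 0 (z \<bullet> z)))"
    and "C2 = (\<lambda>z :: real ^ 2. complex_of_real (cutoff d 2 (z \<bullet> z)))"
    and "C3 = (\<lambda>z :: real ^ 2. complex_of_real (cutoff d 3 (z \<bullet> z)))"
    and "C4 = (\<lambda>z :: real ^ 2. complex_of_real (cutoff d 4 (z \<bullet> z)))"
    and "Q = (\<lambda>z :: real ^ 2. complex_of_real (z \<bullet> z))"
    and "W = (\<lambda>z :: real ^ 2. complex_of_real (z \<bullet> z * ln (z \<bullet> z)))"
  note defs = C0_def C2_def C3_def C4_def Q_def W_def
  have "C1_on S (\<lambda>z. C0 z * (- k\<^sup>2 + (- (k ^ 4 / 8)) * W z)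
     + (- of_real (16 / d ^ 4)) * C2 z * ((1 / 2) * Q z + (- (k\<^sup>2 / 8)) * (Q z * (W z + Q z)))
     + (of_real (- 16 / d ^ 4) * C2 z + of_real (16 / d ^ 8) * (Q z * Q z) * (C4 z + (- 2) * C3 z))
        * ((1 / 2) * W z + (- (k\<^sup>2 / 8)) * (Q z * W z)))"
    unfolding defs by (intro C1_on_add C1_on_mult C1_on_const c q C1_on_sq_ln)
  moreover have "C0 z * (- k\<^sup>2 + (- (k ^ 4 / 8)) * W z)
     + (- of_real (16 / d ^ 4)) * C2 z * ((1 / 2) * Q z + (- (k\<^sup>2 / 8)) * (Q z * (W z + Q z)))
     + (of_real (- 16 / d ^ 4) * C2 z + of_real (16 / d ^ 8) * (Q z * Q z) * (C4 z + (- 2) * C3 z))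
        * ((1 / 2) * W z + (- (k\<^sup>2 / 8)) * (Q z * W z)) = limit_remainder k d z" for z
    unfolding limit_remainder_def remainder_def defs by (simp add: power2_eq_square)
  ultimately show ?thesis by (simp only:)
qed

lemma compact_support_deriv_bounded:
  fixes T :: "real ^ 2 \<Rightarrow> complex"
  assumes D: "\<And>z. (T has_derivative D z) (at z)" "\<And>h. continuous_on UNIV (\<lambda>z. D z h)"
    and supp: "\<And>z. norm z \<ge> d \<Longrightarrow> T z = 0"
  shows "\<exists>M\<ge>0. \<forall>z h. cmod (D z h) \<le> M * norm h"
proof -
  have far: "D z h = 0" if "norm z > d" for z h
  proof -
    have o: "open {z :: real ^ 2. norm z > d}" by (intro open_Collect_less continuous_intros)
    have "((\<lambda>z. 0 :: complex) has_derivative (\<lambda>h. 0)) (at z)" by simp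
    then have "(T has_derivative (\<lambda>h. 0)) (at z)"
      by (rule has_derivative_transform_within_open[OF _ o]) (use that supp in auto)
    then show ?thesis using has_derivative_unique[OF D(1)[of z]] by metis
  qed
  have "\<exists>M\<ge>0. \<forall>z. cmod (D z (axis i 1)) \<le> M" for i
  proof -
    have "bounded ((\<lambda>z. D z (axis i 1)) ` cball 0 d)"
      by (intro compact_imp_bounded compact_continuous_image continuous_on_subset[OF D(2)]) auto
    then obtain M where M: "\<And>y. y \<in> (\<lambda>z. D z (axis i 1)) ` cball 0 d \<Longrightarrow> norm y \<le> M" unfolding bounded_iff by blast
    have "cmod (D z (axis i 1)) \<le> \<bar>M\<bar>" for z
    proof (cases "norm z \<le> d")
      case True
      then have "cmod (D z (axis i 1)) \<le> M" by (intro M imageI) simp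
      then show ?thesis by simp
    qed (use far[of z] in simp)
    then show ?thesis by (intro exI[of _ "\<bar>M\<bar>"]) auto
  qed
  then obtain M where M: "\<And>i. M i \<ge> 0" "\<And>i z. cmod (D z (axis i 1)) \<le> M i" by metis
  have "cmod (D z h) \<le> (M 1 + M 2) * norm h" for z h
  proof -
    have h: "h = h $ 1 *\<^sub>R axis 1 1 + h $ 2 *\<^sub>R axis 2 1"
      by (simp add: vec_eq_iff forall_2 axis_def)
    have lin: "linear (D z)" using D(1) by (rule has_derivative_linear)
    have "D z h = h $ 1 *\<^sub>R D z (axis 1 1) + h $ 2 *\<^sub>R D z (axis 2 1)"
      by (subst h) (simp only: linear_add[OF lin] linear_scale[OF lin])
    also have "cmod \<dots> \<le> \<bar>h $ 1\<bar> * cmod (D z (axis 1 1)) + \<bar>h $ 2\<bar> * cmod (D z (axis 2 1))"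
      by (rule order_trans[OF norm_triangle_ineq]) simp
    also have "\<dots> \<le> norm h * M 1 + norm h * M 2"
      by (intro add_mono mult_mono M component_le_norm_cart) auto
    finally show ?thesis by (simp add: algebra_simps)
  qed
  then show ?thesis using M(1) by (intro exI[of _ "M 1 + M 2"]) auto
qed

text \<open>Differentiation under the integral: the difference quotients of \<open>T\<close> are bounded by a Lipschitz
constant, which compact support provides, and \<open>U\<close> is integrable. The derivative is a convolution of \<open>U\<close> with
a bounded continuous function, hence continuous in \<open>x\<close>.\<close>
lemma convolution_C1:
  fixes U T :: "real ^ 2 \<Rightarrow> complex"
  assumes U: "integrable lborel U" and T: "C1_on UNIV T" and supp: "\<And>z. norm z \<ge> d \<Longrightarrow> T z = 0" and bT: "\<And>z. cmod (T z) \<le> B"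
  shows "C1_on S (\<lambda>x. \<integral>y. U y * T (y - x) \<partial>lborel)"
proof -
  obtain D where D: "\<And>z. (T has_derivative D z) (at z)" "\<And>h. continuous_on UNIV (\<lambda>z. D z h)"
    using T unfolding C1_on_def by auto
  obtain M where M: "M \<ge> 0" "\<And>z h. cmod (D z h) \<le> M * norm h"
    using compact_support_deriv_bounded[OF D supp] by blast
  have [measurable]: "U \<in> borel_measurable borel" using U by simp
  have [measurable]: "T \<in> borel_measurable borel" by (rule borel_measurable_continuous_onI[OF C1_on_continuous[OF T]])
  have [measurable]: "(\<lambda>z. D z h) \<in> borel_measurable borel" for h by (rule borel_measurable_continuous_onI[OF D(2)])
  have lip: "cmod (T (z + h) - T z) \<le> M * norm h" for z h
  proof -
    have "norm (T (z + h) - T z) \<le> M * norm ((z + h) - z)"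
      by (rule differentiable_bound[of UNIV T D]) (use D(1) M in \<open>auto intro: has_derivative_at_withinI onorm_le\<close>)
    then show ?thesis by simp
  qed
  have lin: "linear (D z)" for z using D(1) by (rule has_derivative_linear)
  define E where "E x h = - (\<integral>y. U y * D (y - x) h \<partial>lborel)" for x h
  have iD: "integrable lborel (\<lambda>y. U y * D (y - x) h)" and bD: "cmod (\<integral>y. U y * D (y - x) h \<partial>lborel) \<le> (M * norm h) * (\<integral>y. cmod (U y) \<partial>lborel)" for x h
    by (rule integrable_mult_bounded[OF U, where C = "M * norm h"]; use M in simp)+
  have iT: "integrable lborel (\<lambda>y. U y * T (y - x))" for x
    by (rule integrable_mult_bounded[OF U, where C = B]; use bT in simp)
  have iM: "integrable lborel (\<lambda>y. c * cmod (U y))" for c using U by simp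
  have E_lin: "bounded_linear (E x)" for x
  proof (rule bounded_linear_intro[where K = "M * (\<integral>y. cmod (U y) \<partial>lborel)"])
    show "E x (a + b) = E x a + E x b" for a b
      unfolding E_def linear_add[OF lin] distrib_left Bochner_Integration.integral_add[OF iD iD] by simp
    show "E x (r *\<^sub>R a) = r *\<^sub>R E x a" for r a
      unfolding E_def linear_scale[OF lin] by simp
    show "norm (E x h) \<le> norm h * (M * (\<integral>y. cmod (U y) \<partial>lborel))" for h
      using bD[of x h] by (simp add: E_def mult_ac)
  qed
  have der: "((\<lambda>x. \<integral>y. U y * T (y - x) \<partial>lborel) has_derivative E x) (at x)" for x
    unfolding has_derivative_at
  proof (intro conjI E_lin)
    have "(\<lambda>h. ((\<integral>y. U y * T (y - (x + h)) \<partial>lborel) - (\<integral>y. U y * T (y - x) \<partial>lborel) - E x h) /\<^sub>R norm h) \<midarrow>0\<rightarrow> 0"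
      unfolding tendsto_at_iff_sequentially
    proof (intro allI impI)
      fix X :: "nat \<Rightarrow> real ^ 2" assume X0: "\<forall>i. X i \<in> UNIV - {0}" and X: "X \<longlonglongrightarrow> 0"
      define r where "r n y = (T (y - (x + X n)) - T (y - x) + D (y - x) (X n)) /\<^sub>R norm (X n)" for n y
      have [measurable]: "r n \<in> borel_measurable borel" for n unfolding r_def[abs_def] by measurable
      have rb: "cmod (r n y) \<le> 2 * M" for n y
      proof -
        have "cmod (T (y - (x + X n)) - T (y - x) + D (y - x) (X n)) \<le> M * norm (X n) + M * norm (X n)"
          using lip[of "y - x" "- X n"] M(2)[of "y - x" "X n"]
          by (intro order_trans[OF norm_triangle_ineq] add_mono) (auto simp: algebra_simps)
        then show ?thesis using X0 by (simp add: r_def divide_simps)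
      qed
      have "((\<integral>y. U y * T (y - (x + X n)) \<partial>lborel) - (\<integral>y. U y * T (y - x) \<partial>lborel) - E x (X n)) /\<^sub>R norm (X n) = (\<integral>y. U y * r n y \<partial>lborel)" for n
      proof -
        have "(\<integral>y. U y * T (y - (x + X n)) \<partial>lborel) - (\<integral>y. U y * T (y - x) \<partial>lborel) - E x (X n)
          = (\<integral>y. U y * T (y - (x + X n)) - U y * T (y - x) + U y * D (y - x) (X n) \<partial>lborel)"
          using iT iD by (simp add: E_def)
        moreover have "U y * r n y = (U y * T (y - (x + X n)) - U y * T (y - x) + U y * D (y - x) (X n)) /\<^sub>R norm (X n)" for y
          by (simp add: r_def algebra_simps)
        ultimately show ?thesis by simp
      qed
      moreover have "(\<lambda>n. \<integral>y. U y * r n y \<partial>lborel) \<longlonglongrightarrow> (\<integral>y. 0 \<partial>(lborel :: (real ^ 2) measure))"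
      proof (rule integral_dominated_convergence[where w = "\<lambda>y. (2 * M) * cmod (U y)"])
        show "AE y in lborel. (\<lambda>n. U y * r n y) \<longlonglongrightarrow> 0"
        proof (rule AE_I2)
          fix y
          have "((\<lambda>h. norm (T (y - x + h) - T (y - x) - D (y - x) h) / norm h) \<longlongrightarrow> 0) (at 0)"
            using D(1)[of "y - x"] unfolding has_derivative_at by blast
          moreover have "filterlim (\<lambda>n. - X n) (at 0) sequentially"
            using X X0 tendsto_minus[OF X] by (auto simp: filterlim_at)
          ultimately have "(\<lambda>n. norm (T (y - x + - X n) - T (y - x) - D (y - x) (- X n)) / norm (- X n)) \<longlonglongrightarrow> 0"
            by (rule filterlim_compose)
          moreover have "norm (T (y - x + - X n) - T (y - x) - D (y - x) (- X n)) / norm (- X n) = norm (r n y)" for n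
          proof -
            have e: "y - x + - X n = y - (x + X n)" by simp
            show ?thesis unfolding r_def e linear_neg[OF lin] by (simp add: divide_inverse mult.commute)
          qed
          ultimately have "(\<lambda>n. r n y) \<longlonglongrightarrow> 0" by (simp add: tendsto_norm_zero_iff)
          then show "(\<lambda>n. U y * r n y) \<longlonglongrightarrow> 0" by (rule tendsto_mult_right_zero)
        qed
        show "AE y in lborel. norm (U y * r n y) \<le> 2 * M * cmod (U y)" for n
        proof (rule AE_I2)
          show "norm (U y * r n y) \<le> 2 * M * cmod (U y)" for y
            using mult_right_mono[OF rb[of n y], of "cmod (U y)"] by (simp add: norm_mult mult.commute)
        qed
        show "integrable lborel (\<lambda>y. 2 * M * cmod (U y))" by (rule iM)
      qed measurable
      ultimately show "((\<lambda>h. ((\<integral>y. U y * T (y - (x + h)) \<partial>lborel) - (\<integral>y. U y * T (y - x) \<partial>lborel) - E x h) /\<^sub>R norm h) \<circ> X) \<longlonglongrightarrow> 0"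
        by (simp add: o_def)
    qed
    then show "(\<lambda>h. norm ((\<integral>y. U y * T (y - (x + h)) \<partial>lborel) - (\<integral>y. U y * T (y - x) \<partial>lborel) - E x h) / norm h) \<midarrow>0\<rightarrow> 0"
      using tendsto_norm_zero by (fastforce simp: divide_inverse mult.commute)
  qed
  have cont: "continuous_on UNIV (\<lambda>x. E x h)" for h
  proof (rule continuous_at_imp_continuous_on, rule ballI)
    fix x :: "real ^ 2"
    show "isCont (\<lambda>x. E x h) x"
      unfolding continuous_at_sequentially o_def
    proof (intro allI impI)
      fix X assume X: "X \<longlonglongrightarrow> x"
      have "(\<lambda>n. \<integral>y. U y * D (y - X n) h \<partial>lborel) \<longlonglongrightarrow> (\<integral>y. U y * D (y - x) h \<partial>lborel)"
      proof (rule integral_dominated_convergence[where w = "\<lambda>y. (M * norm h) * cmod (U y)"])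
        show "AE y in lborel. (\<lambda>n. U y * D (y - X n) h) \<longlonglongrightarrow> U y * D (y - x) h"
        proof (rule AE_I2)
          fix y
          have "isCont (\<lambda>z. D z h) (y - x)" using D(2) by (simp add: continuous_on_eq_continuous_at)
          moreover have "(\<lambda>n. y - X n) \<longlonglongrightarrow> y - x" by (intro tendsto_intros X)
          ultimately have "(\<lambda>n. D (y - X n) h) \<longlonglongrightarrow> D (y - x) h" by (rule isCont_tendsto_compose)
          then show "(\<lambda>n. U y * D (y - X n) h) \<longlonglongrightarrow> U y * D (y - x) h" by (intro tendsto_intros)
        qed
        show "AE y in lborel. norm (U y * D (y - X n) h) \<le> M * norm h * cmod (U y)" for n
        proof (rule AE_I2)
          show "norm (U y * D (y - X n) h) \<le> M * norm h * cmod (U y)" for y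
            using mult_right_mono[OF M(2)[of "y - X n" h], of "cmod (U y)"] by (simp add: norm_mult mult.commute)
        qed
        show "integrable lborel (\<lambda>y. M * norm h * cmod (U y))" by (rule iM)
      qed measurable
      then show "(\<lambda>n. E (X n) h) \<longlonglongrightarrow> E x h" unfolding E_def by (intro tendsto_intros)
    qed
  qed
  show ?thesis unfolding C1_on_def using der cont by (intro exI[of _ E]) (auto intro: continuous_on_subset)
qed

lemma log_kernel_test_function:
  assumes d: "d > 0" and sub: "cball x d \<subseteq> W"
  shows "(\<lambda>y. log_kernel k d (eps n) (sqdist x y)) \<in> test_functions W"
proof -
  have "{y. log_kernel k d (eps n) (sqdist x y) \<noteq> 0} \<subseteq> cball x d"
  proof
    fix y assume "y \<in> {y. log_kernel k d (eps n) (sqdist x y) \<noteq> 0}"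
    then have "sqdist x y < d\<^sup>2" using log_kernel_eq_0[OF d, of "sqdist x y"] by fastforce
    then have "(norm (y - x))\<^sup>2 < d\<^sup>2" by (simp add: power2_norm_eq_inner)
    then have "norm (y - x) < d" using d by (simp add: power2_less_imp_less)
    then show "y \<in> cball x d" by (simp add: dist_norm norm_minus_commute)
  qed
  then have "closure {y. log_kernel k d (eps n) (sqdist x y) \<noteq> 0} \<subseteq> cball x d"
    by (rule closure_minimal) simp
  moreover from this have "compact (closure {y. log_kernel k d (eps n) (sqdist x y) \<noteq> 0})"
    by (meson bounded_cball bounded_subset closed_closure compact_eq_bounded_closed)
  ultimately show ?thesis
    using log_kernel_smooth[OF eps_pos(1)] sub unfolding test_functions_def by blast
qed

lemma helmholtz_log_kernel_eps:
  assumes d: "d > 0"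
  shows "laplacian (\<lambda>y. log_kernel k d (eps n) (sqdist x y)) y + k\<^sup>2 * log_kernel k d (eps n) (sqdist x y)
    = of_real (approx_kernel d (eps n) (y - x)) + approx_remainder k d (eps n) (y - x)"
  using helmholtz_log_kernel[OF eps_pos(1)[of n] d, where x = x and y = y and k = k]
  unfolding approx_kernel_def approx_remainder_def .

lemma complex_completion_borel_rep:
  fixes f :: "real ^ 2 \<Rightarrow> complex"
  assumes f: "f \<in> borel_measurable lebesgue"
  shows "\<exists>g\<in>borel_measurable borel. AE x in lborel. f x = g x"
proof -
  have re: "(\<lambda>x. Re (f x)) \<in> borel_measurable lebesgue" and im: "(\<lambda>x. Im (f x)) \<in> borel_measurable lebesgue"
    using f by (auto intro: borel_measurable_Re borel_measurable_Im)
  obtain a where a: "a \<in> borel_measurable lborel" "AE x in lborel. Re (f x) = a x"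
    using completion_ex_borel_measurable_real[OF re] by blast
  obtain b where b: "b \<in> borel_measurable lborel" "AE x in lborel. Im (f x) = b x"
    using completion_ex_borel_measurable_real[OF im] by blast
  have "(\<lambda>x. of_real (a x) + \<i> * of_real (b x)) \<in> borel_measurable borel"
    using a(1) b(1) by simp
  moreover have "AE x in lborel. f x = of_real (a x) + \<i> * of_real (b x)"
    using a(2) b(2) by eventually_elim (simp add: complex_eq_iff)
  ultimately show ?thesis by (intro bexI[of _ "\<lambda>x. of_real (a x) + \<i> * of_real (b x)"])
qed

lemma AE_notin_frontier_box: "AE y in lborel. y \<notin> frontier (box a (b :: real ^ 2))"
proof -
  have "negligible (frontier (box a b))" by (rule negligible_convex_frontier[OF convex_box(2)])
  then have "frontier (box a b) \<in> null_sets (completion lborel)" by (rule negligible_iff_null_sets[THEN iffD1])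
  moreover have "frontier (box a b) \<in> sets lborel" using borel_closed[OF frontier_closed] by (simp only: sets_lborel)
  ultimately have "frontier (box a b) \<in> null_sets lborel" by (simp only: null_sets_completion_iff)
  then show ?thesis by (rule AE_not_in)
qed

text \<open>Test functions centred at points \<open>x\<close> near \<open>x0\<close> give, through \<open>box_identity\<close>, the equation
\<open>bump_mass d * U x + (\<integral> U y * limit_remainder k d (y - x) dy) = 0\<close> almost everywhere near \<open>x0\<close>. The
convolution is continuously differentiable, and dividing by the mass makes it a representative of \<open>u\<close>.\<close>
lemma weak_solution_local_C1:
  assumes D: "open D" and u: "u \<in> H1_loc D" and w: "weak_helmholtz D k u" and x0: "x0 \<in> D"
  shows "\<exists>B w. open B \<and> x0 \<in> B \<and> B \<subseteq> D \<and> C1_on UNIV w \<and> (AE x in lebesgue. x \<in> B \<longrightarrow> u x = w x)"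
proof -
  obtain \<rho> where \<rho>: "\<rho> > 0" "cball x0 \<rho> \<subseteq> D" using D x0 open_contains_cball by blast
  \<comment> \<open>Test functions of radius \<open>d\<close> centred in \<open>ball x0 d\<close> then stay inside \<open>W\<close>.\<close>
  define d where "d = \<rho> / 3"
  define W where "W = ball x0 \<rho>"
  have d: "d > 0" using \<rho> by (simp add: d_def)
  have W: "open W" "bounded W" "closure W \<subseteq> D" using \<rho> by (auto simp: W_def)
  then have "u \<in> L2_on W" using u unfolding H1_loc_def H1_on_def by blast
  then have um: "u \<in> borel_measurable (lebesgue_on W)" and ui: "integrable (lebesgue_on W) (\<lambda>x. (cmod (u x))\<^sup>2)"
    by (auto simp: L2_on_def)
  have Wl: "W \<in> sets lebesgue" "D \<in> sets lebesgue" using W(1) D by auto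
  define uW where "uW x = indicator W x *\<^sub>R u x" for x
  have uWm: "uW \<in> borel_measurable lebesgue"
    using um Wl unfolding uW_def[abs_def] by (subst (asm) borel_measurable_restrict_space_iff) auto
  have uWi: "integrable lebesgue uW"
  proof (rule Bochner_Integration.integrable_bound)
    have "integrable (lebesgue_on W) (\<lambda>x. 1 :: real)"
    proof -
      have "emeasure lebesgue W < \<infinity>" using W(2) emeasure_bounded_finite[of W] Wl W(1) by (simp add: emeasure_completion)
      then show ?thesis using Wl by (simp add: integrable_restrict_space integrable_indicator_iff)
    qed
    then have "integrable (lebesgue_on W) (\<lambda>x. 1 + (cmod (u x))\<^sup>2)" using ui by (rule Bochner_Integration.integrable_add)
    then show "integrable lebesgue (\<lambda>x. indicator W x *\<^sub>R (1 + (cmod (u x))\<^sup>2))"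
      using Wl by (subst (asm) integrable_restrict_space) auto
    show "AE x in lebesgue. norm (uW x) \<le> norm (indicator W x *\<^sub>R (1 + (cmod (u x))\<^sup>2))"
    proof (rule AE_I2)
      fix x :: "real ^ 2"
      have "cmod (u x) \<le> 1 + (cmod (u x))\<^sup>2"
      proof -
        have "2 * cmod (u x) \<le> 1 + (cmod (u x))\<^sup>2"
          using zero_le_power2[of "cmod (u x) - 1"] by (simp add: power2_diff)
        then show ?thesis using norm_ge_zero[of "u x"] by linarith
      qed
      then show "norm (uW x) \<le> norm (indicator W x *\<^sub>R (1 + (cmod (u x))\<^sup>2))"
        by (auto simp: uW_def indicator_def)
    qed
  qed (rule uWm)
  \<comment> \<open>A Borel version of the Lebesgue measurable function, so that Fubini's theorem applies.\<close>
  obtain U where Um[measurable]: "U \<in> borel_measurable borel" and UW: "AE x in lborel. uW x = U x"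
    using complex_completion_borel_rep[OF uWm] by blast
  have U: "integrable lborel U"
  proof -
    have "integrable lebesgue U"
      using integrable_cong_AE[OF uWm measurable_completion AE_completion[OF UW]] uWi by simp
    then show ?thesis by (subst (asm) integrable_completion) auto
  qed
  have test: "(\<integral>y. U y * (of_real (approx_kernel d (eps n) (y - x)) + approx_remainder k d (eps n) (y - x)) \<partial>lborel) = 0"
    if x: "x \<in> ball x0 d" for x n
  proof -
    define g where "g y = of_real (approx_kernel d (eps n) (y - x)) + approx_remainder k d (eps n) (y - x)" for y
    have [measurable]: "g \<in> borel_measurable borel" unfolding g_def[abs_def] by measurable
    have sub: "cball x d \<subseteq> W"
    proof
      fix y assume "y \<in> cball x d"
      then have "dist x0 y \<le> dist x0 x + d" using dist_triangle[of x0 y x] by simp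
      then show "y \<in> W" using x d by (simp add: W_def d_def)
    qed
    have WD: "W \<subseteq> D" using \<rho> by (auto simp: W_def)
    have g0: "g y = 0" if "y \<notin> W" for y
    proof -
      have "norm (y - x) \<ge> d" using that sub by (force simp: dist_norm norm_minus_commute)
      then have "(y - x) \<bullet> (y - x) \<ge> d\<^sup>2" using d by (simp add: dot_square_norm power_mono)
      then show ?thesis unfolding g_def approx_kernel_def approx_remainder_def
        using cutoff_eq_0[OF d] remainder_eq_0[OF d] by simp
    qed
    have "(\<integral>y. u y * g y \<partial>lebesgue_on D) = 0"
      using w log_kernel_test_function[OF d, of x D k n] sub WD
      unfolding weak_helmholtz_def g_def helmholtz_log_kernel_eps[OF d, symmetric] by blast
    then have "(\<integral>y. indicator D y *\<^sub>R (u y * g y) \<partial>lebesgue) = 0"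
      using Wl by (subst (asm) integral_restrict_space) auto
    moreover have "indicator D y *\<^sub>R (u y * g y) = uW y * g y" for y
      using g0[of y] WD by (auto simp: indicator_def uW_def)
    ultimately have "(\<integral>y. uW y * g y \<partial>lebesgue) = 0" by simp
    moreover have "(\<integral>y. uW y * g y \<partial>lebesgue) = (\<integral>y. U y * g y \<partial>lebesgue)"
    proof (rule integral_cong_AE)
      show "(\<lambda>y. uW y * g y) \<in> borel_measurable lebesgue" by (rule borel_measurable_times[OF uWm measurable_completion]) simp
      show "(\<lambda>y. U y * g y) \<in> borel_measurable lebesgue" by (intro measurable_completion) measurable
      show "AE y in lebesgue. uW y * g y = U y * g y" using AE_completion[OF UW] by eventually_elim simp
    qed
    moreover have "(\<integral>y. U y * g y \<partial>lebesgue) = (\<integral>y. U y * g y \<partial>lborel)" by (rule integral_completion) measurable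
    ultimately show ?thesis by (simp add: g_def)
  qed
  obtain a b where ab: "box a b \<subseteq> ball x0 d" "x0 \<in> box a b"
    using rational_boxes[OF d, of x0] by metis
  define m where "m = bump_mass d"
  have m: "m > 0" unfolding m_def by (rule bump_mass_pos[OF d])
  obtain C where C: "C \<ge> 0" "\<And>z. cmod (limit_remainder k d z) \<le> C"
    using approx_remainder_bounded[OF d, of k] by blast
  define S where "S x = (\<integral>y. U y * limit_remainder k d (y - x) \<partial>lborel)" for x
  have C1S: "C1_on UNIV S" unfolding S_def[abs_def]
  proof (rule convolution_C1[OF U C1_on_limit_remainder _ C(2)])
    show "limit_remainder k d z = 0" if "norm z \<ge> d" for z
      using that d remainder_eq_0[OF d, of "z \<bullet> z"] by (simp add: limit_remainder_def dot_square_norm power_mono)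
  qed
  define f where "f x = indicator (box a b) x *\<^sub>R (of_real m * U x + S x)" for x
  have bS: "cmod (S x) \<le> C * (\<integral>y. cmod (U y) \<partial>lborel)" for x
    unfolding S_def by (rule integrable_mult_bounded[OF U, where C = C]; use C in simp)
  have Sm[measurable]: "S \<in> borel_measurable borel" by (rule borel_measurable_continuous_onI[OF C1_on_continuous[OF C1S]])
  have iI: "integrable lborel (indicator (box a b) :: _ \<Rightarrow> real)" by (simp add: integrable_indicator_iff emeasure_lborel_box_eq)
  have i1: "integrable lborel (\<lambda>x. indicator (box a b) x *\<^sub>R (of_real m * U x))"
    using U by (intro integrable_mult_indicator) auto
  have i2: "integrable lborel (\<lambda>x. indicator (box a b) x *\<^sub>R S x)"
  proof (rule Bochner_Integration.integrable_bound[where f = "\<lambda>x. indicator (box a b) x * (C * (\<integral>y. cmod (U y) \<partial>lborel))"])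
    show "integrable lborel (\<lambda>x. indicator (box a b) x * (C * (\<integral>y. cmod (U y) \<partial>lborel)))" using iI by simp
    show "AE x in lborel. norm (indicator (box a b) x *\<^sub>R S x) \<le> norm (indicator (box a b) x * (C * (\<integral>y. cmod (U y) \<partial>lborel)))"
    proof (rule AE_I2)
      show "norm (indicator (box a b) x *\<^sub>R S x) \<le> norm (indicator (box a b) x * (C * (\<integral>y. cmod (U y) \<partial>lborel)))" for x
        using bS[of x] by (auto simp: indicator_def)
    qed
  qed measurable
  have fi: "integrable lborel f"
    using Bochner_Integration.integrable_add[OF i1 i2] unfolding f_def[abs_def] by (simp add: scaleR_add_right)
  have zero: "(\<integral>x. indicator (box p q \<inter> box a b) x *\<^sub>R (of_real m * U x + S x) \<partial>lborel) = 0" for p q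
  proof -
    obtain r s where rs: "box p q \<inter> box a b = box r s" unfolding box_Int_box by blast
    show ?thesis unfolding rs m_def S_def
    proof (rule box_identity[OF U d])
      show "(\<integral>y. U y * (of_real (approx_kernel d (eps n) (y - x)) + approx_remainder k d (eps n) (y - x)) \<partial>lborel) = 0"
        if "x \<in> box r s" for x n
        using that rs ab by (intro test) blast
    qed (auto simp: AE_notin_frontier_box emeasure_lborel_box_eq)
  qed
  have "AE x in lborel. f x = 0"
  proof (rule AE_zero_of_box_integrals[OF fi])
    have "indicator (box p q) x *\<^sub>R f x = indicator (box p q \<inter> box a b) x *\<^sub>R (of_real m * U x + S x)" for p q x
      by (simp add: f_def indicator_def)
    then show "(\<integral>x. indicator (box p q) x *\<^sub>R f x \<partial>lborel) = 0" for p q using zero[of p q] by simp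
    show "integral\<^sup>L lborel f = 0" using zero[of a b] by (simp add: f_def[abs_def])
  qed
  with UW have ae: "AE x in lborel. x \<in> box a b \<longrightarrow> u x = (- 1 / of_real m) * S x"
  proof eventually_elim
    case (elim x)
    show ?case
    proof
      assume x: "x \<in> box a b"
      then have "x \<in> ball x0 d" using ab by blast
      then have "x \<in> W" using \<rho> by (simp add: W_def d_def)
      then have "u x = U x" using elim by (simp add: uW_def)
      moreover have "of_real m * U x + S x = 0" using elim x by (simp add: f_def)
      ultimately show "u x = (- 1 / of_real m) * S x" using m by (simp add: field_simps eq_neg_iff_add_eq_0)
    qed
  qed
  have "box a b \<subseteq> D" using ab \<rho> by (force simp: d_def)
  moreover have "C1_on UNIV (\<lambda>x. (- 1 / of_real m) * S x)" by (intro C1_on_mult C1_on_const C1S)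
  ultimately show ?thesis
    using ab(2) AE_completion[OF ae] by (intro exI[of _ "box a b"] exI[of _ "\<lambda>x. (- 1 / of_real m) * S x"]) auto
qed

lemma continuous_AE_eq:
  fixes f g :: "real ^ 2 \<Rightarrow> complex"
  assumes S: "open S" and f: "continuous_on S f" and g: "continuous_on S g" and ae: "AE x in lebesgue. x \<in> S \<longrightarrow> f x = g x"
    and x: "x \<in> S"
  shows "f x = g x"
proof (rule ccontr)
  assume ne: "f x \<noteq> g x"
  define N where "N = S \<inter> (\<lambda>x. f x - g x) -` (- {0})"
  have "open N" unfolding N_def by (intro continuous_open_preimage continuous_on_diff f g S) auto
  moreover have "x \<in> N" using ne x by (simp add: N_def)
  ultimately have "\<not> negligible N" using open_not_negligible by blast
  moreover have "N \<in> null_sets lebesgue"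
  proof -
    obtain M where M: "{x \<in> space lebesgue. \<not> (x \<in> S \<longrightarrow> f x = g x)} \<subseteq> M" "M \<in> null_sets lebesgue"
      using ae unfolding eventually_ae_filter by blast
    have "N \<subseteq> M" using M(1) by (auto simp: N_def)
    then show ?thesis using M(2) by (rule null_sets_completion_subset)
  qed
  ultimately show False by (simp add: negligible_iff_null_sets)
qed

text \<open>The local representatives agree on overlaps, two continuous functions that are equal almost everywhere
being equal, and glue to a function \<open>W\<close> on \<open>D\<close>; countably many of the neighbourhoods cover \<open>D\<close>, so that
\<open>W\<close> equals \<open>u\<close> almost everywhere. By the same uniqueness, every continuous representative is \<open>W\<close> on
\<open>D\<close>, whichever one is chosen.\<close>
theorem helmholtz_continuous_rep_C1:
  assumes D: "open D" and u: "u \<in> H1_loc D" and helm: "weak_helmholtz D k u"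
  shows "C1_on D (continuous_rep D u)"
proof -
  have "\<forall>x\<in>D. \<exists>p. open (fst p) \<and> x \<in> fst p \<and> fst p \<subseteq> D \<and> C1_on UNIV (snd p) \<and>
      (AE z in lebesgue. z \<in> fst p \<longrightarrow> u z = snd p z)"
  proof
    fix x assume "x \<in> D"
    from weak_solution_local_C1[OF D u helm this] obtain B w where
      "open B \<and> x \<in> B \<and> B \<subseteq> D \<and> C1_on UNIV w \<and> (AE z in lebesgue. z \<in> B \<longrightarrow> u z = w z)" by (elim exE)
    then show "\<exists>p. open (fst p) \<and> x \<in> fst p \<and> fst p \<subseteq> D \<and> C1_on UNIV (snd p) \<and>
      (AE z in lebesgue. z \<in> fst p \<longrightarrow> u z = snd p z)"
      by (intro exI[of _ "(B, w)"]) simp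
  qed
  from bchoice[OF this] obtain P where P: "\<forall>x\<in>D. open (fst (P x)) \<and> x \<in> fst (P x) \<and> fst (P x) \<subseteq> D \<and> C1_on UNIV (snd (P x)) \<and>
      (AE z in lebesgue. z \<in> fst (P x) \<longrightarrow> u z = snd (P x) z)" by (elim exE)
  define B w where "B x = fst (P x)" and "w x = snd (P x)" for x
  have B: "\<And>x. x \<in> D \<Longrightarrow> open (B x)" "\<And>x. x \<in> D \<Longrightarrow> x \<in> B x" "\<And>x. x \<in> D \<Longrightarrow> B x \<subseteq> D"
    and w: "\<And>x. x \<in> D \<Longrightarrow> C1_on UNIV (w x)" "\<And>x. x \<in> D \<Longrightarrow> AE z in lebesgue. z \<in> B x \<longrightarrow> u z = w x z"
    using P unfolding B_def w_def by blast+
  define W where "W z = w z z" for z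
  have W: "W z = w x z" if "x \<in> D" "z \<in> B x" for x z
  proof -
    have z: "z \<in> D" using that B by blast
    show ?thesis unfolding W_def
    proof (rule continuous_AE_eq[of "B x \<inter> B z" "w z" "w x"])
      show "AE y in lebesgue. y \<in> B x \<inter> B z \<longrightarrow> w z y = w x y"
        using w(2)[OF that(1)] w(2)[OF z] by eventually_elim auto
      show "continuous_on (B x \<inter> B z) (w z)" "continuous_on (B x \<inter> B z) (w x)"
        using C1_on_continuous[OF C1_on_subset[OF w(1) subset_UNIV]] that(1) z by blast+
    qed (use B that z in auto)
  qed
  have C1: "C1_on D g" if g: "\<And>z. z \<in> D \<Longrightarrow> g z = W z" for g
  proof -
    obtain E where E: "\<And>x z. x \<in> D \<Longrightarrow> (w x has_derivative E x z) (at z)" "\<And>x h. x \<in> D \<Longrightarrow> continuous_on UNIV (\<lambda>z. E x z h)"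
      using w(1) unfolding C1_on_def by (metis UNIV_I)
    have dg: "(g has_derivative E x z) (at z)" if "x \<in> D" "z \<in> B x" for x z
      using E(1)[OF that(1), of z]
      by (rule has_derivative_transform_within_open[OF _ B(1)[OF that(1)] that(2)]) (use g W that(1) B(3) in force)
    have ee: "E y y h = E x y h" if "x \<in> D" "y \<in> B x" for x y h
    proof -
      have y: "y \<in> D" using that B by blast
      show ?thesis using has_derivative_unique[OF dg[OF y B(2)[OF y]] dg[OF that]] by simp
    qed
    have "isCont (\<lambda>y. E y y h) x" if x: "x \<in> D" for x h
    proof -
      have "continuous_on (B x) (\<lambda>y. E x y h)" using E(2)[OF x] continuous_on_subset by blast
      then have "continuous_on (B x) (\<lambda>y. E y y h)"
        by (rule continuous_on_cong[THEN iffD1, rotated 2]) (simp_all add: ee[OF x])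
      then show ?thesis using B(1,2)[OF x] by (simp add: continuous_on_eq_continuous_at)
    qed
    then have "continuous_on D (\<lambda>y. E y y h)" for h by (intro continuous_at_imp_continuous_on) auto
    then show ?thesis unfolding C1_on_def using dg B(2) by (intro exI[of _ "\<lambda>y. E y y"]) auto
  qed
  have aeW: "AE z in lebesgue. z \<in> D \<longrightarrow> W z = u z"
  proof -
    obtain F where F: "F \<subseteq> B ` D" "countable F" "\<Union>F = \<Union>(B ` D)"
      using Lindelof[of "B ` D"] B(1) by auto
    have "\<forall>S\<in>F. AE z in lebesgue. z \<in> S \<longrightarrow> W z = u z"
    proof
      fix S assume "S \<in> F"
      then obtain x where x: "x \<in> D" "S = B x" using F by blast
      show "AE z in lebesgue. z \<in> S \<longrightarrow> W z = u z"
        using w(2)[OF x(1)] by eventually_elim (use W[OF x(1)] x(2) in auto)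
    qed
    then have "AE z in lebesgue. \<forall>S\<in>F. z \<in> S \<longrightarrow> W z = u z"
      unfolding AE_ball_countable[OF F(2)] .
    then show ?thesis
    proof eventually_elim
      case (elim z)
      show ?case
      proof
        assume "z \<in> D"
        then have "z \<in> \<Union>F" using B(2) F(3) by blast
        then show "W z = u z" using elim by blast
      qed
    qed
  qed
  have Dl: "D \<inter> space lebesgue \<in> sets lebesgue" using D by simp
  have cW: "continuous_on D W" by (rule C1_on_continuous[OF C1]) simp
  define v where "v = continuous_rep D u"
  have "\<exists>v. continuous_on D v \<and> (AE x in lebesgue_on D. v x = u x)"
    using cW aeW unfolding AE_restrict_space_iff[OF Dl] by blast
  then have v: "continuous_on D v" "AE x in lebesgue_on D. v x = u x"
    unfolding v_def continuous_rep_def by (rule someI2_ex; blast)+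
  have "AE x in lebesgue. x \<in> D \<longrightarrow> v x = W x"
    using v(2)[unfolded AE_restrict_space_iff[OF Dl]] aeW by eventually_elim auto
  then have "v z = W z" if "z \<in> D" for z using continuous_AE_eq[OF D v(1) cW _ that] by blast
  then show ?thesis using C1 unfolding v_def by blast
qed

section \<open>Boundary integrals over the portions\<close>

text \<open>Measurability is required for the function cut off outside \<open>A\<close>: the fields are regular near the boundary
only, and nothing is known about their values elsewhere.\<close>
definition bounded_borel_on :: "(real ^ 2) set \<Rightarrow> (real ^ 2 \<Rightarrow> complex) \<Rightarrow> bool" where
  "bounded_borel_on A q \<longleftrightarrow> (\<lambda>y. indicator A y *\<^sub>R q y) \<in> borel_measurable borel \<and> (\<exists>B. \<forall>y\<in>A. cmod (q y) \<le> B)"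

lemma bounded_borel_on_cong: "(\<And>y. y \<in> A \<Longrightarrow> p y = q y) \<Longrightarrow> bounded_borel_on A p \<longleftrightarrow> bounded_borel_on A q"
proof -
  assume eq: "\<And>y. y \<in> A \<Longrightarrow> p y = q y"
  have "(\<lambda>y. indicator A y *\<^sub>R p y) = (\<lambda>y. indicator A y *\<^sub>R q y)" using eq by (intro ext) (auto simp: indicator_def)
  then show ?thesis unfolding bounded_borel_on_def using eq by auto
qed

lemma bounded_borel_on_add:
  assumes "bounded_borel_on A p" "bounded_borel_on A q" shows "bounded_borel_on A (\<lambda>y. p y + q y)"
proof -
  obtain B C where B: "\<And>y. y \<in> A \<Longrightarrow> cmod (p y) \<le> B" and C: "\<And>y. y \<in> A \<Longrightarrow> cmod (q y) \<le> C"
    using assms unfolding bounded_borel_on_def by blast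
  have "(\<lambda>y. indicator A y *\<^sub>R p y + indicator A y *\<^sub>R q y) \<in> borel_measurable borel"
    using assms unfolding bounded_borel_on_def by (intro borel_measurable_add) auto
  moreover have "\<forall>y\<in>A. cmod (p y + q y) \<le> B + C"
    using B C by (auto intro: order_trans[OF norm_triangle_ineq] add_mono)
  ultimately show ?thesis unfolding bounded_borel_on_def by (auto simp: scaleR_add_right)
qed

lemma bounded_borel_on_mult:
  assumes "bounded_borel_on A p" "bounded_borel_on A q" shows "bounded_borel_on A (\<lambda>y. p y * q y)"
proof -
  obtain B C where B: "\<And>y. y \<in> A \<Longrightarrow> cmod (p y) \<le> B" and C: "\<And>y. y \<in> A \<Longrightarrow> cmod (q y) \<le> C"
    using assms unfolding bounded_borel_on_def by blast
  have "(\<lambda>y. (indicator A y *\<^sub>R p y) * (indicator A y *\<^sub>R q y)) \<in> borel_measurable borel"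
    using assms unfolding bounded_borel_on_def by (intro borel_measurable_times) auto
  moreover have "(\<lambda>y. (indicator A y *\<^sub>R p y) * (indicator A y *\<^sub>R q y)) = (\<lambda>y. indicator A y *\<^sub>R (p y * q y))"
    by (intro ext) (auto simp: indicator_def)
  moreover have "\<forall>y\<in>A. cmod (p y * q y) \<le> \<bar>B\<bar> * \<bar>C\<bar>"
    using B C by (auto simp: norm_mult intro!: mult_mono intro: order_trans[OF _ abs_ge_self])
  ultimately show ?thesis unfolding bounded_borel_on_def by auto
qed

lemma bounded_borel_on_continuous:
  assumes "compact A" "continuous_on A q" shows "bounded_borel_on A q"
proof -
  have "bounded (q ` A)" using assms by (intro compact_imp_bounded compact_continuous_image)
  then have "\<exists>B. \<forall>y\<in>A. cmod (q y) \<le> B" unfolding bounded_iff by auto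
  moreover have "(\<lambda>y. indicator A y *\<^sub>R q y) \<in> borel_measurable borel"
    using assms by (intro borel_measurable_continuous_on_indicator borel_compact)
  ultimately show ?thesis unfolding bounded_borel_on_def by blast
qed

lemma bounded_borel_on_const: "compact A \<Longrightarrow> bounded_borel_on A (\<lambda>y. c)"
  by (intro bounded_borel_on_continuous) auto

lemma bounded_borel_on_subset:
  assumes "bounded_borel_on A q" "B \<subseteq> A" "B \<in> sets borel" shows "bounded_borel_on B q"
proof -
  have [measurable]: "(\<lambda>y. indicator A y *\<^sub>R q y) \<in> borel_measurable borel" using assms by (simp add: bounded_borel_on_def)
  have [measurable]: "B \<in> sets borel" by fact
  have "(\<lambda>y. indicator B y *\<^sub>R (indicator A y *\<^sub>R q y)) \<in> borel_measurable borel" by measurable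
  moreover have "(\<lambda>y. indicator B y *\<^sub>R (indicator A y *\<^sub>R q y)) = (\<lambda>y. indicator B y *\<^sub>R q y)"
    using assms(2) by (intro ext) (auto simp: indicator_def)
  ultimately show ?thesis using assms unfolding bounded_borel_on_def by auto
qed

text \<open>The normal derivative is the sum of the continuous partial derivatives, weighted with the components of
the Borel measurable outward normal.\<close>
lemma bounded_borel_on_normal_deriv:
  assumes A: "compact A" and f: "\<And>y. y \<in> A \<Longrightarrow> (f has_derivative D y) (at y)"
    and D: "\<And>h. continuous_on A (\<lambda>y. D y h)"
  shows "bounded_borel_on A (normal_deriv S f)"
proof -
  have n: "bounded_borel_on A (\<lambda>y. of_real (outward_normal S y $ i))" for i
  proof -
    have [measurable]: "A \<in> sets borel" using A by (rule borel_compact)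
    have "(\<lambda>x :: real ^ 2. x $ i) \<in> borel_measurable borel" by (intro borel_measurable_continuous_onI continuous_intros)
    then have "(\<lambda>y. indicator A y *\<^sub>R complex_of_real (outward_normal S y $ i)) \<in> borel_measurable borel" by measurable
    moreover have "cmod (of_real (outward_normal S y $ i)) \<le> 1" for y
      using component_le_norm_cart[of "outward_normal S y" i] norm_outward_normal_le[of S y] by simp
    ultimately show ?thesis unfolding bounded_borel_on_def by blast
  qed
  have main: "bounded_borel_on A (\<lambda>y. of_real (outward_normal S y $ 1) * D y (axis 1 1) + of_real (outward_normal S y $ 2) * D y (axis 2 1))"
    by (intro bounded_borel_on_add bounded_borel_on_mult n bounded_borel_on_continuous A D)
  have eq: "normal_deriv S f y = of_real (outward_normal S y $ 1) * D y (axis 1 1) + of_real (outward_normal S y $ 2) * D y (axis 2 1)"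
    if "y \<in> A" for y
  proof -
    let ?n = "outward_normal S y"
    have h: "?n = ?n $ 1 *\<^sub>R axis 1 1 + ?n $ 2 *\<^sub>R axis 2 1"
      by (simp add: vec_eq_iff forall_2 axis_def)
    have lin: "linear (D y)" using f[OF that] by (rule has_derivative_linear)
    have "D y ?n = ?n $ 1 *\<^sub>R D y (axis 1 1) + ?n $ 2 *\<^sub>R D y (axis 2 1)"
      by (subst h) (simp only: linear_add[OF lin] linear_scale[OF lin])
    then show ?thesis using normal_deriv_eq[OF f[OF that]] by (simp add: scaleR_conv_of_real)
  qed
  from main show ?thesis by (rule bounded_borel_on_cong[THEN iffD2, rotated]) (rule eq)
qed

lemma bounded_borel_on_integrable:
  assumes q: "bounded_borel_on A q" and A: "A \<in> sets borel" and fin: "emeasure arc_length A < \<infinity>"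
  shows "set_integrable arc_length A q"
proof -
  obtain B where B: "\<And>y. y \<in> A \<Longrightarrow> cmod (q y) \<le> B" using q unfolding bounded_borel_on_def by blast
  have i: "integrable arc_length (\<lambda>y. indicator A y * B)"
    using A fin by (intro integrable_mult_left) (simp add: integrable_indicator_iff)
  show ?thesis unfolding set_integrable_def
  proof (rule Bochner_Integration.integrable_bound[OF i])
    show "(\<lambda>y. indicator A y *\<^sub>R q y) \<in> borel_measurable arc_length"
      using q by (simp add: bounded_borel_on_def cong: measurable_cong_sets)
    show "AE y in arc_length. norm (indicator A y *\<^sub>R q y) \<le> norm (indicator A y * B)"
      using B by (intro AE_I2) (auto simp: indicator_def intro: order_trans[OF B])
  qed
qed

locale device_cover =
  fixes \<Omega> :: "(real ^ 2) set" and N :: nat and \<Gamma> :: "nat \<Rightarrow> (real ^ 2) set" and c :: "nat \<Rightarrow> real ^ 2"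
  assumes bounded_region: "bounded \<Omega>" and lipschitz: "lipschitz_boundary \<Omega>" and N: "N \<ge> 1"
    and portions: "\<And>j. j \<in> {1..N} \<Longrightarrow> compact (\<Gamma> j) \<and> \<Gamma> j \<noteq> {}"
    and cover: "(\<Union>j\<in>{1..N}. \<Gamma> j) = frontier \<Omega>"
    and overlap: "\<And>i j. i \<in> {1..N} \<Longrightarrow> j \<in> {1..N} \<Longrightarrow> i \<noteq> j \<Longrightarrow> finite (\<Gamma> i \<inter> \<Gamma> j)"
begin

lemma compact_boundary: "compact (frontier \<Omega>)"
  using bounded_region by (rule compact_frontier_bounded)

lemma portion_borel: "j \<in> {1..N} \<Longrightarrow> \<Gamma> j \<in> sets borel"
  using portions borel_compact by blast

lemma portion_subset: "j \<in> {1..N} \<Longrightarrow> \<Gamma> j \<subseteq> frontier \<Omega>"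
  using cover by blast

lemma boundary_borel: "frontier \<Omega> \<in> sets borel"
  by (intro borel_closed frontier_closed)

lemma integrable_on_boundary:
  "bounded_borel_on (frontier \<Omega>) q \<Longrightarrow> set_integrable arc_length (frontier \<Omega>) q"
  by (rule bounded_borel_on_integrable[OF _ boundary_borel lipschitz_boundary_finite_length[OF lipschitz bounded_region]])

lemma integrable_on_portion:
  assumes j: "j \<in> {1..N}" and q: "bounded_borel_on (\<Gamma> j) q"
  shows "set_integrable arc_length (\<Gamma> j) q"
proof (rule bounded_borel_on_integrable[OF q portion_borel[OF j]])
  have "emeasure arc_length (\<Gamma> j) \<le> emeasure arc_length (frontier \<Omega>)"
    using portion_subset[OF j] boundary_borel by (intro emeasure_mono) auto
  then show "emeasure arc_length (\<Gamma> j) < \<infinity>"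
    using lipschitz_boundary_finite_length[OF lipschitz bounded_region] by (rule order_le_less_trans)
qed

text \<open>Points in two portions form a finite set, which has length zero.\<close>
lemma AE_indicator_boundary: "AE y in arc_length. indicator (frontier \<Omega>) y = (\<Sum>j=1..N. indicator (\<Gamma> j) y :: real)"
proof -
  define E where "E = (\<Union>i\<in>{1..N}. \<Union>j\<in>{1..N} - {i}. \<Gamma> i \<inter> \<Gamma> j)"
  have "finite E" unfolding E_def using overlap by (intro finite_UN_I) auto
  then have "AE y in arc_length. y \<notin> E" by (intro AE_not_in finite_null_arc_length)
  then show ?thesis
  proof eventually_elim
    case (elim y)
    show ?case
    proof (cases "y \<in> frontier \<Omega>")
      case True
      then obtain i where i: "i \<in> {1..N}" "y \<in> \<Gamma> i" using cover by blast
      have "y \<notin> \<Gamma> j" if "j \<in> {1..N}" "j \<noteq> i" for j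
        using elim i that unfolding E_def by blast
      then have "indicator (\<Gamma> j) y = (if j = i then 1 else 0 :: real)" if "j \<in> {1..N}" for j
        using that i(2) by simp
      then have "(\<Sum>j=1..N. indicator (\<Gamma> j) y :: real) = (\<Sum>j=1..N. if j = i then 1 else 0)" by (intro sum.cong) auto
      then show ?thesis using i True by simp
    next
      case False
      then have "y \<notin> \<Gamma> j" if "j \<in> {1..N}" for j using cover that by blast
      then have "(\<Sum>j=1..N. indicator (\<Gamma> j) y :: real) = 0" by (intro sum.neutral) simp
      then show ?thesis using False by simp
    qed
  qed
qed

lemma boundary_integral_split:
  fixes h :: "real ^ 2 \<Rightarrow> 'b :: {banach, second_countable_topology}"
  assumes h: "set_integrable arc_length (frontier \<Omega>) h"
  shows "set_lebesgue_integral arc_length (frontier \<Omega>) h = (\<Sum>j=1..N. set_lebesgue_integral arc_length (\<Gamma> j) h)"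
proof -
  have i: "integrable arc_length (\<lambda>y. indicator (\<Gamma> j) y *\<^sub>R h y)" if "j \<in> {1..N}" for j
    using set_integrable_subset[OF h, of "\<Gamma> j"] portion_borel[OF that] portion_subset[OF that]
    by (simp add: set_integrable_def)
  have "set_lebesgue_integral arc_length (frontier \<Omega>) h = (\<integral>y. (\<Sum>j=1..N. indicator (\<Gamma> j) y *\<^sub>R h y) \<partial>arc_length)"
    unfolding set_lebesgue_integral_def
  proof (rule integral_cong_AE)
    show "AE y in arc_length. indicator (frontier \<Omega>) y *\<^sub>R h y = (\<Sum>j=1..N. indicator (\<Gamma> j) y *\<^sub>R h y)"
      using AE_indicator_boundary
    proof eventually_elim
      case (elim y)
      show ?case unfolding elim by (rule scaleR_sum_left)
    qed
    show "(\<lambda>y. indicator (frontier \<Omega>) y *\<^sub>R h y) \<in> borel_measurable arc_length"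
      using h unfolding set_integrable_def by (rule borel_measurable_integrable)
    show "(\<lambda>y. \<Sum>j=1..N. indicator (\<Gamma> j) y *\<^sub>R h y) \<in> borel_measurable arc_length"
      by (intro borel_measurable_sum borel_measurable_integrable i)
  qed
  also have "\<dots> = (\<Sum>j=1..N. set_lebesgue_integral arc_length (\<Gamma> j) h)"
    unfolding set_lebesgue_integral_def by (rule Bochner_Integration.integral_sum) (use i in auto)
  finally show ?thesis .
qed

text \<open>The regularity of the incident field that the error estimate draws on. It concerns the
traces only, as the constants may depend on the field through its traces.\<close>
definition admissible_trace :: "(real ^ 2 \<Rightarrow> complex) \<Rightarrow> bool" where
  "admissible_trace v \<longleftrightarrow> bounded_borel_on (frontier \<Omega>) v \<and> bounded_borel_on (frontier \<Omega>) (normal_deriv \<Omega> v)"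

lemma helmholtz_admissible_trace:
  assumes "open D" "closure \<Omega> \<subseteq> D" "u \<in> H1_loc D" "weak_helmholtz D k u"
  shows "admissible_trace (continuous_rep D u)"
proof -
  have sub: "frontier \<Omega> \<subseteq> D" using assms(2) by (auto simp: frontier_def)
  have C1: "C1_on (frontier \<Omega>) (continuous_rep D u)"
    using helmholtz_continuous_rep_C1[OF assms(1,3,4)] sub by (rule C1_on_subset)
  then obtain E where "\<And>y. y \<in> frontier \<Omega> \<Longrightarrow> (continuous_rep D u has_derivative E y) (at y)"
    "\<And>h. continuous_on (frontier \<Omega>) (\<lambda>y. E y h)" unfolding C1_on_def by blast
  then have "bounded_borel_on (frontier \<Omega>) (normal_deriv \<Omega> (continuous_rep D u))"
    by (rule bounded_borel_on_normal_deriv[OF compact_boundary])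
  then show ?thesis unfolding admissible_trace_def
    using bounded_borel_on_continuous[OF compact_boundary C1_on_continuous[OF C1]] by simp
qed

text \<open>The norm of the traces that enters the constant of the error estimate.\<close>
definition trace_mass :: "(real ^ 2) set \<Rightarrow> (real ^ 2 \<Rightarrow> complex) \<Rightarrow> real" where
  "trace_mass A v = (LINT y:A|arc_length. cmod (v y) + cmod (normal_deriv \<Omega> v y))"

lemma trace_integrable:
  assumes "admissible_trace v"
  shows "set_integrable arc_length (frontier \<Omega>) (\<lambda>y. cmod (v y) + cmod (normal_deriv \<Omega> v y))"
  using assms integrable_on_boundary unfolding admissible_trace_def
  by (intro set_integral_add set_integrable_norm) auto

lemma trace_portion:
  assumes v: "admissible_trace v" and j: "j \<in> {1..N}"
  shows "bounded_borel_on (\<Gamma> j) v" "bounded_borel_on (\<Gamma> j) (normal_deriv \<Omega> v)"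
  using v bounded_borel_on_subset portion_subset[OF j] portion_borel[OF j] unfolding admissible_trace_def by blast+

lemma portion_integral_bound:
  assumes v: "admissible_trace v" and j: "j \<in> {1..N}"
    and q: "bounded_borel_on (\<Gamma> j) q" "bounded_borel_on (\<Gamma> j) q'"
    and b: "\<And>y. y \<in> \<Gamma> j \<Longrightarrow> cmod (q y) \<le> C" "\<And>y. y \<in> \<Gamma> j \<Longrightarrow> cmod (q' y) \<le> C"
  shows "cmod (LINT y:\<Gamma> j|arc_length. - normal_deriv \<Omega> v y * q y + v y * q' y) \<le> C * trace_mass (\<Gamma> j) v"
proof -
  note t = trace_portion[OF v j]
  have "bounded_borel_on (\<Gamma> j) (\<lambda>y. (- 1) * (normal_deriv \<Omega> v y * q y) + v y * q' y)"
    using portions[OF j] by (intro bounded_borel_on_add bounded_borel_on_mult bounded_borel_on_const t q) auto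
  then have i: "set_integrable arc_length (\<Gamma> j) (\<lambda>y. - normal_deriv \<Omega> v y * q y + v y * q' y)"
    using integrable_on_portion[OF j] by simp
  have i2: "set_integrable arc_length (\<Gamma> j) (\<lambda>y. C * (cmod (v y) + cmod (normal_deriv \<Omega> v y)))"
    using integrable_on_portion[OF j] t by (intro set_integrable_mult_right set_integral_add set_integrable_norm) auto
  have "cmod (LINT y:\<Gamma> j|arc_length. - normal_deriv \<Omega> v y * q y + v y * q' y)
     \<le> (LINT y:\<Gamma> j|arc_length. C * (cmod (v y) + cmod (normal_deriv \<Omega> v y)))"
    unfolding set_lebesgue_integral_def
  proof (rule Bochner_Integration.integral_norm_bound_integral)
    fix y
    show "norm (indicator (\<Gamma> j) y *\<^sub>R (- normal_deriv \<Omega> v y * q y + v y * q' y))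
       \<le> indicator (\<Gamma> j) y *\<^sub>R (C * (cmod (v y) + cmod (normal_deriv \<Omega> v y)))"
    proof (cases "y \<in> \<Gamma> j")
      case True
      have "cmod (- normal_deriv \<Omega> v y * q y + v y * q' y) \<le> cmod (normal_deriv \<Omega> v y) * cmod (q y) + cmod (v y) * cmod (q' y)"
        by (rule order_trans[OF norm_triangle_ineq]) (simp add: norm_mult)
      also have "\<dots> \<le> cmod (normal_deriv \<Omega> v y) * C + cmod (v y) * C"
        using b[OF True] by (intro add_mono mult_left_mono) auto
      finally show ?thesis using True by (simp add: algebra_simps)
    qed simp
  qed (use i i2 in \<open>auto simp: set_integrable_def\<close>)
  then show ?thesis by (simp add: trace_mass_def)
qed

lemma green_on_portion:
  assumes k: "k \<notin> \<real>\<^sub>\<le>\<^sub>0" and A: "compact A" and x: "x \<notin> A"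
  shows "bounded_borel_on A (\<lambda>y. green k (x - y))" "bounded_borel_on A (normal_deriv \<Omega> (\<lambda>y. green k (x - y)))"
    and "\<And>y. y \<in> A \<Longrightarrow> normal_deriv \<Omega> (\<lambda>y. green k (x - y)) y = green_D k (x - y) (- outward_normal \<Omega> y)"
proof -
  have d: "((\<lambda>y. green k (x - y)) has_derivative (\<lambda>h. green_D k (x - y) (- h))) (at y)" if "y \<in> A" for y
  proof -
    have "((\<lambda>y. x - y) has_derivative (\<lambda>h. - h)) (at y)" by (auto intro!: derivative_eq_intros)
    moreover have "(green k has_derivative green_D k (x - y)) (at (x - y))" using that x k by (intro green_deriv) auto
    ultimately show ?thesis by (rule has_derivative_compose)
  qed
  have c: "continuous_on A (\<lambda>y. green_D k (x - y) (- h))" for h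
  proof -
    have "continuous_on A (\<lambda>y. hankel_wave k m (plane (x - y)))" for m
    proof (rule continuous_on_compose2[of "- {0}" "hankel_wave k m"])
      show "continuous_on (- {0}) (hankel_wave k m)"
        using hankel_wave_deriv[OF k] by (intro continuous_at_imp_continuous_on ballI) (auto dest: has_derivative_continuous)
      show "continuous_on A (\<lambda>y. plane (x - y))"
        by (intro bounded_linear.continuous_on[OF bounded_linear_plane] continuous_intros)
      show "(\<lambda>y. plane (x - y)) ` A \<subseteq> - {0}"
      proof
        fix w assume "w \<in> (\<lambda>y. plane (x - y)) ` A"
        then obtain y where y: "y \<in> A" "w = plane (x - y)" by blast
        then have "norm (x - y) \<noteq> 0" using x by auto
        then have "cmod w \<noteq> 0" unfolding y(2) norm_plane .
        then show "w \<in> - {0}" by auto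
      qed
    qed
    then show ?thesis unfolding green_D_def hankel_wave_D_def by (intro continuous_intros)
  qed
  show "bounded_borel_on A (\<lambda>y. green k (x - y))"
    using d by (intro bounded_borel_on_continuous A continuous_at_imp_continuous_on ballI) (auto dest: has_derivative_continuous)
  show "bounded_borel_on A (normal_deriv \<Omega> (\<lambda>y. green k (x - y)))"
    by (rule bounded_borel_on_normal_deriv[OF A d c])
  show "normal_deriv \<Omega> (\<lambda>y. green k (x - y)) y = green_D k (x - y) (- outward_normal \<Omega> y)" if "y \<in> A" for y
    by (rule normal_deriv_eq[OF d[OF that]])
qed

lemma U_wave_on_portion:
  assumes A: "compact A"
  shows "bounded_borel_on A (\<lambda>y. U_wave m k (y - p))" "bounded_borel_on A (normal_deriv \<Omega> (\<lambda>y. U_wave m k (y - p)))"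
    and "normal_deriv \<Omega> (\<lambda>y. U_wave m k (y - p)) y = U_wave_D m k (y - p) (outward_normal \<Omega> y)"
proof -
  have d: "((\<lambda>y. U_wave m k (y - p)) has_derivative (\<lambda>h. U_wave_D m k (y - p) h)) (at y)" for y
  proof -
    have "((\<lambda>y. y - p) has_derivative (\<lambda>h. h)) (at y)" by (auto intro!: derivative_eq_intros)
    from has_derivative_compose[OF this U_wave_deriv] show ?thesis .
  qed
  have c: "continuous_on A (\<lambda>y. U_wave_D m k (y - p) h)" for h
  proof -
    have "continuous_on A (\<lambda>y. bessel_wave k m (plane (y - p)))" for m
    proof (rule continuous_on_compose2[of UNIV "bessel_wave k m"])
      show "continuous_on UNIV (bessel_wave k m)"
        using bessel_wave_deriv by (intro continuous_at_imp_continuous_on ballI) (auto dest: has_derivative_continuous)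
      show "continuous_on A (\<lambda>y. plane (y - p))"
        by (intro bounded_linear.continuous_on[OF bounded_linear_plane] continuous_intros)
    qed simp
    then show ?thesis unfolding U_wave_D_def bessel_wave_D_def by (intro continuous_intros)
  qed
  show "bounded_borel_on A (\<lambda>y. U_wave m k (y - p))"
    using d by (intro bounded_borel_on_continuous A continuous_at_imp_continuous_on ballI) (auto dest: has_derivative_continuous)
  show "bounded_borel_on A (normal_deriv \<Omega> (\<lambda>y. U_wave m k (y - p)))"
    by (rule bounded_borel_on_normal_deriv[OF A d c])
  show "normal_deriv \<Omega> (\<lambda>y. U_wave m k (y - p)) y = U_wave_D m k (y - p) (outward_normal \<Omega> y)"
    by (rule normal_deriv_eq[OF d])
qed

text \<open>Both the layer potentials and the coefficients are linear in the kernel, so their difference is the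
layer potential of the truncation error. The normal derivatives of the kernels are the total derivatives
evaluated at the normal, since \<open>x\<close> is off the portion.\<close>
lemma portion_error:
  assumes v: "admissible_trace v" and j: "j \<in> {1..N}" and k: "k \<notin> \<real>\<^sub>\<le>\<^sub>0" and x: "x \<notin> \<Gamma> j"
  shows "(LINT y:\<Gamma> j|arc_length. - normal_deriv \<Omega> v y * green k (x - y) + v y * normal_deriv \<Omega> (\<lambda>y. green k (x - y)) y)
     - (\<Sum>m=-int M..int M. multipole_coeff \<Omega> \<Gamma> c v k j m * V_wave m k (x - c j))
    = (LINT y:\<Gamma> j|arc_length. - normal_deriv \<Omega> v y * graf_error k M (x - c j) (y - c j)
        + v y * graf_error_D k M (x - c j) (y - c j) (outward_normal \<Omega> y))" (is "?G - ?S = ?E")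
    and "bounded_borel_on (\<Gamma> j) (\<lambda>y. graf_error k M (x - c j) (y - c j))"
    and "bounded_borel_on (\<Gamma> j) (\<lambda>y. graf_error_D k M (x - c j) (y - c j) (outward_normal \<Omega> y))"
proof -
  have A: "compact (\<Gamma> j)" using portions[OF j] by blast
  note t = trace_portion[OF v j] and g = green_on_portion[OF k A x]
  have i: "set_integrable arc_length (\<Gamma> j) (\<lambda>y. - normal_deriv \<Omega> v y * q y + v y * q' y)"
    if "bounded_borel_on (\<Gamma> j) q" "bounded_borel_on (\<Gamma> j) q'" for q q'
  proof -
    have "bounded_borel_on (\<Gamma> j) (\<lambda>y. (- 1) * (normal_deriv \<Omega> v y * q y) + v y * q' y)"
      using A by (intro bounded_borel_on_add bounded_borel_on_mult bounded_borel_on_const t that) auto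
    then show ?thesis using integrable_on_portion[OF j] by simp
  qed
  define h where "h m y = - normal_deriv \<Omega> v y * U_wave m k (y - c j) + v y * normal_deriv \<Omega> (\<lambda>y. U_wave m k (y - c j)) y" for m y
  have ih: "set_integrable arc_length (\<Gamma> j) (h m)" for m
    unfolding h_def[abs_def] by (rule i[OF U_wave_on_portion(1,2)[OF A]])
  have im: "integrable arc_length (\<lambda>y. indicator (\<Gamma> j) y *\<^sub>R (a * h m y))" for a m
    using set_integrable_mult_right[where a = a, OF ih[of m]] unfolding set_integrable_def .
  have S: "?S = (LINT y:\<Gamma> j|arc_length. (\<Sum>m=-int M..int M. (\<i> / 4 * V_wave m k (x - c j)) * h m y))"
  proof -
    have "(LINT y:\<Gamma> j|arc_length. (\<Sum>m=-int M..int M. (\<i> / 4 * V_wave m k (x - c j)) * h m y))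
       = (\<Sum>m=-int M..int M. LINT y:\<Gamma> j|arc_length. (\<i> / 4 * V_wave m k (x - c j)) * h m y)"
      unfolding set_lebesgue_integral_def scaleR_sum_right by (rule Bochner_Integration.integral_sum) (rule im)
    also have "\<dots> = ?S"
      unfolding multipole_coeff_def h_def[symmetric] set_integral_mult_right by (intro sum.cong) (simp_all add: mult_ac)
    finally show ?thesis by simp
  qed
  have iS: "set_integrable arc_length (\<Gamma> j) (\<lambda>y. \<Sum>m=-int M..int M. (\<i> / 4 * V_wave m k (x - c j)) * h m y)"
    unfolding set_integrable_def scaleR_sum_right by (rule Bochner_Integration.integrable_sum) (rule im)
  have "?G - ?S = (LINT y:\<Gamma> j|arc_length. (- normal_deriv \<Omega> v y * green k (x - y) + v y * normal_deriv \<Omega> (\<lambda>y. green k (x - y)) y)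
     - (\<Sum>m=-int M..int M. (\<i> / 4 * V_wave m k (x - c j)) * h m y))"
    unfolding S by (rule set_integral_diff(2)[OF i[OF g(1,2)] iS, symmetric])
  also have "\<dots> = ?E"
  proof (rule set_lebesgue_integral_cong)
    show "\<Gamma> j \<in> sets arc_length" using portion_borel[OF j] by simp
    show "\<forall>y. y \<in> \<Gamma> j \<longrightarrow> (- normal_deriv \<Omega> v y * green k (x - y) + v y * normal_deriv \<Omega> (\<lambda>y. green k (x - y)) y)
     - (\<Sum>m=-int M..int M. (\<i> / 4 * V_wave m k (x - c j)) * h m y) = - normal_deriv \<Omega> v y * graf_error k M (x - c j) (y - c j)
        + v y * graf_error_D k M (x - c j) (y - c j) (outward_normal \<Omega> y)"
    proof (intro allI impI)
      fix y assume y: "y \<in> \<Gamma> j"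
      define a b where "a = normal_deriv \<Omega> v y" and "b = v y"
      define V where "V m = V_wave m k (x - c j)" for m
      have xy: "x - c j - (y - c j) = x - y" by simp
      have "(\<Sum>m=-int M..int M. (\<i> / 4 * V m) * (- a * U_wave m k (y - c j) + b * U_wave_D m k (y - c j) (outward_normal \<Omega> y)))
        = - a * (\<i> / 4 * (\<Sum>m=-int M..int M. V m * U_wave m k (y - c j)))
          + b * (\<i> / 4 * (\<Sum>m=-int M..int M. V m * U_wave_D m k (y - c j) (outward_normal \<Omega> y)))"
        unfolding sum_distrib_left sum.distrib[symmetric] by (intro sum.cong) (auto simp: algebra_simps)
      then show "(- normal_deriv \<Omega> v y * green k (x - y) + v y * normal_deriv \<Omega> (\<lambda>y. green k (x - y)) y)
       - (\<Sum>m=-int M..int M. (\<i> / 4 * V_wave m k (x - c j)) * h m y) = - normal_deriv \<Omega> v y * graf_error k M (x - c j) (y - c j)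
          + v y * graf_error_D k M (x - c j) (y - c j) (outward_normal \<Omega> y)"
        unfolding h_def g(3)[OF y] U_wave_on_portion(3)[OF A] graf_error_def graf_error_D_def xy
          a_def[symmetric] b_def[symmetric] V_def[symmetric] by (simp add: algebra_simps)
    qed
  qed
  finally show "?G - ?S = ?E" .
  have sumb: "bounded_borel_on (\<Gamma> j) (\<lambda>y. \<Sum>m\<in>I. q m y)" if "\<And>m. bounded_borel_on (\<Gamma> j) (q m)" "finite I" for q and I :: "int set"
    using that(2) by (induction I) (auto intro!: bounded_borel_on_add bounded_borel_on_const A that(1))
  have e1: "graf_error k M (x - c j) (y - c j) = green k (x - y) + (- (\<i> / 4)) * (\<Sum>m=-int M..int M. V_wave m k (x - c j) * U_wave m k (y - c j))" for y
    by (simp add: graf_error_def)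
  show "bounded_borel_on (\<Gamma> j) (\<lambda>y. graf_error k M (x - c j) (y - c j))"
    unfolding e1 by (intro bounded_borel_on_add bounded_borel_on_mult bounded_borel_on_const sumb A g U_wave_on_portion) auto
  have "bounded_borel_on (\<Gamma> j) (\<lambda>y. normal_deriv \<Omega> (\<lambda>y. green k (x - y)) y + (- (\<i> / 4)) * (\<Sum>m=-int M..int M. V_wave m k (x - c j) * normal_deriv \<Omega> (\<lambda>y. U_wave m k (y - c j)) y))"
    by (intro bounded_borel_on_add bounded_borel_on_mult bounded_borel_on_const sumb A g U_wave_on_portion) auto
  then show "bounded_borel_on (\<Gamma> j) (\<lambda>y. graf_error_D k M (x - c j) (y - c j) (outward_normal \<Omega> y))"
    by (rule bounded_borel_on_cong[THEN iffD1, rotated]) (simp add: graf_error_D_def g(3) U_wave_on_portion(3)[OF A])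
qed

section \<open>The expansion ratio and the truncation error\<close>

lemma farthest_point:
  obtains s where "\<And>j y. j \<in> {1..N} \<Longrightarrow> y \<in> \<Gamma> j \<Longrightarrow> norm (y - c j) \<le> s j"
    and "\<And>j. j \<in> {1..N} \<Longrightarrow> \<exists>p\<in>\<Gamma> j. s j = norm (p - c j)"
proof -
  have "\<forall>j\<in>{1..N}. \<exists>p. p \<in> \<Gamma> j \<and> (\<forall>y\<in>\<Gamma> j. norm (y - c j) \<le> norm (p - c j))"
  proof
    fix j assume "j \<in> {1..N}"
    then have "compact (\<Gamma> j)" "\<Gamma> j \<noteq> {}" using portions by auto
    moreover have "continuous_on (\<Gamma> j) (\<lambda>y. norm (y - c j))" by (intro continuous_intros)
    ultimately show "\<exists>p. p \<in> \<Gamma> j \<and> (\<forall>y\<in>\<Gamma> j. norm (y - c j) \<le> norm (p - c j))"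
      using continuous_attains_sup by blast
  qed
  from bchoice[OF this] obtain p where p: "\<forall>j\<in>{1..N}. p j \<in> \<Gamma> j \<and> (\<forall>y\<in>\<Gamma> j. norm (y - c j) \<le> norm (p j - c j))" ..
  show ?thesis by (rule that[of "\<lambda>j. norm (p j - c j)"]) (use p in blast)+
qed

text \<open>By compactness the suprema are attained: \<open>s j\<close> is the radius of the disc of device \<open>j\<close>. A point outside
the disc has \<open>s j < \<bar>x - c j\<bar>\<close>, and the maximum over the compact \<open>X\<close> of the continuous quotient
\<open>s j / \<bar>x - c j\<bar>\<close> stays below \<open>1\<close>.\<close>
lemma expansion_ratio_facts:
  assumes X: "compact X" "X \<noteq> {}" "X \<subseteq> - device_region N \<Gamma> c"
  defines "a \<equiv> expansion_ratio N \<Gamma> c X"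
  shows "0 \<le> a" and "a < 1"
    and "\<And>x j y. x \<in> X \<Longrightarrow> j \<in> {1..N} \<Longrightarrow> y \<in> \<Gamma> j \<Longrightarrow> norm (y - c j) \<le> a * norm (x - c j)"
    and "\<And>x j. x \<in> X \<Longrightarrow> j \<in> {1..N} \<Longrightarrow> x \<noteq> c j"
proof -
  obtain s where s: "\<And>j y. j \<in> {1..N} \<Longrightarrow> y \<in> \<Gamma> j \<Longrightarrow> norm (y - c j) \<le> s j"
    and sp: "\<And>j. j \<in> {1..N} \<Longrightarrow> \<exists>p\<in>\<Gamma> j. s j = norm (p - c j)"
    using farthest_point by blast
  have s0: "0 \<le> s j" if "j \<in> {1..N}" for j using sp[OF that] by auto
  have sup1: "(SUP y\<in>\<Gamma> j. norm (y - c j)) = s j" if j: "j \<in> {1..N}" for j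
    using sp[OF j] s[OF j] by (intro cSup_eq_maximum) auto
  have lt: "s j < norm (x - c j)" if "x \<in> X" "j \<in> {1..N}" for x j
    using X(3) that sup1[OF that(2)] by (force simp: device_region_def)
  then show ne: "x \<noteq> c j" if "x \<in> X" "j \<in> {1..N}" for x j using lt[OF that] s0[OF that(2)] by auto
  have sup2: "(SUP y\<in>\<Gamma> j. norm (y - c j) / norm (x - c j)) = s j / norm (x - c j)" if j: "j \<in> {1..N}" for x j
    using sp[OF j] s[OF j] by (intro cSup_eq_maximum) (auto intro: divide_right_mono)
  define \<rho> where "\<rho> x = Max ((\<lambda>j. s j / norm (x - c j)) ` {1..N})" for x
  have a: "a = (SUP x\<in>X. \<rho> x)"
    unfolding a_def expansion_ratio_def \<rho>_def by (intro SUP_cong refl arg_cong[where f = Max] image_cong sup2)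
  have "\<forall>j\<in>{1..N}. \<exists>t<1. \<forall>x\<in>X. s j / norm (x - c j) \<le> t"
  proof
    fix j assume j: "j \<in> {1..N}"
    have "continuous_on X (\<lambda>x. s j / norm (x - c j))" using ne[OF _ j] by (intro continuous_intros) auto
    then obtain x where x: "x \<in> X" "\<forall>y\<in>X. s j / norm (y - c j) \<le> s j / norm (x - c j)"
      using continuous_attains_sup[OF X(1,2)] by blast
    have "s j / norm (x - c j) < 1" using lt[OF x(1) j] s0[OF j] by (simp add: divide_simps)
    then show "\<exists>t<1. \<forall>x\<in>X. s j / norm (x - c j) \<le> t" using x(2) by blast
  qed
  from bchoice[OF this] obtain t where t: "\<forall>j\<in>{1..N}. t j < 1 \<and> (\<forall>x\<in>X. s j / norm (x - c j) \<le> t j)" ..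
  define T where "T = Max (t ` {1..N})"
  have fin: "finite {1..N}" "{1..N} \<noteq> {}" using N by auto
  have T: "T < 1" unfolding T_def using t fin by (subst Max_less_iff) auto
  have \<rho>T: "\<rho> x \<le> T" if "x \<in> X" for x
    unfolding \<rho>_def
  proof (rule Max.boundedI)
    fix r assume "r \<in> (\<lambda>j. s j / norm (x - c j)) ` {1..N}"
    then obtain j where j: "j \<in> {1..N}" "r = s j / norm (x - c j)" by blast
    have "r \<le> t j" using t j that by blast
    also have "t j \<le> T" unfolding T_def using j by (intro Max_ge) auto
    finally show "r \<le> T" .
  qed (use fin in auto)
  have "a \<le> T" unfolding a using X(2) \<rho>T by (intro cSUP_least)
  then show "a < 1" using T by linarith
  have le: "s j / norm (x - c j) \<le> a" if "x \<in> X" "j \<in> {1..N}" for x j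
  proof -
    have "s j / norm (x - c j) \<le> \<rho> x" unfolding \<rho>_def using that by (intro Max_ge) auto
    also have "\<rho> x \<le> a" unfolding a using \<rho>T that by (intro cSUP_upper bdd_aboveI2[where M = T]) auto
    finally show ?thesis .
  qed
  show "0 \<le> a"
  proof -
    obtain x where x: "x \<in> X" using X(2) by blast
    have 1: "1 \<in> {1..N}" using N by simp
    have "0 \<le> s 1 / norm (x - c 1)" using s0[OF 1] by simp
    then show ?thesis using le[OF x 1] by linarith
  qed
  show "norm (y - c j) \<le> a * norm (x - c j)" if "x \<in> X" "j \<in> {1..N}" "y \<in> \<Gamma> j" for x j y
  proof -
    have p: "norm (x - c j) > 0" using ne[OF that(1,2)] by simp
    have "norm (y - c j) \<le> s j" using s that by blast
    also have "s j \<le> a * norm (x - c j)" using le[OF that(1,2)] p by (simp add: divide_simps)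
    finally show ?thesis .
  qed
qed

text \<open>These bounds put all the vectors \<open>x - c j\<close> into one annulus, on which the Hankel waves are controlled.\<close>
lemma device_distances:
  assumes X: "compact X" and ne: "\<And>x j. x \<in> X \<Longrightarrow> j \<in> {1..N} \<Longrightarrow> x \<noteq> c j"
  obtains r0 r1 where "r0 > 0" "\<And>x j. x \<in> X \<Longrightarrow> j \<in> {1..N} \<Longrightarrow> r0 \<le> norm (x - c j) \<and> norm (x - c j) \<le> r1"
proof (cases "X = {}")
  case True then show ?thesis using that[of 1] by auto
next
  case False
  have "\<forall>j\<in>{1..N}. \<exists>r. fst r > 0 \<and> (\<forall>x\<in>X. fst r \<le> norm (x - c j) \<and> norm (x - c j) \<le> snd r)"
  proof
    fix j assume j: "j \<in> {1..N}"
    have c: "continuous_on X (\<lambda>x. norm (x - c j))" by (intro continuous_intros)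
    obtain p where p: "p \<in> X" "\<forall>x\<in>X. norm (p - c j) \<le> norm (x - c j)" using continuous_attains_inf[OF X False c] by blast
    obtain q where q: "q \<in> X" "\<forall>x\<in>X. norm (x - c j) \<le> norm (q - c j)" using continuous_attains_sup[OF X False c] by blast
    show "\<exists>r. fst r > 0 \<and> (\<forall>x\<in>X. fst r \<le> norm (x - c j) \<and> norm (x - c j) \<le> snd r)"
      by (intro exI[of _ "(norm (p - c j), norm (q - c j))"]) (use p q ne[OF p(1) j] in simp)
  qed
  from bchoice[OF this] obtain r where r: "\<forall>j\<in>{1..N}. fst (r j) > 0 \<and> (\<forall>x\<in>X. fst (r j) \<le> norm (x - c j) \<and> norm (x - c j) \<le> snd (r j))" ..
  have fin: "finite {1..N}" "{1..N} \<noteq> {}" using N by auto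
  show ?thesis
  proof (rule that)
    show "Min ((\<lambda>j. fst (r j)) ` {1..N}) > 0" using r fin by (subst Min_gr_iff) auto
    fix x j assume x: "x \<in> X" and j: "j \<in> {1..N}"
    have "Min ((\<lambda>j. fst (r j)) ` {1..N}) \<le> fst (r j)" using j by (intro Min_le) auto
    moreover have "snd (r j) \<le> Max ((\<lambda>j. snd (r j)) ` {1..N})" using j by (intro Max_ge) auto
    moreover have "fst (r j) \<le> norm (x - c j) \<and> norm (x - c j) \<le> snd (r j)" using r x j by blast
    ultimately show "Min ((\<lambda>j. fst (r j)) ` {1..N}) \<le> norm (x - c j) \<and> norm (x - c j) \<le> Max ((\<lambda>j. snd (r j)) ` {1..N})"
      by linarith
  qed
qed

lemma trace_mass_nonneg: "0 \<le> trace_mass A v"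
  unfolding trace_mass_def set_lebesgue_integral_def by (rule Bochner_Integration.integral_nonneg) simp

text \<open>The second estimate, on single terms, yields the summability of the device field. The constant does not
depend on \<open>v\<close>; all of the dependence is in \<open>trace_mass\<close>.\<close>
lemma multipole_expansion_error:
  assumes K: "compact K" "K \<subseteq> - \<real>\<^sub>\<le>\<^sub>0" and X: "compact X" "X \<noteq> {}" "X \<subseteq> - device_region N \<Gamma> c"
  defines "a \<equiv> expansion_ratio N \<Gamma> c X"
  shows "\<exists>C>0. \<forall>v k x. admissible_trace v \<and> k \<in> K \<and> x \<in> X \<longrightarrow>
     (\<forall>M. cmod (cloak_field \<Omega> v k x - device_field_trunc \<Omega> N \<Gamma> c v k M x)
        \<le> C * trace_mass (frontier \<Omega>) v * (a ^ (M + 1) / (1 - a))) \<and>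
     (\<forall>j\<in>{1..N}. \<forall>m. m \<noteq> 0 \<longrightarrow> cmod (multipole_coeff \<Omega> \<Gamma> c v k j m * V_wave m k (x - c j))
        \<le> C * trace_mass (\<Gamma> j) v * a ^ (nat \<bar>m\<bar> - 1))"
proof -
  note ef = expansion_ratio_facts[OF X, folded a_def]
  have a: "0 \<le> a" "a < 1" by (fact ef)+
  obtain r0 r1 where r: "r0 > 0" "\<And>x j. x \<in> X \<Longrightarrow> j \<in> {1..N} \<Longrightarrow> r0 \<le> norm (x - c j) \<and> norm (x - c j) \<le> r1"
    using device_distances[OF X(1) ef(4)] by blast
  obtain C where C: "C > 0" and Cb: "\<forall>k\<in>K. \<forall>x y a. r0 \<le> norm x \<and> norm x \<le> r1 \<and> norm y \<le> a * norm x \<and> 0 \<le> a \<and> a < 1 \<longrightarrow>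
     (\<forall>M. cmod (graf_error k M x y) \<le> C * (a ^ (M + 1) / (1 - a))) \<and>
     (\<forall>M h. cmod (graf_error_D k M x y h) \<le> C * norm h * (a ^ M / (1 - a))) \<and>
     (\<forall>m. m \<noteq> 0 \<longrightarrow> cmod (V_wave m k x * U_wave m k y) \<le> C * a ^ (nat \<bar>m\<bar> - 1)) \<and>
     (\<forall>m h. m \<noteq> 0 \<longrightarrow> cmod (V_wave m k x * U_wave_D m k y h) \<le> C * norm h * a ^ (nat \<bar>m\<bar> - 1))"
    using graf_error_bound[OF K r(1), of r1] by (elim exE conjE) (rule that)
  \<comment> \<open>The factor \<open>1 / a\<close> restores the power of \<open>a\<close> that the derivatives lose. For \<open>a = 0\<close> it equals \<open>0\<close>,
    and \<open>C1 = C\<close>.\<close>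
  define C1 where "C1 = C * (1 + 1 / a)"
  have C1: "C1 \<ge> C" "C1 \<ge> C * (1 / a)" "C1 > 0" 
  proof -
    have "C * (1 / a) \<ge> 0" using C a by simp
    moreover have "C1 = C + C * (1 / a)" by (simp add: C1_def distrib_left)
    ultimately show "C1 \<ge> C" "C1 \<ge> C * (1 / a)" "C1 > 0" using C by linarith+
  qed
  show ?thesis
  proof (intro exI[of _ C1] conjI allI impI ballI C1(3))
    fix v k x assume "admissible_trace v \<and> k \<in> K \<and> x \<in> X"
    then have v: "admissible_trace v" and kK: "k \<in> K" and x: "x \<in> X" by auto
    have k: "k \<notin> \<real>\<^sub>\<le>\<^sub>0" using kK K by blast
    have Cbj: "cmod (graf_error k M (x - c j) (y - c j)) \<le> C * (a ^ (M + 1) / (1 - a))"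
       "cmod (graf_error_D k M (x - c j) (y - c j) h) \<le> C * norm h * (a ^ M / (1 - a))"
       "m \<noteq> 0 \<Longrightarrow> cmod (V_wave m k (x - c j) * U_wave m k (y - c j)) \<le> C * a ^ (nat \<bar>m\<bar> - 1)"
       "m \<noteq> 0 \<Longrightarrow> cmod (V_wave m k (x - c j) * U_wave_D m k (y - c j) h) \<le> C * norm h * a ^ (nat \<bar>m\<bar> - 1)"
      if "j \<in> {1..N}" "y \<in> \<Gamma> j" for j y M h m
    proof -
      have "r0 \<le> norm (x - c j) \<and> norm (x - c j) \<le> r1 \<and> norm (y - c j) \<le> a * norm (x - c j) \<and> 0 \<le> a \<and> a < 1"
        using r(2)[OF x that(1)] ef(3)[OF x that] a by simp
      note b = bspec[OF Cb kK, THEN spec, THEN spec, THEN spec, THEN mp, OF this]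
      show "cmod (graf_error k M (x - c j) (y - c j)) \<le> C * (a ^ (M + 1) / (1 - a))"
        by (rule b[THEN conjunct1, THEN spec])
      show "cmod (graf_error_D k M (x - c j) (y - c j) h) \<le> C * norm h * (a ^ M / (1 - a))"
        by (rule b[THEN conjunct2, THEN conjunct1, THEN spec, THEN spec])
      show "cmod (V_wave m k (x - c j) * U_wave m k (y - c j)) \<le> C * a ^ (nat \<bar>m\<bar> - 1)" if "m \<noteq> 0"
        by (rule b[THEN conjunct2, THEN conjunct2, THEN conjunct1, THEN spec, THEN mp, OF that])
      show "cmod (V_wave m k (x - c j) * U_wave_D m k (y - c j) h) \<le> C * norm h * a ^ (nat \<bar>m\<bar> - 1)" if "m \<noteq> 0"
        by (rule b[THEN conjunct2, THEN conjunct2, THEN conjunct2, THEN spec, THEN spec, THEN mp, OF that])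
    qed
    have xj: "x \<notin> \<Gamma> j" if j: "j \<in> {1..N}" for j
    proof
      assume "x \<in> \<Gamma> j"
      then have "norm (x - c j) \<le> a * norm (x - c j)" using ef(3)[OF x j] by blast
      moreover have "norm (x - c j) > 0" using ef(4)[OF x j] by simp
      ultimately show False using a by (simp add: mult_le_cancel_right1)
    qed
    then have xb: "x \<notin> frontier \<Omega>" using cover by blast
    {
      fix M
      define G where "G j = (LINT y:\<Gamma> j|arc_length. - normal_deriv \<Omega> v y * green k (x - y) + v y * normal_deriv \<Omega> (\<lambda>y. green k (x - y)) y)" for j
      define S where "S j = (\<Sum>m=-int M..int M. multipole_coeff \<Omega> \<Gamma> c v k j m * V_wave m k (x - c j))" for j
      define E where "E j = (LINT y:\<Gamma> j|arc_length. - normal_deriv \<Omega> v y * graf_error k M (x - c j) (y - c j)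
        + v y * graf_error_D k M (x - c j) (y - c j) (outward_normal \<Omega> y))" for j
      define T where "T = a ^ (M + 1) / (1 - a)"
      have T: "T \<ge> 0" using a by (simp add: T_def)
      have GSE: "G j - S j = E j" if "j \<in> {1..N}" for j
        unfolding G_def S_def E_def by (rule portion_error(1)[OF v that k xj[OF that]])
      have Eb: "cmod (E j) \<le> C1 * T * trace_mass (\<Gamma> j) v" if j: "j \<in> {1..N}" for j
      proof (cases "a = 0")
        case True
        \<comment> \<open>A portion at distance zero from its device is a point, which has no length.\<close>
        have "\<Gamma> j \<subseteq> {c j}"
        proof
          fix y assume "y \<in> \<Gamma> j"
          from ef(3)[OF x j this] True have "norm (y - c j) \<le> 0" by simp
          then show "y \<in> {c j}" by simp
        qed
        then have "finite (\<Gamma> j)" by (rule finite_subset) simp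
        then have "\<Gamma> j \<in> null_sets arc_length" by (rule finite_null_arc_length)
        then have "AE y in arc_length. y \<notin> \<Gamma> j" by (rule AE_not_in)
        then have "E j = 0" unfolding E_def set_lebesgue_integral_def
          by (intro integral_eq_zero_AE) (auto elim!: eventually_mono)
        then show ?thesis using C1 T trace_mass_nonneg by simp
      next
        case False
        then have a0: "a > 0" using a by simp
        show ?thesis unfolding E_def
        proof (rule portion_integral_bound[OF v j portion_error(2,3)[OF v j k xj[OF j]]])
          fix y assume y: "y \<in> \<Gamma> j"
          have "C * T \<le> C1 * T" using C1 T by (intro mult_right_mono)
          then show "cmod (graf_error k M (x - c j) (y - c j)) \<le> C1 * T"
            using Cbj(1)[OF j y, of M] unfolding T_def by linarith
          have "cmod (graf_error_D k M (x - c j) (y - c j) (outward_normal \<Omega> y)) \<le> C * norm (outward_normal \<Omega> y) * (a ^ M / (1 - a))"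
            by (rule Cbj(2)[OF j y])
          also have "\<dots> \<le> C * 1 * (a ^ M / (1 - a))"
            using C a norm_outward_normal_le[of \<Omega> y] by (intro mult_right_mono mult_left_mono) auto
          also have "\<dots> = C * (1 / a) * T" using a0 by (simp add: T_def)
          also have "\<dots> \<le> C1 * T" using C1(2) T by (rule mult_right_mono)
          finally show "cmod (graf_error_D k M (x - c j) (y - c j) (outward_normal \<Omega> y)) \<le> C1 * T" .
        qed
      qed
      have g: "bounded_borel_on (frontier \<Omega>) (\<lambda>y. (- 1) * (normal_deriv \<Omega> v y * green k (x - y)) + v y * normal_deriv \<Omega> (\<lambda>y. green k (x - y)) y)"
        using v unfolding admissible_trace_def
        by (intro bounded_borel_on_add bounded_borel_on_mult bounded_borel_on_const green_on_portion(1,2)[OF k compact_boundary xb] compact_boundary) auto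
      have "cloak_field \<Omega> v k x = (\<Sum>j=1..N. G j)"
        unfolding cloak_field_def G_def by (rule boundary_integral_split) (use integrable_on_boundary[OF g] in simp)
      then have "cloak_field \<Omega> v k x - device_field_trunc \<Omega> N \<Gamma> c v k M x = (\<Sum>j=1..N. G j - S j)"
        by (simp add: device_field_trunc_def S_def sum_subtractf)
      also have "\<dots> = (\<Sum>j=1..N. E j)" using GSE by (intro sum.cong) auto
      finally have "cmod (cloak_field \<Omega> v k x - device_field_trunc \<Omega> N \<Gamma> c v k M x) \<le> (\<Sum>j=1..N. C1 * T * trace_mass (\<Gamma> j) v)"
        using Eb by (auto intro!: sum_norm_le)
      also have "\<dots> = C1 * T * (\<Sum>j=1..N. trace_mass (\<Gamma> j) v)" by (simp add: sum_distrib_left)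
      also have "(\<Sum>j=1..N. trace_mass (\<Gamma> j) v) = trace_mass (frontier \<Omega>) v"
        unfolding trace_mass_def by (rule boundary_integral_split[OF trace_integrable[OF v], symmetric])
      finally show "cmod (cloak_field \<Omega> v k x - device_field_trunc \<Omega> N \<Gamma> c v k M x)
        \<le> C1 * trace_mass (frontier \<Omega>) v * (a ^ (M + 1) / (1 - a))" by (simp add: T_def mult_ac)
    }
    fix j and m :: int assume j: "j \<in> {1..N}" and m: "m \<noteq> 0"
    have A: "compact (\<Gamma> j)" using portions[OF j] by blast
    define w where "w = \<i> / 4 * V_wave m k (x - c j)"
    have "multipole_coeff \<Omega> \<Gamma> c v k j m * V_wave m k (x - c j) =
       w * (LINT y:\<Gamma> j|arc_length. - normal_deriv \<Omega> v y * U_wave m k (y - c j) + v y * normal_deriv \<Omega> (\<lambda>y. U_wave m k (y - c j)) y)"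
      by (simp add: multipole_coeff_def w_def)
    also have "\<dots> = (LINT y:\<Gamma> j|arc_length. w * (- normal_deriv \<Omega> v y * U_wave m k (y - c j) + v y * normal_deriv \<Omega> (\<lambda>y. U_wave m k (y - c j)) y))"
      by (rule set_integral_mult_right[symmetric])
    also have "\<dots> = (LINT y:\<Gamma> j|arc_length. - normal_deriv \<Omega> v y * (w * U_wave m k (y - c j)) + v y * (w * normal_deriv \<Omega> (\<lambda>y. U_wave m k (y - c j)) y))"
      by (simp add: algebra_simps)
    also have "cmod \<dots> \<le> (C1 * a ^ (nat \<bar>m\<bar> - 1)) * trace_mass (\<Gamma> j) v"
    proof (rule portion_integral_bound[OF v j])
      show "bounded_borel_on (\<Gamma> j) (\<lambda>y. w * U_wave m k (y - c j))"
        "bounded_borel_on (\<Gamma> j) (\<lambda>y. w * normal_deriv \<Omega> (\<lambda>y. U_wave m k (y - c j)) y)"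
        by (intro bounded_borel_on_mult bounded_borel_on_const A U_wave_on_portion)+
      fix y assume y: "y \<in> \<Gamma> j"
      have w4: "cmod (w * z) \<le> B" if "cmod (V_wave m k (x - c j) * z) \<le> B" for z B
      proof -
        have "cmod (w * z) = cmod (V_wave m k (x - c j) * z) / 4" by (simp add: w_def norm_mult norm_divide)
        then show ?thesis using that norm_ge_zero[of "V_wave m k (x - c j) * z"] by linarith
      qed
      have le: "C * a ^ (nat \<bar>m\<bar> - 1) \<le> C1 * a ^ (nat \<bar>m\<bar> - 1)" using C1 a by (intro mult_right_mono) auto
      show "cmod (w * U_wave m k (y - c j)) \<le> C1 * a ^ (nat \<bar>m\<bar> - 1)"
        by (rule w4, rule order_trans[OF Cbj(3)[OF j y m] le])
      have "C * norm (outward_normal \<Omega> y) * a ^ (nat \<bar>m\<bar> - 1) \<le> C * 1 * a ^ (nat \<bar>m\<bar> - 1)"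
        using C a norm_outward_normal_le[of \<Omega> y] by (intro mult_right_mono mult_left_mono) auto
      then have "C * norm (outward_normal \<Omega> y) * a ^ (nat \<bar>m\<bar> - 1) \<le> C1 * a ^ (nat \<bar>m\<bar> - 1)" using le by simp
      then show "cmod (w * normal_deriv \<Omega> (\<lambda>y. U_wave m k (y - c j)) y) \<le> C1 * a ^ (nat \<bar>m\<bar> - 1)"
        unfolding U_wave_on_portion(3)[OF A] by (intro w4 order_trans[OF Cbj(4)[OF j y m]])
    qed
    finally show "cmod (multipole_coeff \<Omega> \<Gamma> c v k j m * V_wave m k (x - c j)) \<le> C1 * trace_mass (\<Gamma> j) v * a ^ (nat \<bar>m\<bar> - 1)"
      by (simp add: mult_ac)
  qed
qed

lemma summable_on_int_geometric:
  fixes a :: real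
  assumes a: "0 \<le> a" "a < 1"
  shows "(\<lambda>m::int. a ^ (nat \<bar>m\<bar> - 1)) summable_on UNIV"
proof -
  have "summable (\<lambda>n. a ^ n)" using a by (simp add: summable_geometric)
  then have "summable (\<lambda>n. a ^ (n - 1))" by (subst summable_Suc_iff[symmetric]) simp
  then have s: "(\<lambda>n. a ^ (n - 1)) summable_on UNIV"
    using a by (intro norm_summable_imp_summable_on) simp
  have "(\<lambda>m. a ^ (nat \<bar>m\<bar> - 1)) summable_on range int"
    using s by (subst summable_on_reindex) (auto simp: o_def)
  moreover have "(\<lambda>m. a ^ (nat \<bar>m\<bar> - 1)) summable_on range (\<lambda>n. - int n)"
    using s by (subst summable_on_reindex) (auto simp: o_def inj_on_def)
  ultimately have "(\<lambda>m. a ^ (nat \<bar>m\<bar> - 1)) summable_on (range int \<union> range (\<lambda>n. - int n))"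
    by (rule summable_on_union)
  moreover have "range int \<union> range (\<lambda>n. - int n) = UNIV"
  proof -
    have "m \<in> range int \<union> range (\<lambda>n. - int n)" for m by (cases m rule: int_cases2) auto
    then show ?thesis by blast
  qed
  ultimately show ?thesis by simp
qed

text \<open>The intervals \<open>{- M..M}\<close> eventually contain every finite set of orders.\<close>
lemma symmetric_sums_tendsto_infsum:
  fixes f :: "int \<Rightarrow> complex"
  assumes "f summable_on UNIV"
  shows "(\<lambda>M. \<Sum>m=-int M..int M. f m) \<longlonglongrightarrow> infsum f UNIV"
proof -
  have "(sum f \<longlongrightarrow> infsum f UNIV) (finite_subsets_at_top UNIV)"
    using has_sum_infsum[OF assms] by (simp add: has_sum_def)
  moreover have "filterlim (\<lambda>M. {- int M..int M}) (finite_subsets_at_top UNIV) sequentially"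
    unfolding filterlim_finite_subsets_at_top
  proof (intro allI impI)
    fix F :: "int set" assume F: "finite F \<and> F \<subseteq> UNIV"
    define B where "B = Max (insert 0 (abs ` F))"
    have B: "\<bar>m\<bar> \<le> B" if "m \<in> F" for m unfolding B_def using F that by (intro Max_ge) auto
    show "\<forall>\<^sub>F M in sequentially. finite {- int M..int M} \<and> F \<subseteq> {- int M..int M} \<and> {- int M..int M} \<subseteq> UNIV"
      using eventually_ge_at_top[of "nat B"]
    proof eventually_elim
      case (elim M)
      then have "B \<le> int M" by linarith
      then show ?case using B by (force simp: abs_le_iff)
    qed
  qed
  ultimately show ?thesis by (rule filterlim_compose)
qed

text \<open>The error estimate for the one-point sets \<open>{x}\<close> and \<open>{k}\<close>: as \<open>M\<close> grows, the truncated device fields tend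
to the cloak field by the estimate and to the device field by absolute convergence.\<close>
lemma device_field_eq_cloak_field:
  assumes k: "k \<notin> \<real>\<^sub>\<le>\<^sub>0" and x: "x \<notin> device_region N \<Gamma> c" and v: "admissible_trace v"
  shows "\<And>j. j \<in> {1..N} \<Longrightarrow> (\<lambda>m. multipole_coeff \<Omega> \<Gamma> c v k j m * V_wave m k (x - c j)) summable_on UNIV"
    and "cloak_field \<Omega> v k x = device_field \<Omega> N \<Gamma> c v k x"
proof -
  define a where "a = expansion_ratio N \<Gamma> c {x}"
  have X: "compact {x}" "{x} \<noteq> {}" "{x} \<subseteq> - device_region N \<Gamma> c" and K: "compact {k}" "{k} \<subseteq> - \<real>\<^sub>\<le>\<^sub>0"
    using k x by auto
  have a: "0 \<le> a" "a < 1" unfolding a_def by (rule expansion_ratio_facts[OF X])+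
  obtain C where C: "C > 0" and bound: "\<forall>v k' x'. admissible_trace v \<and> k' \<in> {k} \<and> x' \<in> {x} \<longrightarrow>
     (\<forall>M. cmod (cloak_field \<Omega> v k' x' - device_field_trunc \<Omega> N \<Gamma> c v k' M x')
        \<le> C * trace_mass (frontier \<Omega>) v * (a ^ (M + 1) / (1 - a))) \<and>
     (\<forall>j\<in>{1..N}. \<forall>m. m \<noteq> 0 \<longrightarrow> cmod (multipole_coeff \<Omega> \<Gamma> c v k' j m * V_wave m k' (x' - c j))
        \<le> C * trace_mass (\<Gamma> j) v * a ^ (nat \<bar>m\<bar> - 1))"
    using multipole_expansion_error[OF K X, folded a_def] by (elim exE conjE) (rule that)
  have vkx: "admissible_trace v \<and> k \<in> {k} \<and> x \<in> {x}" using v by simp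
  note b = bound[THEN spec, THEN spec, THEN spec, THEN mp, OF vkx]
  note field_bound = b[THEN conjunct1, THEN spec]
  note term_bound = b[THEN conjunct2, THEN bspec, THEN spec, THEN mp]
  show s: "(\<lambda>m. multipole_coeff \<Omega> \<Gamma> c v k j m * V_wave m k (x - c j)) summable_on UNIV" if j: "j \<in> {1..N}" for j
  proof -
    define f where "f m = multipole_coeff \<Omega> \<Gamma> c v k j m * V_wave m k (x - c j)" for m
    define D where "D = C * trace_mass (\<Gamma> j) v + cmod (f 0)"
    have "norm (f m) \<le> D * a ^ (nat \<bar>m\<bar> - 1)" for m
    proof (cases "m = 0")
      case True then show ?thesis using C trace_mass_nonneg by (simp add: D_def)
    next
      case False
      have "norm (f m) \<le> C * trace_mass (\<Gamma> j) v * a ^ (nat \<bar>m\<bar> - 1)" unfolding f_def by (rule term_bound[OF j False])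
      also have "\<dots> \<le> D * a ^ (nat \<bar>m\<bar> - 1)" using a by (intro mult_right_mono) (auto simp: D_def)
      finally show ?thesis .
    qed
    moreover have "(\<lambda>m::int. D * a ^ (nat \<bar>m\<bar> - 1)) summable_on UNIV"
      by (intro summable_on_cmult_right summable_on_int_geometric a)
    ultimately have "(\<lambda>m. norm (f m)) summable_on UNIV"
      by (intro Infinite_Sum.abs_summable_on_comparison_test'[where g = "\<lambda>m. D * a ^ (nat \<bar>m\<bar> - 1)"])
    then show ?thesis unfolding f_def[abs_def] by (rule abs_summable_summable)
  qed
  have "(\<lambda>M. device_field_trunc \<Omega> N \<Gamma> c v k M x) \<longlonglongrightarrow> device_field \<Omega> N \<Gamma> c v k x"
    unfolding device_field_trunc_def device_field_def
    by (intro tendsto_sum symmetric_sums_tendsto_infsum s)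
  moreover have "(\<lambda>M. device_field_trunc \<Omega> N \<Gamma> c v k M x) \<longlonglongrightarrow> cloak_field \<Omega> v k x"
  proof -
    have "(\<lambda>M. C * trace_mass (frontier \<Omega>) v * (a ^ (M + 1) / (1 - a))) \<longlonglongrightarrow> C * trace_mass (frontier \<Omega>) v * (0 / (1 - a))"
      using a by (intro tendsto_intros LIMSEQ_ignore_initial_segment LIMSEQ_power_zero) auto
    then have z: "(\<lambda>M. C * trace_mass (frontier \<Omega>) v * (a ^ (M + 1) / (1 - a))) \<longlonglongrightarrow> 0" by simp
    have "(\<lambda>M. cloak_field \<Omega> v k x - device_field_trunc \<Omega> N \<Gamma> c v k M x) \<longlonglongrightarrow> 0"
      by (rule Lim_null_comparison[OF always_eventually z]) (intro allI field_bound)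
    then show ?thesis by (simp add: LIMSEQ_iff norm_minus_commute)
  qed
  ultimately show "cloak_field \<Omega> v k x = device_field \<Omega> N \<Gamma> c v k x" using LIMSEQ_unique by blast
qed

end

theorem theorem2:
  fixes \<Omega> X :: "(real ^ 2) set"
    and N :: nat
    and \<Gamma> :: "nat \<Rightarrow> (real ^ 2) set"
    and c :: "nat \<Rightarrow> real ^ 2"
    and K :: "complex set"
  assumes "open \<Omega>" and "bounded \<Omega>" and "lipschitz_boundary \<Omega>"
    and "N \<ge> 1"
    and "\<And>j. j \<in> {1..N} \<Longrightarrow> compact (\<Gamma> j) \<and> \<Gamma> j \<noteq> {}"
    and "(\<Union>j\<in>{1..N}. \<Gamma> j) = frontier \<Omega>"
    and "\<And>i j. i \<in> {1..N} \<Longrightarrow> j \<in> {1..N} \<Longrightarrow> i \<noteq> j \<Longrightarrow> finite (\<Gamma> i \<inter> \<Gamma> j)"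
    and "compact K" and "K \<subseteq> - \<real>\<^sub>\<le>\<^sub>0"
    and "compact X" and "X \<noteq> {}" and "X \<subseteq> - device_region N \<Gamma> c"
  shows "expansion_ratio N \<Gamma> c X < 1 \<and>
    (\<exists>C :: (real ^ 2 \<Rightarrow> complex) \<Rightarrow> (real ^ 2 \<Rightarrow> complex) \<Rightarrow> real.
       (\<forall>f g. C f g > 0) \<and>
       (\<forall>D u. open D \<and> closure \<Omega> \<subseteq> D \<and>
              (\<forall>k\<in>K. u k \<in> H1_loc D \<and> weak_helmholtz D k (u k)) \<longrightarrow>
          (\<forall>k\<in>K. \<forall>x\<in>X. \<forall>M :: nat.
             let v = continuous_rep D (u k); a = expansion_ratio N \<Gamma> c X in
             cmod (cloak_field \<Omega> v k x - device_field_trunc \<Omega> N \<Gamma> c v k M x)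
               \<le> C (restrict v (frontier \<Omega>)) (restrict (normal_deriv \<Omega> v) (frontier \<Omega>))
                   * (a ^ (M + 1) / (1 - a))))) \<and>
    (\<forall>D u k x. open D \<and> closure \<Omega> \<subseteq> D \<and>
        k \<notin> \<real>\<^sub>\<le>\<^sub>0 \<and> u k \<in> H1_loc D \<and> weak_helmholtz D k (u k) \<and>
        x \<notin> device_region N \<Gamma> c \<longrightarrow>
        (let v = continuous_rep D (u k) in
           (\<forall>j\<in>{1..N}. (\<lambda>m. multipole_coeff \<Omega> \<Gamma> c v k j m * V_wave m k (x - c j)) summable_on UNIV) \<and>
           cloak_field \<Omega> v k x = device_field \<Omega> N \<Gamma> c v k x))"
proof -
  interpret device_cover \<Omega> N \<Gamma> c by (rule device_cover.intro) (fact assms)+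
  define a where "a = expansion_ratio N \<Gamma> c X"
  note ef = expansion_ratio_facts[OF assms(10-12), folded a_def]
  from multipole_expansion_error[OF assms(8-12), folded a_def]
  obtain C where C: "C > 0" and bound: "\<forall>v k x. admissible_trace v \<and> k \<in> K \<and> x \<in> X \<longrightarrow>
     (\<forall>M. cmod (cloak_field \<Omega> v k x - device_field_trunc \<Omega> N \<Gamma> c v k M x)
        \<le> C * trace_mass (frontier \<Omega>) v * (a ^ (M + 1) / (1 - a))) \<and>
     (\<forall>j\<in>{1..N}. \<forall>m. m \<noteq> 0 \<longrightarrow> cmod (multipole_coeff \<Omega> \<Gamma> c v k j m * V_wave m k (x - c j))
        \<le> C * trace_mass (\<Gamma> j) v * a ^ (nat \<bar>m\<bar> - 1))"
    by (elim exE conjE)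
  have Cb: "cmod (cloak_field \<Omega> v k x - device_field_trunc \<Omega> N \<Gamma> c v k M x) \<le> C * trace_mass (frontier \<Omega>) v * (a ^ (M + 1) / (1 - a))"
    if "admissible_trace v" "k \<in> K" "x \<in> X" for v k x M
    by (rule bound[THEN spec, THEN spec, THEN spec, THEN mp, THEN conjunct1, THEN spec]) (intro conjI that)
  \<comment> \<open>The summand \<open>1\<close> keeps the constant positive when the integral is \<open>0\<close>.\<close>
  define C' where "C' f g = C * (LINT y:frontier \<Omega>|arc_length. cmod (f y) + cmod (g y)) + 1"
    for f g :: "real ^ 2 \<Rightarrow> complex"
  have pos: "C' f g > 0" for f g
  proof -
    have "(LINT y:frontier \<Omega>|arc_length. cmod (f y) + cmod (g y)) \<ge> 0"
      unfolding set_lebesgue_integral_def by (rule Bochner_Integration.integral_nonneg) simp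
    then have "C * (LINT y:frontier \<Omega>|arc_length. cmod (f y) + cmod (g y)) \<ge> 0" using C by simp
    then show ?thesis by (simp add: C'_def)
  qed
  have C': "C' (restrict v (frontier \<Omega>)) (restrict (normal_deriv \<Omega> v) (frontier \<Omega>)) = C * trace_mass (frontier \<Omega>) v + 1" for v
  proof -
    have "(LINT y:frontier \<Omega>|arc_length. cmod (restrict v (frontier \<Omega>) y) + cmod (restrict (normal_deriv \<Omega> v) (frontier \<Omega>) y))
       = trace_mass (frontier \<Omega>) v"
      unfolding trace_mass_def by (rule set_lebesgue_integral_cong) (use boundary_borel in auto)
    then show ?thesis by (simp add: C'_def)
  qed
  have T: "a ^ (M + 1) / (1 - a) \<ge> 0" for M using ef(1,2) by simp
  show ?thesis
  proof (intro conjI exI[of _ C'] allI impI ballI)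
    show "expansion_ratio N \<Gamma> c X < 1" using ef(2) by (simp add: a_def)
    show "C' f g > 0" for f g by (rule pos)
  next
    fix D u k x and M :: nat
    assume "open D \<and> closure \<Omega> \<subseteq> D \<and> (\<forall>k\<in>K. u k \<in> H1_loc D \<and> weak_helmholtz D k (u k))" and k: "k \<in> K" and x: "x \<in> X"
    then have v: "admissible_trace (continuous_rep D (u k))" using helmholtz_admissible_trace by blast
    have "C * trace_mass (frontier \<Omega>) (continuous_rep D (u k)) * (a ^ (M + 1) / (1 - a))
      \<le> (C * trace_mass (frontier \<Omega>) (continuous_rep D (u k)) + 1) * (a ^ (M + 1) / (1 - a))"
      using T[of M] by (intro mult_right_mono) auto
    then show "let v = continuous_rep D (u k); a = expansion_ratio N \<Gamma> c X in
             cmod (cloak_field \<Omega> v k x - device_field_trunc \<Omega> N \<Gamma> c v k M x)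
               \<le> C' (restrict v (frontier \<Omega>)) (restrict (normal_deriv \<Omega> v) (frontier \<Omega>)) * (a ^ (M + 1) / (1 - a))"
      using Cb[OF v k x, of M] unfolding Let_def C' a_def[symmetric] by linarith
  next
    fix D and u :: "complex \<Rightarrow> real ^ 2 \<Rightarrow> complex" and k x
    assume *: "open D \<and> closure \<Omega> \<subseteq> D \<and> k \<notin> \<real>\<^sub>\<le>\<^sub>0 \<and> u k \<in> H1_loc D \<and> weak_helmholtz D k (u k) \<and> x \<notin> device_region N \<Gamma> c"
    then have v: "admissible_trace (continuous_rep D (u k))" using helmholtz_admissible_trace by blast
    show "let v = continuous_rep D (u k) in
           (\<forall>j\<in>{1..N}. (\<lambda>m. multipole_coeff \<Omega> \<Gamma> c v k j m * V_wave m k (x - c j)) summable_on UNIV) \<and>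
           cloak_field \<Omega> v k x = device_field \<Omega> N \<Gamma> c v k x"
      unfolding Let_def using device_field_eq_cloak_field[OF _ _ v, of k x] * by blast
  qed
qed

end
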